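(* Let $Q\subset\mathbb{P}^2$ be a smooth plane quartic with its 28 bitangent lines $L_1,\ldots,L_{28}$, let $I_1,I_2\subset\{1,\ldots,28\}$, and let $\mathcal{L}_{I_1}=(\mathcal{L}_{I_1},\Delta_{I_1})$ and $\mathcal{L}_{I_2}=(\mathcal{L}_{I_2},\Delta_{I_2})$ be the two-graphs associated to $Q+L_{I_1}$ and $Q+L_{I_2}$. If $\mathcal{L}_{I_1}$ and $\mathcal{L}_{I_2}$ are not equivalent as two-graphs, then $(\mathbb{P}^2,Q+L_{I_1})$ and $(\mathbb{P}^2,Q+L_{I_2})$ are not homeomorphic as pairs. If furthermore $Q+L_{I_1}$ and $Q+L_{I_2}$ have the same combinatorial type, then they form a Zariski pair.
   Context: Everything is over $\mathbb{C}$, $\mathbb{P}^2=\mathbb{P}^2(\mathbb{C})$ has its classical topology. A smooth plane quartic $Q$ has exactly 28 bitangent lines $L_1,\ldots,L_{28}$: lines $L$ whose intersection divisor with $Q$ has the form $L|_Q=2D$ with $D$ effective of degree 2 (the two tangent points, possibly coinciding). For $I\subset\{1,\ldots,28\}$ put $Q+L_I=Q+\sum_{i\in I}L_i$ and $\mathcal{L}_I=\{L_i\mid i\in I\}$. A two-graph $(\Omega,\Delta)$ is a finite set $\Omega$ with a set $\Delta$ of 3-element subsets of $\Omega$ such that every 4-element subset of $\Omega$ contains an even number of triples in $\Delta$. Two two-graphs $(\Omega_1,\Delta_1)$, $(\Omega_2,\Delta_2)$ are equivalent if there is a bijection $\psi:\Omega_1\to\Omega_2$ such that $\{a,b,c\}\in\Delta_1$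 if and only if $\{\psi(a),\psi(b),\psi(c)\}\in\Delta_2$. The two-graph associated to $Q+L_I$ is $(\mathcal{L}_I,\Delta_I)$, where $\Delta_I$ is the set of triples $\{L_i,L_j,L_k\}\subset\mathcal{L}_I$ of distinct lines such that there exists a conic (curve of degree 2, possibly reducible) passing through all six tangent points of $Q\cap(L_i+L_j+L_k)$, counted with multiplicity, i.e. a conic $C$ with $C|_Q\ge D_i+D_j+D_k$, where $L_i|_Q=2D_i$. Two plane curves $C_1,C_2\subset\mathbb{P}^2$ have the same combinatorial type (equivalently, the same combinatorics) if there exist tubular neighborhoods $T(C_i)$ of $C_i$ such that the pairs $(T(C_1),C_1)$ and $(T(C_2),C_2)$ are homeomorphic as pairs. They form a Zariski pair if they have the same combinatorial type but $(\mathbb{P}^2,C_1)$ and $(\mathbb{P}^2,C_2)$ are not homeomorphic as pairs. *)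

theory Defs
  imports "HOL-Complex_Analysis.Complex_Analysis" "HOL-Library.Poly_Mapping"
begin

section \<open>The complex projective plane\<close>

definition proportional :: "complex^3 \<Rightarrow> complex^3 \<Rightarrow> bool" where
  "proportional v w \<longleftrightarrow> v \<noteq> 0 \<and> w \<noteq> 0 \<and> (\<exists>c. w = c *s v)"

lemma part_equivp_proportional: "part_equivp proportional"
proof (rule part_equivpI)
  show "\<exists>v. proportional v v"
    by (intro exI[of _ "axis 1 1"]) (auto simp: proportional_def axis_eq_0_iff intro: exI[of _ 1])
  show "symp proportional"
  proof (rule sympI)
    fix v w assume "proportional v w"
    then obtain c where c: "v \<noteq> 0" "w \<noteq> 0" "w = c *s v"
      by (auto simp: proportional_def)
    then have "c \<noteq> 0" by auto
    then have "v = inverse c *s w"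
      using c by (simp add: vector_smult_assoc)
    then show "proportional w v"
      using c(1,2) unfolding proportional_def by blast
  qed
  show "transp proportional"
    by (rule transpI) (auto simp: proportional_def vector_smult_assoc)
qed

quotient_type cp2 = "complex^3" / partial: proportional
  by (rule part_equivp_proportional)

text \<open>The point \<open>[v $ 1 : v $ 2 : v $ 3]\<close>, meaningful for \<open>v \<noteq> 0\<close> only.\<close>

definition proj :: "complex^3 \<Rightarrow> cp2" where
  "proj v = abs_cp2 v"

lemma proj_eq_iff:
  assumes "v \<noteq> 0" "w \<noteq> 0"
  shows "proj v = proj w \<longleftrightarrow> (\<exists>c. w = c *s v)"
proof -
  have refl: "proportional u u" if "u \<noteq> 0" for u
    using that by (auto simp: proportional_def intro: exI[of _ 1])
  have "proj v = proj w \<longleftrightarrow> proportional v w"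
    using Quotient3_rel[OF Quotient3_cp2, of v w] assms refl by (simp add: proj_def)
  then show ?thesis
    using assms by (simp add: proportional_def)
qed

lemma proj_surj: "\<exists>v. v \<noteq> 0 \<and> proj v = p"
  using Quotient3_abs_rep[OF Quotient3_cp2, of p] Quotient3_rep_reflp[OF Quotient3_cp2, of p]
  unfolding proj_def proportional_def by blast

text \<open>The classical topology is the quotient topology of \<open>UNIV - {0}\<close>.\<close>

instantiation cp2 :: topological_space
begin

definition open_cp2 :: "cp2 set \<Rightarrow> bool" where
  "open_cp2 U \<longleftrightarrow> open {v. v \<noteq> 0 \<and> proj v \<in> U}"

instance
proof
  have "{v :: complex^3. v \<noteq> 0 \<and> proj v \<in> UNIV} = - {0}" by auto
  then show "open (UNIV :: cp2 set)" by (simp add: open_cp2_def open_Compl)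
next
  fix S T :: "cp2 set" assume "open S" "open T"
  moreover have "{v. v \<noteq> 0 \<and> proj v \<in> S \<inter> T} =
      {v. v \<noteq> 0 \<and> proj v \<in> S} \<inter> {v. v \<noteq> 0 \<and> proj v \<in> T}" by auto
  ultimately show "open (S \<inter> T)" by (simp add: open_cp2_def open_Int)
next
  fix K :: "cp2 set set" assume "\<forall>S\<in>K. open S"
  moreover have "{v. v \<noteq> 0 \<and> proj v \<in> \<Union>K} = (\<Union>S\<in>K. {v. v \<noteq> 0 \<and> proj v \<in> S})" by auto
  ultimately show "open (\<Union>K)" by (auto simp: open_cp2_def)
qed

end


section \<open>Plane curves\<close>

text \<open>Polynomials in three variables; the outer \<open>keys\<close> are the exponent vectors.\<close>

type_synonym ternary_poly = "(3 \<Rightarrow>\<^sub>0 nat) \<Rightarrow>\<^sub>0 complex"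

definition peval :: "ternary_poly \<Rightarrow> complex^3 \<Rightarrow> complex" where
  "peval F v = (\<Sum>m\<in>Poly_Mapping.keys F. Poly_Mapping.lookup F m *
     (\<Prod>i\<in>UNIV. (v $ i) ^ Poly_Mapping.lookup m i))"

definition is_form :: "nat \<Rightarrow> ternary_poly \<Rightarrow> bool" where
  "is_form d F \<longleftrightarrow>
     F \<noteq> 0 \<and> (\<forall>m\<in>Poly_Mapping.keys F. (\<Sum>i\<in>UNIV. Poly_Mapping.lookup m i) = d)"

definition curve :: "ternary_poly \<Rightarrow> cp2 set" where
  "curve F = proj ` {v. v \<noteq> 0 \<and> peval F v = 0}"

definition partial_deriv :: "3 \<Rightarrow> ternary_poly \<Rightarrow> complex^3 \<Rightarrow> complex" where
  "partial_deriv i F v = deriv (\<lambda>z. peval F (\<chi> j. if j = i then z else v $ j)) (v $ i)"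

definition smooth_curve :: "ternary_poly \<Rightarrow> bool" where
  "smooth_curve F \<longleftrightarrow> (\<forall>v. v \<noteq> 0 \<and> peval F v = 0 \<longrightarrow> (\<exists>i. partial_deriv i F v \<noteq> 0))"

definition smooth_quartic :: "ternary_poly \<Rightarrow> bool" where
  "smooth_quartic Q \<longleftrightarrow> is_form 4 Q \<and> smooth_curve Q"


section \<open>Intersection divisors on a smooth curve\<close>

text \<open>
  \<open>t \<mapsto> proj (\<gamma> t)\<close> is the inverse of a holomorphic chart of the Riemann surface \<open>curve Q\<close>
  centred at \<open>p\<close>. The last condition says that it is immersive at \<open>0\<close>, i.e. that \<open>\<gamma>'(0)\<close> is
  not tangent to the fibre of \<open>proj\<close>.
\<close>

definition local_param ::
    "ternary_poly \<Rightarrow> cp2 \<Rightarrow> (complex \<Rightarrow> complex^3) \<Rightarrow> bool" where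
  "local_param Q p \<gamma> \<longleftrightarrow>
     (\<exists>r>0. (\<forall>i. (\<lambda>t. \<gamma> t $ i) holomorphic_on ball 0 r) \<and>
            (\<forall>t\<in>ball 0 r. \<gamma> t \<noteq> 0 \<and> peval Q (\<gamma> t) = 0)) \<and>
     proj (\<gamma> 0) = p \<and>
     (\<forall>c. (\<chi> i. deriv (\<lambda>t. \<gamma> t $ i) 0) \<noteq> c *s \<gamma> 0)"

text \<open>
  The multiplicity at \<open>p\<close> of the divisor cut out on the smooth curve \<open>Q\<close> by the form \<open>F\<close>: the
  order of vanishing at \<open>p\<close> of the restriction of \<open>F\<close> to \<open>Q\<close>, read in a local coordinate. It
  does not depend on the chart. It is meaningful only if \<open>F\<close> does not vanish identically on a
  component of \<open>Q\<close>; below, \<open>F\<close> is a nonzero form of degree 1 or 2 and \<open>Q\<close> is a smooth quartic.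
\<close>

definition int_mult :: "ternary_poly \<Rightarrow> ternary_poly \<Rightarrow> cp2 \<Rightarrow> nat" where
  "int_mult Q F p =
     (if p \<in> curve Q
      then nat (zorder (\<lambda>t. peval F ((SOME \<gamma>. local_param Q p \<gamma>) t)) 0)
      else 0)"


section \<open>Bitangents\<close>

text \<open>
  Lines are point sets. Effective divisors on \<open>curve Q\<close> are multisets of points. In the next
  definition \<open>set_mset D \<subseteq> curve Q\<close> is automatic, since \<open>int_mult\<close> is \<open>0\<close> off \<open>curve Q\<close>.
\<close>

definition tangency_divisor :: "ternary_poly \<Rightarrow> cp2 set \<Rightarrow> cp2 multiset \<Rightarrow> bool" where
  "tangency_divisor Q M D \<longleftrightarrow>
     (\<exists>l. is_form 1 l \<and> M = curve l \<and> size D = 2 \<and>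
          (\<forall>p. int_mult Q l p = 2 * count D p))"

definition bitangents :: "ternary_poly \<Rightarrow> cp2 set set" where
  "bitangents Q = {M. \<exists>D. tangency_divisor Q M D}"

definition quartic_with_lines :: "ternary_poly \<Rightarrow> cp2 set set \<Rightarrow> cp2 set" where
  "quartic_with_lines Q \<L> = curve Q \<union> \<Union>\<L>"


section \<open>Two-graphs\<close>

definition two_graph :: "'a set \<times> 'a set set \<Rightarrow> bool" where
  "two_graph G \<longleftrightarrow>
     (case G of (\<Omega>, \<Delta>) \<Rightarrow>
       finite \<Omega> \<and> (\<forall>T\<in>\<Delta>. T \<subseteq> \<Omega> \<and> card T = 3) \<and>
       (\<forall>S. S \<subseteq> \<Omega> \<and> card S = 4 \<longrightarrow> even (card {T\<in>\<Delta>. T \<subseteq> S})))"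

text \<open>Equivalence of two-graphs; the axioms \<^const>\<open>two_graph\<close> are not needed to state it.\<close>

definition two_graph_equivalent ::
    "'a set \<times> 'a set set \<Rightarrow> 'b set \<times> 'b set set \<Rightarrow> bool" where
  "two_graph_equivalent G\<^sub>1 G\<^sub>2 \<longleftrightarrow>
     (case (G\<^sub>1, G\<^sub>2) of ((\<Omega>\<^sub>1, \<Delta>\<^sub>1), (\<Omega>\<^sub>2, \<Delta>\<^sub>2)) \<Rightarrow>
       \<exists>\<psi>. bij_betw \<psi> \<Omega>\<^sub>1 \<Omega>\<^sub>2 \<and>
         (\<forall>a\<in>\<Omega>\<^sub>1. \<forall>b\<in>\<Omega>\<^sub>1. \<forall>c\<in>\<Omega>\<^sub>1. {a, b, c} \<in> \<Delta>\<^sub>1 \<longleftrightarrow> {\<psi> a, \<psi> b, \<psi> c} \<in> \<Delta>\<^sub>2))"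

text \<open>The conic \<open>C\<close> may be reducible or non-reduced.\<close>

definition associated_two_graph ::
    "ternary_poly \<Rightarrow> cp2 set set \<Rightarrow> cp2 set set \<times> cp2 set set set" where
  "associated_two_graph Q \<L> =
     (\<L>, {{M\<^sub>1, M\<^sub>2, M\<^sub>3} | M\<^sub>1 M\<^sub>2 M\<^sub>3.
            M\<^sub>1 \<in> \<L> \<and> M\<^sub>2 \<in> \<L> \<and> M\<^sub>3 \<in> \<L> \<and> M\<^sub>1 \<noteq> M\<^sub>2 \<and> M\<^sub>1 \<noteq> M\<^sub>3 \<and> M\<^sub>2 \<noteq> M\<^sub>3 \<and>
            (\<exists>D\<^sub>1 D\<^sub>2 D\<^sub>3 C.
               tangency_divisor Q M\<^sub>1 D\<^sub>1 \<and> tangency_divisor Q M\<^sub>2 D\<^sub>2 \<and> tangency_divisor Q M\<^sub>3 D\<^sub>3 \<and>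
               is_form 2 C \<and> (\<forall>p. count (D\<^sub>1 + D\<^sub>2 + D\<^sub>3) p \<le> int_mult Q C p))})"


section \<open>Zariski pairs\<close>

definition homeomorphic_pairs ::
    "'a::topological_space set \<Rightarrow> 'a set \<Rightarrow> 'b::topological_space set \<Rightarrow> 'b set \<Rightarrow> bool" where
  "homeomorphic_pairs X A Y B \<longleftrightarrow> (\<exists>f g. homeomorphism X Y f g \<and> f ` A = B)"

text \<open>
  Plane curves may be singular, so a tubular neighbourhood is understood as a mapping cylinder
  neighbourhood: a compact neighbourhood \<open>T\<close> of \<open>C\<close> collapsing onto \<open>C\<close> along the arcs
  \<open>\<phi> (x, -)\<close> that join the boundary points \<open>x\<close> to \<open>C\<close> and are disjoint off \<open>C\<close>. For a smooth
  curve, closed disc bundles are of this kind.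
\<close>

definition tubular_neighborhood :: "cp2 set \<Rightarrow> cp2 set \<Rightarrow> bool" where
  "tubular_neighborhood T C \<longleftrightarrow>
     compact T \<and> closed T \<and> C \<subseteq> interior T \<and>
     (\<exists>\<phi> :: cp2 \<times> real \<Rightarrow> cp2.
        continuous_on (frontier T \<times> {0..1}) \<phi> \<and>
        (\<forall>x\<in>frontier T. \<phi> (x, 1) = x) \<and>
        \<phi> ` (frontier T \<times> {0}) = C \<and>
        (\<exists>\<rho>. homeomorphism (frontier T \<times> {0<..1}) (T - C) \<phi> \<rho>))"

definition same_combinatorial_type :: "cp2 set \<Rightarrow> cp2 set \<Rightarrow> bool" where
  "same_combinatorial_type C\<^sub>1 C\<^sub>2 \<longleftrightarrow>
     (\<exists>T\<^sub>1 T\<^sub>2. tubular_neighborhood T\<^sub>1 C\<^sub>1 \<and> tubular_neighborhood T\<^sub>2 C\<^sub>2 \<and>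
              homeomorphic_pairs T\<^sub>1 C\<^sub>1 T\<^sub>2 C\<^sub>2)"

definition zariski_pair :: "cp2 set \<Rightarrow> cp2 set \<Rightarrow> bool" where
  "zariski_pair C\<^sub>1 C\<^sub>2 \<longleftrightarrow>
     same_combinatorial_type C\<^sub>1 C\<^sub>2 \<and> \<not> homeomorphic_pairs UNIV C\<^sub>1 UNIV C\<^sub>2"

end

theory Submission
  imports Defs "HOL-Computational_Algebra.Fundamental_Theorem_Algebra"
begin

text \<open>
  Let \<open>f\<close> be the equation of the quartic. A triple of bitangents belongs to the two-graph exactly
  when a certain double cover of the complement of the quartic splits over the three lines, and
  this double cover is preserved by homeomorphisms of the plane.

  The double cover is that of the pairs of a point \<open>[v]\<close> and a square root of \<open>f v\<close>. Scaling \<open>v\<close>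
  by \<open>c\<close> scales the roots by \<open>c\<^sup>2\<close>, as it does the tensor \<open>v \<otimes> v\<close>, so that the two tensors
  \<open>v \<otimes> v / s\<close> with \<open>s\<^sup>2 = f v\<close> depend only on \<open>[v]\<close>; the function \<open>qroot f\<close> picks one of them at
  every point. A splitting over a set \<open>A\<close> is a choice of signs \<open>\<phi>\<close> that makes \<open>\<phi> p *\<^sub>R qroot f p\<close>
  continuous on \<open>A\<close>, which is the predicate \<open>sec\<close>.

  \<^item> \<^emph>\<open>Algebra\<close> (\<open>conic_iff_section\<close>). The restriction of \<open>f\<close> to a bitangent is the square of a
    binary quadratic form \<open>g\<close> that vanishes in the tangent points, so that the cover splits over
    the bitangent and a splitting is a choice of the sign of \<open>g\<close>. Two bitangents meet off the
    quartic, so the cover splits over three of them if and only if the three signs can be chosen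
    in such a way that the forms agree in the points of intersection. Forms that agree there are
    the restrictions of one conic \<open>C\<close>; its square is \<open>f\<close> on the three lines, so it passes
    through the six tangent points. Conversely, a conic through these points is proportional to
    \<open>g\<close> on each of the lines, and comparing the squares in the points of intersection shows that
    the three factors of proportionality agree up to sign.

  \<^item> \<^emph>\<open>Invariance of the cover\<close> (\<open>qroot_sec_homeo\<close>). Let \<open>h\<close> be a homeomorphism of the plane that
    maps the quartic to itself. Both the cover and its pullback under \<open>h\<close> are non-trivial around
    every point of the quartic, where the complement of the quartic looks like the product of a
    disc with a punctured disc. Such a product has only one non-trivial double cover, so the
    product of the two covers is trivial around every point of the quartic. It follows that it
    extends to the plane, which is simply connected; it is therefore trivial, and the two covers
    are isomorphic.

  \<^item> \<^emph>\<open>Recognising the quartic and the lines\<close> (\<open>homeo_preserves_components\<close>). A homeomorphism that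
    maps one union of the quartic with bitangents to another one preserves the points that lie on
    several components, since the union is locally irreducible precisely at the other points. A
    line without finitely many points is connected, so each line is mapped into one component.
    Suppose that some line is mapped into the quartic. By local irreducibility, the rest of the
    preimage of the quartic is a part of the quartic that is open and closed in it and misses this
    line. By the maximum principle such a part is empty, so that the line is mapped onto the quartic.
    This is impossible, because the complement of a line is an affine plane, over which every
    double cover splits. Hence the lines are mapped to lines, and the quartic to itself.
\<close>

\<comment> \<open>the dollar sign denotes components of vectors only\<close>
no_notation fps_nth (infixl \<open>$\<close> 75)

section \<open>Homogeneous forms\<close>

text \<open>A polynomial function on \<open>complex^3\<close> that is homogeneous of degree \<open>d\<close>. The recursion extracts one
  linear factor from each monomial, so that properties of forms follow by induction on the degree.\<close>

primrec hform :: "nat \<Rightarrow> (complex^3 \<Rightarrow> complex) \<Rightarrow> bool" where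
  "hform 0 F = (\<exists>c. F = (\<lambda>_. c))"
| "hform (Suc d) F = (\<exists>G. (\<forall>i. hform d (G i)) \<and> F = (\<lambda>v. \<Sum>i\<in>UNIV. v $ i * G i v))"

lemma hform_zero: "hform d (\<lambda>_. 0)"
proof (induction d)
  case (Suc d)
  then show ?case by (auto intro!: exI[of _ "\<lambda>_ _. 0"])
qed auto

lemma hform_add: "hform d F \<Longrightarrow> hform d G \<Longrightarrow> hform d (\<lambda>v. F v + G v)"
proof (induction d arbitrary: F G)
  case (Suc d)
  then obtain F' G' where "\<And>i. hform d (F' i)" "F = (\<lambda>v. \<Sum>i\<in>UNIV. v $ i * F' i v)"
     "\<And>i. hform d (G' i)" "G = (\<lambda>v. \<Sum>i\<in>UNIV. v $ i * G' i v)" by auto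
  with Suc.IH show ?case
    by (auto intro!: exI[of _ "\<lambda>i v. F' i v + G' i v"] simp: sum.distrib algebra_simps)
qed auto

lemma hform_cmult: "hform d F \<Longrightarrow> hform d (\<lambda>v. c * F v)"
proof (induction d arbitrary: F)
  case (Suc d)
  then obtain F' where "\<And>i. hform d (F' i)" "F = (\<lambda>v. \<Sum>i\<in>UNIV. v $ i * F' i v)" by auto
  with Suc.IH show ?case
    by (auto intro!: exI[of _ "\<lambda>i v. c * F' i v"] simp: sum_distrib_left algebra_simps)
qed auto

lemma hform_diff: "hform d F \<Longrightarrow> hform d G \<Longrightarrow> hform d (\<lambda>v. F v - G v)"
  using hform_add[of d F "\<lambda>v. -1 * G v"] hform_cmult[of d G "-1"] by simp

lemma hform_sum: "(\<And>i. i \<in> I \<Longrightarrow> hform d (F i)) \<Longrightarrow> hform d (\<lambda>v. \<Sum>i\<in>I. F i v)"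
  by (induction I rule: infinite_finite_induct) (auto simp: hform_zero intro: hform_add)

lemma hform_mult: "hform d F \<Longrightarrow> hform e G \<Longrightarrow> hform (d + e) (\<lambda>v. F v * G v)"
proof (induction d arbitrary: F)
  case 0
  then obtain c where "F = (\<lambda>_. c)" by auto
  then show ?case using hform_cmult[OF 0(2)] by simp
next
  case (Suc d)
  then obtain F' where F': "\<And>i. hform d (F' i)" "F = (\<lambda>v. \<Sum>i\<in>UNIV. v $ i * F' i v)" by auto
  have "hform (d + e) (\<lambda>v. F' i v * G v)" for i by (rule Suc.IH[OF F'(1) Suc.prems(2)])
  then show ?case unfolding F'(2) add_Suc hform.simps
    by (intro exI[of _ "\<lambda>i v. F' i v * G v"]) (auto simp: sum_distrib_right mult.assoc)
qed

lemma hform_power: "hform d F \<Longrightarrow> hform (n * d) (\<lambda>v. F v ^ n)"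
  by (induction n) (auto dest: hform_mult)

lemma hform_coord: "hform 1 (\<lambda>v. v $ i)"
  by (auto intro!: exI[of _ "\<lambda>j _. if j = i then 1 else 0"] simp: if_distrib cong: if_cong)

lemma hform_1_iff: "hform 1 F \<longleftrightarrow> (\<exists>a. F = (\<lambda>v. \<Sum>i\<in>UNIV. a i * v $ i))"
proof
  assume "hform 1 F"
  then obtain G where G: "\<And>i. \<exists>c. G i = (\<lambda>_. c)" "F = (\<lambda>v. \<Sum>i\<in>UNIV. v $ i * G i v)"
    by auto
  then obtain a where "\<And>i. G i = (\<lambda>_. a i)" by metis
  with G(2) show "\<exists>a. F = (\<lambda>v. \<Sum>i\<in>UNIV. a i * v $ i)" by (auto simp: mult.commute)
next
  assume "\<exists>a. F = (\<lambda>v. \<Sum>i\<in>UNIV. a i * v $ i)"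
  then obtain a where "F = (\<lambda>v. \<Sum>i\<in>UNIV. a i * v $ i)" by blast
  then show "hform 1 F" by (auto intro!: exI[of _ "\<lambda>i _. a i"] simp: mult.commute)
qed

declare hform.simps [simp del]

lemma hform_SucE:
  assumes "hform (Suc d) F"
  obtains G where "\<And>i. hform d (G i)" "F = (\<lambda>v. \<Sum>i\<in>UNIV. v $ i * G i v)"
  using assms by (auto simp: hform.simps)

lemma hform_SucI: "(\<And>i. hform d (G i)) \<Longrightarrow> hform (Suc d) (\<lambda>v. \<Sum>i\<in>UNIV. v $ i * G i v)"
  by (auto simp: hform.simps)

lemma hform_const: "hform 0 (\<lambda>_. c)"
  by (auto simp: hform.simps)

lemma hform_subst:
  assumes "\<And>i. hform 1 (\<lambda>v. T v $ i)"
  shows "hform d F \<Longrightarrow> hform d (\<lambda>v. F (T v))"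
proof (induction d arbitrary: F)
  case (Suc d)
  obtain F' where F': "\<And>i. hform d (F' i)" "F = (\<lambda>v. \<Sum>i\<in>UNIV. v $ i * F' i v)"
    using hform_SucE[OF Suc.prems] by blast
  have "hform (1 + d) (\<lambda>v. T v $ i * F' i (T v))" for i
    by (intro hform_mult assms Suc.IH F')
  then show ?case unfolding F'(2) by (intro hform_sum) simp
qed (fastforce simp: hform.simps)

lemma hform_1_linear:
  assumes "hform 1 l"
  shows "l (v + w) = l v + l w" "l (v - w) = l v - l w" "l (c *s v) = c * l v" "l 0 = 0"
  using assms unfolding hform_1_iff
  by (auto simp: algebra_simps sum.distrib sum_subtractf sum_distrib_left)

lemma hform_scale: "hform d F \<Longrightarrow> F (c *s v) = c ^ d * F v"
proof (induction d arbitrary: F)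
  case (Suc d)
  obtain F' where F': "\<And>i. hform d (F' i)" "F = (\<lambda>v. \<Sum>i\<in>UNIV. v $ i * F' i v)"
    using hform_SucE[OF Suc.prems] by blast
  have "F' i (c *s v) = c ^ d * F' i v" for i by (rule Suc.IH[OF F'(1)])
  then show ?case unfolding F'(2) by (simp add: sum_distrib_left mult_ac)
qed (fastforce simp: hform.simps)

lemma hform_continuous: "hform d F \<Longrightarrow> continuous_on S F"
  by (induction d arbitrary: F) (auto simp: hform.simps intro!: continuous_intros)

lemma hform_continuous_comp:
  "hform d F \<Longrightarrow> continuous_on S u \<Longrightarrow> continuous_on S (\<lambda>x. F (u x))"
  by (rule continuous_on_compose2[OF hform_continuous[where S=UNIV]]) auto

lemma hform_holomorphic:
  assumes "\<And>i. (\<lambda>t. u t $ i) holomorphic_on S"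
  shows "hform d F \<Longrightarrow> (\<lambda>t. F (u t)) holomorphic_on S"
  by (induction d arbitrary: F) (auto simp: hform.simps intro!: holomorphic_intros assms)

text \<open>Along a line the form is a polynomial in the parameter, whose coefficient in the top degree is
  the value in the direction of the line, that is, at its point at infinity.\<close>

lemma hform_poly:
  "hform d F \<Longrightarrow> \<exists>p. degree p \<le> d \<and> coeff p d = F b \<and> (\<forall>s. poly p s = F (a + s *s b))"
proof (induction d arbitrary: F)
  case 0
  then obtain c where "F = (\<lambda>_. c)" by (auto simp: hform.simps)
  then show ?case by (intro exI[of _ "[:c:]"]) auto
next
  case (Suc d)
  obtain F' where F': "\<And>i. hform d (F' i)" "F = (\<lambda>v. \<Sum>i\<in>UNIV. v $ i * F' i v)"
    using hform_SucE[OF Suc.prems] by blast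
  from Suc.IH[OF F'(1)] obtain P where P: "\<And>i. degree (P i) \<le> d" "\<And>i. coeff (P i) d = F' i b"
      "\<And>i s. poly (P i) s = F' i (a + s *s b)" by metis
  let ?p = "\<Sum>i\<in>UNIV. [:a $ i, b $ i:] * P i"
  have "degree ([:a $ i, b $ i:] * P i) \<le> Suc d" for i
    by (rule order.trans[OF degree_mult_le]) (use P(1)[of i] in auto)
  then have "degree ?p \<le> Suc d" by (intro degree_sum_le) auto
  moreover have "coeff (P i) (Suc d) = 0" for i using P(1)[of i] by (simp add: coeff_eq_0)
  then have "coeff ?p (Suc d) = F b" by (simp add: coeff_sum F'(2) P(2))
  moreover have "poly ?p s = F (a + s *s b)" for s
    by (simp add: poly_sum P(3) F'(2) algebra_simps)
  ultimately show ?case by blast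
qed

text \<open>Division by a linear form \<open>l\<close>: if \<open>l w = 1\<close>, then \<open>v - l v *s w\<close> is the projection of \<open>v\<close> to the
  kernel of \<open>l\<close>, and the remainder is the restriction of \<open>F\<close> to that kernel.\<close>

lemma hform_divide:
  assumes l: "hform 1 l"
  shows "hform (Suc d) F \<Longrightarrow> \<exists>G. hform d G \<and> (\<forall>v. F v = F (v - l v *s w) + l v * G v)"
proof (induction d arbitrary: F)
  case 0
  then have "hform 1 F" by (simp only: One_nat_def)
  have "F v = F (v - l v *s w) + l v * F w" for v
    by (simp only: hform_1_linear[OF \<open>hform 1 F\<close>]) simp
  moreover have "hform 0 (\<lambda>_. F w)" by (rule hform_const)
  ultimately show ?case by blast
next
  case (Suc d)
  obtain F' where F': "\<And>i. hform (Suc d) (F' i)" "F = (\<lambda>v. \<Sum>i\<in>UNIV. v $ i * F' i v)"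
    using hform_SucE[OF Suc.prems] by blast
  from Suc.IH[OF F'(1)] obtain G where G: "\<And>i. hform d (G i)"
      "\<And>i v. F' i v = F' i (v - l v *s w) + l v * G i v" by metis
  have T: "hform 1 (\<lambda>v. (v - l v *s w) $ i)" for i
  proof -
    have "(\<lambda>v. (v - l v *s w) $ i) = (\<lambda>v. v $ i - w $ i * l v)" by (auto simp: mult.commute)
    then show ?thesis using hform_diff[OF hform_coord[of i] hform_cmult[OF l, of "w $ i"]] by (simp only:)
  qed
  let ?G = "\<lambda>v. (\<Sum>i\<in>UNIV. w $ i * F' i (v - l v *s w)) + (\<Sum>i\<in>UNIV. v $ i * G i v)"
  have "hform (Suc d) ?G"
  proof (rule hform_add)
    show "hform (Suc d) (\<lambda>v. \<Sum>i\<in>UNIV. w $ i * F' i (v - l v *s w))"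
      by (intro hform_sum hform_cmult hform_subst[OF T F'(1)])
  qed (intro hform_SucI G(1))
  moreover have "F v = F (v - l v *s w) + l v * ?G v" for v
  proof -
    have "F v = (\<Sum>i\<in>UNIV. v $ i * F' i v)"
      by (simp only: F'(2))
    also have "\<dots> = (\<Sum>i\<in>UNIV. v $ i * (F' i (v - l v *s w) + l v * G i v))"
      by (simp only: G(2)[symmetric])
    also have "\<dots> = (\<Sum>i\<in>UNIV. (v - l v *s w) $ i * F' i (v - l v *s w)) + l v * ?G v"
      unfolding distrib_left sum_distrib_left sum.distrib[symmetric]
      by (intro sum.cong refl) (simp add: algebra_simps)
    also have "(\<Sum>i\<in>UNIV. (v - l v *s w) $ i * F' i (v - l v *s w)) = F (v - l v *s w)"
      by (simp only: F'(2))
    finally show ?thesis .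
  qed
  ultimately show ?case by blast
qed

lemma hform_dvd_linear:
  assumes "hform 1 l" "l w \<noteq> 0" "hform (Suc d) F" "\<And>v. l v = 0 \<Longrightarrow> F v = 0"
  obtains G where "hform d G" "\<And>v. F v = l v * G v"
proof -
  obtain G where G: "hform d G" "\<And>v. F v = F (v - l v *s (inverse (l w) *s w)) + l v * G v"
    using hform_divide[OF assms(1,3)] by blast
  have "l (v - l v *s (inverse (l w) *s w)) = 0" for v
    using assms(2) by (simp add: hform_1_linear[OF assms(1)])
  then have "F (v - l v *s (inverse (l w) *s w)) = 0" for v by (rule assms(4))
  then have "F v = l v * G v" for v using G(2)[of v] by simp
  with G(1) that show ?thesis by blast
qed

definition hderiv :: "(complex^3 \<Rightarrow> complex) \<Rightarrow> complex^3 \<Rightarrow> complex^3 \<Rightarrow> complex" where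
  "hderiv F v = frechet_derivative F (at v)"

lemma hform_has_derivative_ex:
  "hform d F \<Longrightarrow> \<exists>F'. (\<forall>v. (F has_derivative F' v) (at v)) \<and> (\<forall>v c w. F' v (c *s w) = c * F' v w) \<and>
     (\<forall>v. F' v v = of_nat d * F v) \<and> (\<forall>w. continuous_on UNIV (\<lambda>v. F' v w))"
proof (induction d arbitrary: F)
  case 0
  then show ?case by (auto simp: hform.simps intro!: exI[of _ "\<lambda>_ _. 0"])
next
  case (Suc d)
  obtain F' where F': "\<And>i. hform d (F' i)" "F = (\<lambda>v. \<Sum>i\<in>UNIV. v $ i * F' i v)"
    using hform_SucE[OF Suc.prems] by blast
  from Suc.IH[OF F'(1)] obtain D where
    D: "\<And>i v. (F' i has_derivative D i v) (at v)" "\<And>i v c w. D i v (c *s w) = c * D i v w"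
      "\<And>i v. D i v v = of_nat d * F' i v" "\<And>i w. continuous_on UNIV (\<lambda>v. D i v w)"
    by metis
  let ?D = "\<lambda>v w. \<Sum>i\<in>UNIV. w $ i * F' i v + v $ i * D i v w"
  have "(F has_derivative ?D v) (at v)" for v
    unfolding F'(2)
    by (rule has_derivative_sum)
      (auto intro!: derivative_eq_intros D bounded_linear.has_derivative[OF bounded_linear_vec_nth] simp: algebra_simps)
  moreover have "?D v (c *s w) = c * ?D v w" for v c w
    by (simp add: D sum_distrib_left algebra_simps)
  moreover have "?D v v = of_nat (Suc d) * F v" for v
    by (simp add: D(3) F'(2) sum_distrib_left algebra_simps sum.distrib)
  moreover have "continuous_on UNIV (\<lambda>v. ?D v w)" for w
    by (intro continuous_intros D(4) hform_continuous[OF F'(1)])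
  ultimately show ?case by (intro exI[of _ ?D]) auto
qed

lemma
  assumes "hform d F"
  shows hform_has_derivative: "(F has_derivative hderiv F v) (at v)"
    and hderiv_scale: "hderiv F v (c *s w) = c * hderiv F v w"
    and hderiv_euler: "hderiv F v v = of_nat d * F v"
    and hderiv_continuous: "continuous_on UNIV (\<lambda>v. hderiv F v w)"
proof -
  obtain F' where F': "\<And>v. (F has_derivative F' v) (at v)" "\<And>v c w. F' v (c *s w) = c * F' v w"
     "\<And>v. F' v v = of_nat d * F v" "\<And>w. continuous_on UNIV (\<lambda>v. F' v w)"
    using hform_has_derivative_ex[OF assms] by metis
  have "hderiv F v = F' v" for v unfolding hderiv_def using frechet_derivative_at[OF F'(1)] by simp
  then have "hderiv F = F'" by blast
  with F' show "(F has_derivative hderiv F v) (at v)" "hderiv F v (c *s w) = c * hderiv F v w"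
    "hderiv F v v = of_nat d * F v" "continuous_on UNIV (\<lambda>v. hderiv F v w)" by auto
qed

lemma hderiv_add: "hform d F \<Longrightarrow> hderiv F v (w + w') = hderiv F v w + hderiv F v w'"
  using hform_has_derivative has_derivative_linear linear_add by blast

lemma has_derivative_vec_complex:
  fixes u :: "'a::real_normed_vector \<Rightarrow> complex^'n"
  assumes "\<And>i. ((\<lambda>t. u t $ i) has_derivative (\<lambda>s. D s $ i)) (at a within S)"
  shows "(u has_derivative D) (at a within S)"
  unfolding has_derivative_componentwise_within[of u D]
proof
  fix b :: "complex^'n" assume "b \<in> Basis"
  then obtain i c where "b = axis i c" "c \<in> Basis" by (auto simp: Basis_vec_def)
  then show "((\<lambda>x. u x \<bullet> b) has_derivative (\<lambda>x. D x \<bullet> b)) (at a within S)"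
    using assms[of i] by (simp add: inner_axis has_derivative_inner_left)
qed

lemma hform_has_field_derivative:
  assumes F: "hform d F" and u: "\<And>i. ((\<lambda>t. u t $ i) has_field_derivative u' $ i) (at t)"
  shows "((\<lambda>t. F (u t)) has_field_derivative hderiv F (u t) u') (at t)"
proof -
  have *: "(*) c = (\<lambda>s. s * c)" for c :: complex by (rule ext) (rule mult.commute)
  have "((\<lambda>t. u t $ i) has_derivative (\<lambda>s. (s *s u') $ i)) (at t)" for i
    using u[of i] unfolding has_field_derivative_def *[of "u' $ i"] by simp
  then have "(u has_derivative (\<lambda>s. s *s u')) (at t)"
    by (rule has_derivative_vec_complex)
  then have "((\<lambda>t. F (u t)) has_derivative (\<lambda>s. hderiv F (u t) (s *s u'))) (at t)"
    using has_derivative_compose[of u _ t UNIV F] hform_has_derivative[OF F] by blast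
  then show ?thesis
    unfolding has_field_derivative_def hderiv_scale[OF F] *[of "hderiv F (u t) u'"] .
qed

lemma hform_peval:
  assumes "\<forall>m\<in>Poly_Mapping.keys F. (\<Sum>i\<in>UNIV. Poly_Mapping.lookup m i) = d"
  shows "hform d (peval F)"
proof -
  have mono: "hform (\<Sum>i\<in>I. k i) (\<lambda>v. \<Prod>i\<in>I. v $ i ^ k i)" if "finite I" for I :: "3 set" and k
    using that
  proof (induction I rule: finite_induct)
    case (insert i I)
    then show ?case using hform_mult[OF hform_power[OF hform_coord[of i], of "k i"] insert.IH] by simp
  qed (auto intro: hform_const)
  have "hform d (\<lambda>v. \<Prod>i\<in>UNIV. v $ i ^ Poly_Mapping.lookup m i)" if "m \<in> Poly_Mapping.keys F" for m
    using mono[of UNIV "Poly_Mapping.lookup m"] assms that by auto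
  then show ?thesis unfolding peval_def[abs_def] by (intro hform_sum hform_cmult)
qed

lemma form_hform: "is_form d F \<Longrightarrow> hform d (peval F)"
  by (auto simp: is_form_def intro: hform_peval)

lemma peval_add: "peval (F + G) v = peval F v + peval G v"
proof -
  let ?K = "Poly_Mapping.keys F \<union> Poly_Mapping.keys G"
  have *: "peval H v = (\<Sum>m\<in>?K. Poly_Mapping.lookup H m * (\<Prod>i\<in>UNIV. (v $ i) ^ Poly_Mapping.lookup m i))"
    if "Poly_Mapping.keys H \<subseteq> ?K" for H
    unfolding peval_def using that by (intro sum.mono_neutral_left) (auto simp: in_keys_iff)
  show ?thesis
    by (subst (1 2 3) *) (auto simp: Poly_Mapping.keys_add lookup_add algebra_simps sum.distrib
        dest: subsetD[OF Poly_Mapping.keys_add])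
qed

lemma peval_0: "peval 0 v = 0" by (simp add: peval_def)

lemma peval_sum: "peval (\<Sum>i\<in>I. F i) v = (\<Sum>i\<in>I. peval (F i) v)"
  by (induction I rule: infinite_finite_induct) (auto simp: peval_add peval_0)

lemma hform_2_ex_form:
  assumes "hform 2 F" "F v \<noteq> 0"
  obtains P where "is_form 2 P" "peval P = F"
proof -
  obtain G where G: "\<And>i. hform 1 (G i)" "F = (\<lambda>v. \<Sum>i\<in>UNIV. v $ i * G i v)"
    using hform_SucE[of 1 F] assms(1) by (auto simp: numeral_2_eq_2)
  then obtain a where a: "\<And>i. G i = (\<lambda>v. \<Sum>j\<in>UNIV. a i j * v $ j)"
    unfolding hform_1_iff by metis
  define e :: "3 \<Rightarrow> (3 \<Rightarrow>\<^sub>0 nat)" where "e i = Poly_Mapping.single i 1" for i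
  define P where "P = (\<Sum>i\<in>UNIV. \<Sum>j\<in>UNIV. Poly_Mapping.single (e i + e j) (a i j))"
  have e: "Poly_Mapping.lookup (e i + e j) k = (if k = i then 1 else 0) + (if k = j then 1 else 0)" for i j k
    by (auto simp: e_def lookup_add lookup_single when_def)
  have "(\<Prod>k\<in>UNIV. v $ k ^ Poly_Mapping.lookup (e i + e j) k) = v $ i * v $ j" for i j and v :: "complex^3"
    unfolding e power_add prod.distrib by (simp add: if_distrib[of "\<lambda>n. _ ^ n"] cong: if_cong)
  then have "peval (Poly_Mapping.single (e i + e j) c) v = c * (v $ i * v $ j)" for i j c v
    by (simp add: peval_def)
  then have eq: "peval P = F"
    by (auto simp: P_def peval_sum G(2) a sum_distrib_left fun_eq_iff intro!: sum.cong)
  have "(\<Sum>k\<in>UNIV. Poly_Mapping.lookup (e i + e j) k) = 2" for i j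
    unfolding e sum.distrib by simp
  moreover have "\<exists>i j. m = e i + e j" if "m \<in> Poly_Mapping.keys P" for m
    using that unfolding P_def
    by (fastforce dest!: subsetD[OF Poly_Mapping.keys_sum] split: if_splits)
  moreover have "P \<noteq> 0" using eq assms(2) peval_0 by metis
  ultimately have "is_form 2 P" unfolding is_form_def by metis
  with eq that show ?thesis by blast
qed

text \<open>Kronecker substitution: along \<open>t \<mapsto> (t, t^3, t^9)\<close> the monomials of degree at most 2 become distinct
  powers of \<open>t\<close>, because their exponents are the digits of a number in base 3.\<close>

lemma form_nonzero:
  assumes P: "is_form d P" and d: "d \<le> 2"
  obtains v where "peval P v \<noteq> 0"
proof (rule ccontr)
  assume "\<not> thesis"
  with that have 0: "peval P v = 0" for v by blast
  define N :: "(3 \<Rightarrow>\<^sub>0 nat) \<Rightarrow> nat" where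
    "N m = Poly_Mapping.lookup m 1 + 3 * Poly_Mapping.lookup m 2 + 9 * Poly_Mapping.lookup m 3" for m
  have digits: "a = a' \<and> b = b' \<and> c = c'"
    if "a + b + c \<le> 2" "a' + b' + c' \<le> 2" "a + 3 * b + 9 * c = a' + 3 * b' + 9 * c'" for a b c a' b' c' :: nat
  proof -
    have "\<not> c < c'" "\<not> c' < c" using that by linarith+
    then have c: "c = c'" by simp
    have "\<not> b < b'" "\<not> b' < b" using that c by linarith+
    then have b: "b = b'" by simp
    show ?thesis using that b c by simp
  qed
  have inj: "m = m'" if "m \<in> Poly_Mapping.keys P" "m' \<in> Poly_Mapping.keys P" "N m = N m'" for m m'
  proof -
    have "Poly_Mapping.lookup k 1 + Poly_Mapping.lookup k 2 + Poly_Mapping.lookup k 3 \<le> 2"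
      if "k \<in> Poly_Mapping.keys P" for k
      using P d that by (auto simp: is_form_def sum_3)
    from this[OF that(1)] this[OF that(2)] that(3)
    have "Poly_Mapping.lookup m 1 = Poly_Mapping.lookup m' 1 \<and> Poly_Mapping.lookup m 2 = Poly_Mapping.lookup m' 2
       \<and> Poly_Mapping.lookup m 3 = Poly_Mapping.lookup m' 3"
      unfolding N_def by (rule digits)
    then have "\<forall>i. Poly_Mapping.lookup m i = Poly_Mapping.lookup m' i"
      unfolding forall_3 by simp
    then show ?thesis by (intro poly_mapping_eqI) auto
  qed
  define p where "p = (\<Sum>m\<in>Poly_Mapping.keys P. monom (Poly_Mapping.lookup P m) (N m))"
  have "poly p t = 0" for t
  proof -
    let ?v = "vector [t, t^3, t^9] :: complex^3"
    have prod3: "(\<Prod>i\<in>UNIV. g i) = g 1 * g 2 * g 3" for g :: "3 \<Rightarrow> complex"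
      unfolding UNIV_3 by (simp add: mult.assoc)
    have "(\<Prod>i\<in>UNIV. ?v $ i ^ Poly_Mapping.lookup m i) = t ^ N m" for m
      unfolding prod3 by (simp add: N_def power_add power_mult)
    then have "poly p t = peval P ?v"
      by (simp add: p_def poly_sum poly_monom peval_def)
    then show ?thesis using 0 by simp
  qed
  then have "p = 0" by (metis poly_all_0_iff_0)
  have "Poly_Mapping.keys P \<noteq> {}" using P by (simp add: is_form_def)
  then obtain m where m: "m \<in> Poly_Mapping.keys P" by blast
  have "coeff p (N m) = (\<Sum>m'\<in>Poly_Mapping.keys P. if m' = m then Poly_Mapping.lookup P m else 0)"
    unfolding p_def coeff_sum coeff_monom using inj m by (intro sum.cong) auto
  also have "\<dots> = Poly_Mapping.lookup P m" using m by simp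
  finally show False using m \<open>p = 0\<close> by (simp add: in_keys_iff)
qed

lemma partial_deriv_eq:
  assumes "hform d (peval F)"
  shows "partial_deriv i F v = hderiv (peval F) v (axis i 1)"
proof -
  have D: "((\<lambda>z. peval F (\<chi> j. if j = i then z else v $ j)) has_field_derivative
      hderiv (peval F) (\<chi> j. if j = i then v $ i else v $ j) (axis i 1)) (at (v $ i))"
  proof (rule hform_has_field_derivative[OF assms, of "\<lambda>z. \<chi> j. if j = i then z else v $ j" "axis i 1" "v $ i"])
    fix j show "((\<lambda>z. (\<chi> j. if j = i then z else v $ j) $ j) has_field_derivative axis i 1 $ j) (at (v $ i))"
    proof (cases "j = i")
      case True
      then show ?thesis unfolding vec_lambda_beta axis_def by simp
    next
      case False
      then show ?thesis unfolding vec_lambda_beta axis_def by simp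
    qed
  qed
  have E: "(\<chi> j. if j = i then v $ i else v $ j) = v"
    unfolding vec_eq_iff vec_lambda_beta by auto
  show ?thesis unfolding partial_deriv_def by (rule DERIV_imp_deriv[OF D[unfolded E]])
qed

text \<open>A line meets every curve of positive degree: either the restricted equation has a root, or its
  degree drops, which means that the point at infinity of the line is on the curve.\<close>

lemma hform_zero_on_line:
  assumes F: "hform (Suc d) F" and a: "\<And>s. a + s *s b \<noteq> 0" and "b \<noteq> 0"
  shows "F b = 0 \<or> (\<exists>s. F (a + s *s b) = 0)"
proof -
  obtain p where p: "degree p \<le> Suc d" "coeff p (Suc d) = F b" "\<And>s. poly p s = F (a + s *s b)"
    using hform_poly[OF F] by metis
  show ?thesis
  proof (cases "F b = 0")
    case False
    with p have "degree p \<noteq> 0" by (metis coeff_eq_0 zero_less_Suc gr0I)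
    then have "\<not> constant (poly p)" by (simp add: constant_degree)
    then show ?thesis using Fundamental_Theorem_Algebra.fundamental_theorem_of_algebra[of p] p(3) by auto
  qed simp
qed

section \<open>Topology of the projective plane\<close>

lemma vec_smult_eq_0_iff: "c *s v = 0 \<longleftrightarrow> c = 0 \<or> v = (0 :: complex^'n)"
  by (auto simp: vec_eq_iff)

lemma proj_scale: "v \<noteq> 0 \<Longrightarrow> c \<noteq> 0 \<Longrightarrow> proj (c *s v) = proj v"
  by (subst eq_commute, subst proj_eq_iff) (auto simp: vec_smult_eq_0_iff)

lemma proj_eqE:
  assumes "proj v = proj w" "v \<noteq> 0" "w \<noteq> 0"
  obtains c where "c \<noteq> 0" "w = c *s v"
  using assms proj_eq_iff by force

lemma continuous_on_proj: "continuous_on (- {0}) proj"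
proof (subst continuous_on_open_vimage)
  show "\<forall>B. open B \<longrightarrow> open (proj -` B \<inter> - {0})"
  proof (intro allI impI)
    fix B :: "cp2 set" assume "open B"
    moreover have "proj -` B \<inter> - {0} = {v. v \<noteq> 0 \<and> proj v \<in> B}" by auto
    ultimately show "open (proj -` B \<inter> - {0})" by (simp add: open_cp2_def)
  qed
qed auto

lemma continuous_on_proj_comp:
  "continuous_on S u \<Longrightarrow> (\<And>x. x \<in> S \<Longrightarrow> u x \<noteq> 0) \<Longrightarrow> continuous_on S (\<lambda>x. proj (u x))"
  by (rule continuous_on_compose2[OF continuous_on_proj]) auto

lemma continuous_on_vec_smult:
  "continuous_on S c \<Longrightarrow> continuous_on S u \<Longrightarrow> continuous_on S (\<lambda>x. c x *s (u x :: complex^'n))"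
  unfolding vector_scalar_mult_def by (intro continuous_on_vec_lambda continuous_intros)

lemma open_proj_image:
  assumes "open U" "0 \<notin> U"
  shows "open (proj ` U)"
proof -
  have "{v. v \<noteq> 0 \<and> proj v \<in> proj ` U} = (\<Union>c\<in>-{0}. (\<lambda>v. c *s v) -` U)"
  proof (intro equalityI subsetI)
    fix v assume "v \<in> {v. v \<noteq> 0 \<and> proj v \<in> proj ` U}"
    then obtain w where w: "v \<noteq> 0" "w \<in> U" "proj v = proj w" by auto
    with assms have "w \<noteq> 0" by auto
    then obtain c where "c \<noteq> 0" "w = c *s v" using w proj_eqE by metis
    with w show "v \<in> (\<Union>c\<in>-{0}. (\<lambda>v. c *s v) -` U)" by auto
  next
    fix v assume "v \<in> (\<Union>c\<in>-{0}. (\<lambda>v. c *s v) -` U)"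
    then obtain c where c: "c \<noteq> 0" "c *s v \<in> U" by auto
    then have "v \<noteq> 0" using assms by auto
    with c proj_scale[of v c] show "v \<in> {v. v \<noteq> 0 \<and> proj v \<in> proj ` U}"
      by (auto intro: rev_image_eqI)
  qed
  moreover have "open ((\<lambda>v. c *s v) -` U)" for c
    by (intro open_vimage assms continuous_on_vec_smult continuous_intros)
  ultimately show ?thesis by (auto simp: open_cp2_def)
qed

text \<open>The projection from the nonzero vectors is open, so continuity on an arbitrary subset of the plane
  can be tested on homogeneous coordinates.\<close>

lemma continuous_on_cp2:
  assumes "continuous_on {v. v \<noteq> 0 \<and> proj v \<in> A} (\<lambda>v. s (proj v))"
  shows "continuous_on A s"
  unfolding continuous_on_open_invariant
proof (intro allI impI)
  fix B :: "'a set" assume "open B"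
  with assms obtain U where U: "open U"
    "U \<inter> {v. v \<noteq> 0 \<and> proj v \<in> A} = (\<lambda>v. s (proj v)) -` B \<inter> {v. v \<noteq> 0 \<and> proj v \<in> A}"
    unfolding continuous_on_open_invariant by blast
  have "proj ` (U - {0}) \<inter> A = s -` B \<inter> A"
  proof (intro equalityI subsetI)
    fix p assume "p \<in> proj ` (U - {0}) \<inter> A"
    then show "p \<in> s -` B \<inter> A" using U(2) by auto
  next
    fix p assume p: "p \<in> s -` B \<inter> A"
    obtain v where "v \<noteq> 0" "proj v = p" using proj_surj by blast
    with p U(2) have "v \<in> U - {0}" by auto
    with \<open>proj v = p\<close> p show "p \<in> proj ` (U - {0}) \<inter> A" by auto
  qed
  moreover have "open (proj ` (U - {0}))" using U(1) by (intro open_proj_image) (auto simp: open_delete)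
  ultimately show "\<exists>T. open T \<and> T \<inter> A = s -` B \<inter> A" by blast
qed

lemma not_proportional_minor:
  fixes v w :: "complex^3"
  assumes "v \<noteq> 0" "\<And>i j. v $ i * w $ j = v $ j * w $ i"
  obtains c where "w = c *s v"
proof -
  obtain k where k: "v $ k \<noteq> 0" using assms(1) by (auto simp: vec_eq_iff)
  have "w $ i = w $ k / v $ k * v $ i" for i
  proof -
    have "w $ i = (v $ k * w $ i) / v $ k" using k by simp
    then show ?thesis unfolding assms(2)[of k i] by simp
  qed
  then have "w = (w $ k / v $ k) *s v" unfolding vec_eq_iff vector_smult_component by blast
  then show ?thesis using that by blast
qed

instance cp2 :: t2_space
proof
  fix p q :: cp2 assume "p \<noteq> q"
  obtain v w where v: "v \<noteq> 0" "proj v = p" and w: "w \<noteq> 0" "proj w = q" using proj_surj by metis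
  have "\<not> (\<exists>c. w = c *s v)" using proj_eq_iff[OF v(1) w(1)] \<open>p \<noteq> q\<close> v w by auto
  then obtain i j where ij: "v $ i * w $ j \<noteq> v $ j * w $ i"
    using not_proportional_minor[OF v(1), of w] by metis
  let ?M = "{z :: (complex^3) \<times> (complex^3). fst z $ i * snd z $ j \<noteq> fst z $ j * snd z $ i}"
  have "open ?M" by (intro open_Collect_neq continuous_intros)
  moreover have "(v, w) \<in> ?M" using ij by simp
  ultimately obtain A B where AB: "open A" "open B" "(v, w) \<in> A \<times> B" "A \<times> B \<subseteq> ?M"
    using open_prod_elim[of ?M "(v, w)"] by blast
  have 0: "0 \<notin> A" "0 \<notin> B" using AB(3,4) by force+
  have "proj ` A \<inter> proj ` B = {}"
  proof (rule ccontr)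
    assume "proj ` A \<inter> proj ` B \<noteq> {}"
    then obtain x y where xy: "x \<in> A" "y \<in> B" "proj x = proj y" by auto
    with 0 have "x \<noteq> 0" "y \<noteq> 0" by auto
    then obtain c where "y = c *s x" using xy proj_eqE by metis
    moreover have "(x, y) \<in> ?M" using xy AB(4) by blast
    ultimately show False by simp
  qed
  moreover have "p \<in> proj ` A" "q \<in> proj ` B" using AB(3) v w by auto
  ultimately show "\<exists>U V. open U \<and> open V \<and> p \<in> U \<and> q \<in> V \<and> U \<inter> V = {}"
    using open_proj_image[OF AB(1) 0(1)] open_proj_image[OF AB(2) 0(2)] by blast
qed

lemma compact_cp2: "compact (UNIV :: cp2 set)"
proof -
  have "proj ` sphere 0 1 = UNIV"
  proof (intro equalityI subsetI UNIV_I)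
    fix p
    obtain v where v: "v \<noteq> 0" "proj v = p" using proj_surj by blast
    let ?c = "complex_of_real (inverse (norm v))"
    have "?c *s v = inverse (norm v) *\<^sub>R v"
      unfolding vec_eq_iff vector_smult_component vector_scaleR_component
      by (simp add: scaleR_conv_of_real[where 'a = complex])
    then have "norm (?c *s v) = 1" using v by simp
    moreover have "proj (?c *s v) = p" using v proj_scale[of v ?c] by simp
    ultimately show "p \<in> proj ` sphere 0 1" by (intro image_eqI[of _ _ "?c *s v"]) auto
  qed
  moreover have "compact (proj ` sphere 0 1)"
    by (intro compact_continuous_image continuous_on_subset[OF continuous_on_proj]) auto
  ultimately show ?thesis by simp
qed

definition aff :: "complex \<times> complex \<Rightarrow> complex^3" where
  "aff z = vector [fst z, snd z, 1]"

lemma aff_nth [simp]: "aff z $ 1 = fst z" "aff z $ 2 = snd z" "aff z $ 3 = 1"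
  by (simp_all add: aff_def)

lemma continuous_on_aff: "continuous_on S aff"
proof -
  have "continuous_on S (\<lambda>x. \<chi> i. aff x $ i)"
  proof (rule continuous_on_vec_lambda)
    fix i :: 3 show "continuous_on S (\<lambda>x. aff x $ i)"
      using exhaust_3[of i] by (elim disjE) (simp_all add: continuous_on_fst continuous_on_snd)
  qed
  then show ?thesis by simp
qed

text \<open>The affine chart in the coordinates given by the invertible matrix \<open>A\<close>. Its range is the complement
  of the line on which the third coordinate vanishes.\<close>

definition achart :: "complex^3^3 \<Rightarrow> complex \<times> complex \<Rightarrow> cp2" where
  "achart A z = proj (A *v aff z)"

lemma continuous_on_matrix_vector: 
  "continuous_on S u \<Longrightarrow> continuous_on S (\<lambda>x. (A :: complex^3^3) *v u x)"
  unfolding matrix_vector_mult_def by (intro continuous_on_vec_lambda continuous_intros)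

context
  fixes A B :: "complex^3^3"
  assumes inverse: "A ** B = mat 1" "B ** A = mat 1"
begin

lemma frame_inverse: "A *v (B *v v) = v" "B *v (A *v v) = v"
  using inverse by (simp_all add: matrix_vector_mul_assoc)

lemma frame_eq_0_iff: "A *v v = 0 \<longleftrightarrow> v = 0"
  using frame_inverse(2)[of v] by auto

lemma achart_nz: "A *v aff z \<noteq> 0"
  unfolding frame_eq_0_iff by (metis aff_nth(3) zero_index zero_neq_one)

lemma continuous_on_achart: "continuous_on S (achart A)"
  unfolding achart_def
  by (intro continuous_on_proj_comp continuous_on_matrix_vector continuous_on_aff achart_nz)

lemma achart_eq_iff:
  assumes "v \<noteq> 0"
  shows "achart A z = proj v \<longleftrightarrow>
    (B *v v) $ 3 \<noteq> 0 \<and> fst z = (B *v v) $ 1 / (B *v v) $ 3 \<and> snd z = (B *v v) $ 2 / (B *v v) $ 3"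
    (is "?L \<longleftrightarrow> ?R")
proof
  assume ?L
  then obtain c where c: "c \<noteq> 0" "v = c *s (A *v aff z)"
    unfolding achart_def using proj_eqE[OF _ achart_nz assms] by metis
  then have "B *v v = c *s aff z" by (simp add: vector_scalar_commute frame_inverse)
  with c show ?R by simp
next
  assume R: ?R
  then have "B *v v = (B *v v) $ 3 *s aff z" by (simp add: vec_eq_iff forall_3)
  then have "v = (B *v v) $ 3 *s (A *v aff z)"
    by (metis frame_inverse(1) vector_scalar_commute)
  then show ?L unfolding achart_def using R achart_nz proj_scale by metis
qed

lemma inj_achart: "inj (achart A)"
proof (rule injI)
  fix z z' assume "achart A z = achart A z'"
  then have "achart A z = proj (A *v aff z')" by (simp add: achart_def)
  then show "z = z'" unfolding achart_eq_iff[OF achart_nz] frame_inverse by (simp add: prod_eq_iff)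
qed

lemma range_achart: "v \<noteq> 0 \<Longrightarrow> proj v \<in> range (achart A) \<longleftrightarrow> (B *v v) $ 3 \<noteq> 0"
proof -
  assume v: "v \<noteq> 0"
  have "proj v \<in> range (achart A) \<longleftrightarrow> (\<exists>x y. achart A (x, y) = proj v)"
    by (auto simp: image_iff eq_commute)
  then show ?thesis unfolding achart_eq_iff[OF v] by auto
qed

lemma open_achart_image:
  assumes "open U"
  shows "open (achart A ` U)"
proof -
  let ?g = "\<lambda>v. ((B *v v) $ 1 / (B *v v) $ 3, (B *v v) $ 2 / (B *v v) $ 3)"
  let ?D = "{v. (B *v v) $ 3 \<noteq> 0}"
  have D: "open ?D" by (intro open_Collect_neq continuous_intros continuous_on_matrix_vector)
  have "continuous_on ?D ?g" by (intro continuous_intros continuous_on_matrix_vector) auto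
  then have "open (?g -` U \<inter> ?D)"
    using continuous_on_open_vimage[OF D, of ?g] assms by blast
  moreover have "{v. v \<noteq> 0 \<and> proj v \<in> achart A ` U} = ?g -` U \<inter> ?D"
  proof (intro set_eqI)
    fix v :: "complex^3"
    show "v \<in> {v. v \<noteq> 0 \<and> proj v \<in> achart A ` U} \<longleftrightarrow> v \<in> ?g -` U \<inter> ?D"
    proof (cases "v = 0")
      case False
      have "proj v \<in> achart A ` U \<longleftrightarrow> (\<exists>z\<in>U. achart A z = proj v)"
        unfolding image_iff by (simp only: eq_commute[of "proj v"])
      also have "\<dots> \<longleftrightarrow> (\<exists>z\<in>U. (B *v v) $ 3 \<noteq> 0 \<and> z = ?g v)"
        unfolding achart_eq_iff[OF False] prod_eq_iff fst_conv snd_conv ..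
      also have "\<dots> \<longleftrightarrow> v \<in> ?g -` U \<inter> ?D" by blast
      finally show ?thesis using False by blast
    qed simp
  qed
  ultimately show ?thesis by (simp add: open_cp2_def)
qed

end

text \<open>Two points at which \<open>g\<close> does not vanish are joined by a complex line on which \<open>g\<close> is a nonzero
  polynomial, and a convex open set of complex parameters stays connected when the finitely many
  roots are removed.\<close>

lemma connected_nonzero_set:
  fixes g :: "'a::topological_space \<Rightarrow> complex"
  assumes "open S"
    and line: "\<And>x y. x \<in> S \<Longrightarrow> y \<in> S \<Longrightarrow> \<exists>m p. continuous_on UNIV m \<and> m 0 = x \<and> m 1 = y \<and>
       convex {t. m t \<in> S} \<and> (\<forall>t. g (m t) = poly p t)"
  shows "connected {x \<in> S. g x \<noteq> 0}"
  unfolding connected_iff_connected_component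
proof (intro ballI)
  fix x y assume xy: "x \<in> {x \<in> S. g x \<noteq> 0}" "y \<in> {x \<in> S. g x \<noteq> 0}"
  then have "x \<in> S" "y \<in> S" by auto
  from line[OF this] obtain m p where m: "continuous_on UNIV m" "m 0 = x" "m 1 = y" "convex {t. m t \<in> S}"
    "\<And>t. g (m t) = poly p t" by blast
  from m(2) m(5)[of 0] xy have "p \<noteq> 0" by auto
  have "open {t. m t \<in> S}" using open_vimage[OF \<open>open S\<close> m(1)] by (simp add: vimage_def)
  then have "connected ({t. m t \<in> S} - {t. poly p t = 0})"
    by (intro connected_open_delete_finite convex_connected m(4) poly_roots_finite \<open>p \<noteq> 0\<close>) auto
  then have "connected (m ` ({t. m t \<in> S} - {t. poly p t = 0}))"
    by (intro connected_continuous_image continuous_on_subset[OF m(1)]) auto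
  moreover have "x \<in> m ` ({t. m t \<in> S} - {t. poly p t = 0})"
    using xy m(2) m(5)[of 0] by (intro image_eqI[of _ _ 0]) auto
  moreover have "y \<in> m ` ({t. m t \<in> S} - {t. poly p t = 0})"
    using xy m(3) m(5)[of 1] by (intro image_eqI[of _ _ 1]) auto
  moreover have "m ` ({t. m t \<in> S} - {t. poly p t = 0}) \<subseteq> {x \<in> S. g x \<noteq> 0}"
    using m(5) by auto
  ultimately show "connected_component {x \<in> S. g x \<noteq> 0} x y"
    unfolding connected_component_def by blast
qed

section \<open>Charts at smooth points\<close>

lemma matrix_of_columns:
  fixes c1 c2 c3 :: "complex^3"
  assumes "\<And>a b c. a *s c1 + b *s c2 + c *s c3 = 0 \<Longrightarrow> a = 0 \<and> b = 0 \<and> c = 0"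
  obtains A B :: "complex^3^3" where "A ** B = mat 1" "B ** A = mat 1"
    "\<And>v. A *v v = (v $ 1) *s c1 + (v $ 2) *s c2 + (v $ 3) *s c3"
proof -
  define A :: "complex^3^3" where "A = (\<chi> r s. if s = 1 then c1 $ r else if s = 2 then c2 $ r else c3 $ r)"
  have A: "A *v v = (v $ 1) *s c1 + (v $ 2) *s c2 + (v $ 3) *s c3" for v
    by (simp add: vec_eq_iff matrix_vector_mult_def A_def sum_3 mult.commute)
  have "v = 0" if "A *v v = 0" for v
    using assms[of "v $ 1" "v $ 2" "v $ 3"] that unfolding A by (simp add: vec_eq_iff forall_3)
  then obtain B where "B ** A = mat 1" using matrix_left_invertible_ker by blast
  moreover then have "A ** B = mat 1" using matrix_left_right_inverse by blast
  ultimately show ?thesis using that A by blast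
qed

text \<open>The gradient does not vanish at \<open>v0\<close>, but by Euler's relation it annihilates \<open>v0\<close> itself, so a
  direction of nonzero derivative is independent of \<open>v0\<close>.\<close>

lemma smooth_frame:
  assumes F: "hform d f" and v0: "v0 \<noteq> 0" "f v0 = 0" "hderiv f v0 (axis k 1) \<noteq> 0"
  obtains A B :: "complex^3^3" where "A ** B = mat 1" "B ** A = mat 1" "A *v axis 3 1 = v0"
    "hderiv f v0 (A *v axis 2 1) \<noteq> 0"
proof -
  have "v0 = (\<Sum>i\<in>UNIV. v0 $ i *s axis i 1)" by (rule basis_expansion[symmetric])
  have "\<exists>i. i \<noteq> k \<and> v0 $ i \<noteq> 0"
  proof (rule ccontr)
    assume "\<not> ?thesis"
    then have "v0 = v0 $ k *s axis k 1" by (auto simp: vec_eq_iff axis_def)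
    then have "hderiv f v0 v0 = v0 $ k * hderiv f v0 (axis k 1)" using hderiv_scale[OF F, of v0 "v0 $ k" "axis k 1"] by simp
    then have "v0 $ k = 0" using hderiv_euler[OF F, of v0] v0 by simp
    with \<open>v0 = v0 $ k *s axis k 1\<close> have "v0 = 0" by (metis vector_smult_lzero)
    with v0 show False by blast
  qed
  then obtain i where i: "i \<noteq> k" "v0 $ i \<noteq> 0" by blast
  obtain j where j: "j \<noteq> k" "j \<noteq> i"
  proof -
    have "card {i, k} \<le> 2" by (simp add: card_insert_if)
    have "{i, k} \<noteq> UNIV"
    proof
      assume "{i, k} = UNIV"
      with \<open>card {i, k} \<le> 2\<close> show False by simp
    qed
    then show ?thesis using that by blast
  qed
  obtain A B :: "complex^3^3" where AB: "A ** B = mat 1" "B ** A = mat 1"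
    "\<And>v. A *v v = (v $ 1) *s axis j 1 + (v $ 2) *s axis k 1 + (v $ 3) *s v0"
  proof (rule matrix_of_columns[of "axis j 1" "axis k 1" v0])
    fix a b c assume 0: "a *s axis j 1 + b *s axis k 1 + c *s v0 = 0"
    have "(a *s axis j 1 + b *s axis k 1 + c *s v0) $ i = 0" by (simp add: 0)
    then have c: "c = 0" using i j by (simp add: axis_def)
    have "(a *s axis j 1 + b *s axis k 1 + c *s v0) $ j = 0" by (simp add: 0)
    then have a: "a = 0" using c j by (simp add: axis_def)
    have "(a *s axis j 1 + b *s axis k 1 + c *s v0) $ k = 0" by (simp add: 0)
    then have "b = 0" using c a j by (simp add: axis_def)
    with a c show "a = 0 \<and> b = 0 \<and> c = 0" by simp
  qed blast
  moreover have "A *v axis 3 1 = v0" "A *v axis 2 1 = axis k 1" unfolding AB(3) by (simp_all add: axis_def)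
  ultimately show ?thesis using that v0 by metis
qed

text \<open>The inverse function theorem in an affine chart: next to a smooth point, the value of the equation
  can be used as the second of two coordinates. The curve is the axis on which it vanishes, and the
  parametrisation of this axis is holomorphic and immersive.\<close>

lemma local_chart:
  assumes F: "hform d f" and v0: "v0 \<noteq> 0" "f v0 = 0" "hderiv f v0 (axis k 1) \<noteq> 0"
  obtains V and u :: "complex \<times> complex \<Rightarrow> complex^3" where
    "open V" "(0, 0) \<in> V" "continuous_on V u" "\<And>z. z \<in> V \<Longrightarrow> u z \<noteq> 0" "\<And>z. z \<in> V \<Longrightarrow> f (u z) = snd z"
    "u (0, 0) = v0" "inj_on (\<lambda>z. proj (u z)) V"
    "\<And>W. open W \<Longrightarrow> W \<subseteq> V \<Longrightarrow> open ((\<lambda>z. proj (u z)) ` W)"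
    "\<And>i. (\<lambda>x. u (x, 0) $ i) holomorphic_on {x. (x, 0) \<in> V}"
    "\<And>c. (\<chi> i. deriv (\<lambda>x. u (x, 0) $ i) 0) \<noteq> c *s v0"
proof -
  obtain A B :: "complex^3^3" where AB: "A ** B = mat 1" "B ** A = mat 1" "A *v axis 3 1 = v0"
    "hderiv f v0 (A *v axis 2 1) \<noteq> 0" using smooth_frame[OF F v0] .
  define a1 a2 where "a1 = A *v axis 1 1" and "a2 = A *v axis 2 1"
  have Aaff: "A *v aff z = fst z *s a1 + snd z *s a2 + v0" for z
  proof -
    have "aff z = fst z *s axis 1 1 + snd z *s axis 2 1 + axis 3 1"
      by (simp add: vec_eq_iff forall_3 axis_def)
    then show ?thesis
      by (simp add: a1_def a2_def AB(3) matrix_vector_right_distrib vector_scalar_commute)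
  qed
  define P R where "P z = hderiv f (A *v aff z) a1" and "R z = hderiv f (A *v aff z) a2" for z
  define D where "D z h = (fst h, P z * fst h + R z * snd h)" for z h :: "complex \<times> complex"
  have blD: "bounded_linear (D z)" for z
    unfolding D_def by (intro bounded_linear_Pair bounded_linear_add bounded_linear_const_mult
       bounded_linear_fst bounded_linear_snd)
  define f' where "f' z = Blinfun (D z)" for z
  have f': "blinfun_apply (f' z) = D z" for z
    unfolding f'_def by (rule bounded_linear_Blinfun_apply[OF blD])
  define G where "G z = (fst z, f (A *v aff z))" for z :: "complex \<times> complex"
  have derA: "((\<lambda>z. A *v aff z) has_derivative (\<lambda>h. fst h *s a1 + snd h *s a2)) (at z)" for z
    unfolding Aaff
    by (intro has_derivative_vec_complex) (auto intro!: derivative_eq_intros)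
  have derG: "(G has_derivative blinfun_apply (f' z)) (at z)" for z
  proof -
    have "((\<lambda>z. f (A *v aff z)) has_derivative (\<lambda>h. hderiv f (A *v aff z) (fst h *s a1 + snd h *s a2))) (at z)"
      using has_derivative_compose[OF derA hform_has_derivative[OF F]] by simp
    then have "((\<lambda>z. f (A *v aff z)) has_derivative (\<lambda>h. P z * fst h + R z * snd h)) (at z)"
      by (simp add: hderiv_add[OF F] hderiv_scale[OF F] P_def R_def mult.commute)
    then show ?thesis unfolding f' D_def G_def
      by (intro has_derivative_Pair has_derivative_fst has_derivative_ident) auto
  qed
  have contPR: "continuous_on UNIV P" "continuous_on UNIV R"
    unfolding P_def R_def
    by (auto intro!: continuous_on_compose2[OF hderiv_continuous[OF F]] continuous_on_matrix_vector continuous_on_aff)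
  have contf: "continuous_on UNIV f'"
  proof (rule continuous_on_blinfun_componentwise)
    fix i :: "complex \<times> complex" show "continuous_on UNIV (\<lambda>x. blinfun_apply (f' x) i)"
      unfolding f' D_def by (intro continuous_intros contPR)
  qed
  have aff0: "A *v aff (0, 0) = v0" unfolding Aaff by simp
  have R0: "R (0, 0) \<noteq> 0" using AB(4) unfolding R_def aff0 a2_def .
  \<comment> \<open>the inverse of the derivative of \<open>G\<close> at the origin\<close>
  define E where "E h = (fst h, (snd h - P (0,0) * fst h) / R (0,0))" for h :: "complex \<times> complex"
  have blE: "bounded_linear E"
    unfolding E_def divide_inverse
    by (intro bounded_linear_Pair bounded_linear_sub bounded_linear_mult_const bounded_linear_const_mult
       bounded_linear_fst bounded_linear_snd)
  have "Blinfun E o\<^sub>L f' (0,0) = id_blinfun"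
    by (rule blinfun_eqI) (use R0 in \<open>simp add: bounded_linear_Blinfun_apply[OF blE] f' D_def E_def\<close>)
  from inverse_function_theorem[OF open_UNIV derG contf UNIV_I this]
  obtain U' V g g' where g: "open U'" "(0,0) \<in> U'" "open V" "G (0,0) \<in> V" "homeomorphism U' V G g"
     "\<And>y. y \<in> V \<Longrightarrow> (g has_derivative (g' y)) (at y)"
     "\<And>y. y \<in> V \<Longrightarrow> g' y = inv (D (g y))"
     "\<And>y. y \<in> V \<Longrightarrow> bij (D (g y))"
    unfolding f' by (metis (no_types, lifting))
  define u where "u z = A *v aff (g z)" for z
  have G0: "G (0,0) = (0,0)" by (simp add: G_def aff0 v0)
  have Gg: "G (g z) = z" if "z \<in> V" for z using g(5) that by (auto simp: homeomorphism_def)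
  then have fstg: "fst (g z) = fst z" and fg: "f (u z) = snd z" if "z \<in> V" for z
    using that unfolding G_def u_def by (metis fst_conv, metis snd_conv)
  have g0: "g (0,0) = (0,0)" using g(2,5) G0 by (metis homeomorphism_def)
  have contg: "continuous_on V g" using g(5) by (simp add: homeomorphism_def)
  have proju: "proj (u z) = achart A (g z)" for z by (simp add: u_def achart_def)
  show ?thesis
  proof (rule that[of V u])
    show "open V" "(0, 0) \<in> V" using g G0 by auto
    show "continuous_on V u" unfolding u_def
      by (intro continuous_on_matrix_vector continuous_on_compose2[OF continuous_on_aff contg]) auto
    show "u z \<noteq> 0" if "z \<in> V" for z unfolding u_def by (rule achart_nz[OF AB(1,2)])
    show "f (u z) = snd z" if "z \<in> V" for z by (rule fg[OF that])
    show "u (0, 0) = v0" by (simp add: u_def g0 aff0)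
    show "inj_on (\<lambda>z. proj (u z)) V"
    proof (rule inj_onI)
      fix x y assume xy: "x \<in> V" "y \<in> V" "proj (u x) = proj (u y)"
      then have "g x = g y" unfolding proju using inj_achart[OF AB(1,2)] by (simp add: inj_eq)
      with xy Gg show "x = y" by metis
    qed
    show "open ((\<lambda>z. proj (u z)) ` W)" if W: "open W" "W \<subseteq> V" for W
    proof -
      have "g ` W = G -` W \<inter> U'"
      proof (intro equalityI subsetI)
        fix z assume "z \<in> g ` W"
        then show "z \<in> G -` W \<inter> U'" using W(2) Gg g(5) by (auto simp: homeomorphism_def)
      next
        fix z assume z: "z \<in> G -` W \<inter> U'"
        then have "g (G z) = z" using g(5) by (auto simp: homeomorphism_def)
        with z show "z \<in> g ` W" by (metis IntD1 image_eqI vimageD)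
      qed
      moreover have "continuous_on U' G" using g(5) by (simp add: homeomorphism_def)
      then have "open (G -` W \<inter> U')" using continuous_on_open_vimage[OF g(1), of G] W(1) by blast
      ultimately have "open (achart A ` g ` W)" using open_achart_image[OF AB(1,2)] by simp
      then show ?thesis by (simp add: image_image proju)
    qed
    have der: "((\<lambda>x. snd (g (x, 0))) has_field_derivative (- P (g (x, 0)) / R (g (x, 0)))) (at x)"
      if x: "(x, 0) \<in> V" for x
    proof -
      let ?y = "(x, 0 :: complex)"
      have Rnz: "R (g ?y) \<noteq> 0"
      proof
        assume "R (g ?y) = 0"
        then have "D (g ?y) (0, 1) = D (g ?y) (0, 0)" by (simp add: D_def)
        then show False using g(8)[OF x] by (metis bij_is_inj injD prod.inject zero_neq_one)
      qed
      have inv: "g' ?y (h, 0) = (h, - P (g ?y) / R (g ?y) * h)" for h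
      proof -
        have "D (g ?y) (h, - P (g ?y) / R (g ?y) * h) = (h, 0)" using Rnz by (simp add: D_def)
        then show ?thesis unfolding g(7)[OF x] using g(8)[OF x] by (metis bij_is_inj inv_f_f)
      qed
      have "((\<lambda>x. (x, 0 :: complex)) has_derivative (\<lambda>h. (h, 0))) (at x)"
        by (auto intro!: derivative_eq_intros)
      then have "((\<lambda>x. g (x, 0)) has_derivative (\<lambda>h. g' ?y (h, 0))) (at x)"
        using has_derivative_compose[of "\<lambda>x. (x, 0)" _ x UNIV g, OF _ g(6)[OF x]] by blast
      then have "((\<lambda>x. snd (g (x, 0))) has_derivative (\<lambda>h. snd (g' ?y (h, 0)))) (at x)"
        by (rule has_derivative_snd)
      then show ?thesis unfolding inv snd_conv has_field_derivative_def .
    qed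
    have ui: "u (x, 0) $ i = x * a1 $ i + snd (g (x, 0)) * a2 $ i + v0 $ i" if "(x, 0) \<in> V" for x i
      unfolding u_def Aaff using fstg[OF that] by simp
    have openX: "open {x. (x, 0 :: complex) \<in> V}"
      using open_vimage[OF g(3), of "\<lambda>x. (x, 0 :: complex)"] by (simp add: vimage_def continuous_intros)
    have der': "((\<lambda>x. u (x, 0) $ i) has_field_derivative (a1 $ i - P (g (x, 0)) / R (g (x, 0)) * a2 $ i)) (at x)"
      if x: "(x, 0) \<in> V" for x i
    proof (rule has_field_derivative_transform_within_open[OF _ openX])
      show "((\<lambda>x. x * a1 $ i + snd (g (x, 0)) * a2 $ i + v0 $ i) has_field_derivative
         (a1 $ i - P (g (x, 0)) / R (g (x, 0)) * a2 $ i)) (at x)"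
        by (rule derivative_eq_intros der[OF x] refl)+ simp
    qed (use x ui in auto)
    show "(\<lambda>x. u (x, 0) $ i) holomorphic_on {x. (x, 0) \<in> V}" for i
      unfolding holomorphic_on_open[OF openX] using der' by blast
    show "(\<chi> i. deriv (\<lambda>x. u (x, 0) $ i) 0) \<noteq> c *s v0" for c
    proof
      assume eq: "(\<chi> i. deriv (\<lambda>x. u (x, 0) $ i) 0) = c *s v0"
      have "(0, 0) \<in> V" using g G0 by auto
      then have "deriv (\<lambda>x. u (x, 0) $ i) 0 = a1 $ i - P (0,0) / R (0,0) * a2 $ i" for i
        using DERIV_imp_deriv[OF der'[of 0 i]] by (simp add: g0)
      then have "a1 - (P (0,0) / R (0,0)) *s a2 = c *s v0" using eq by (simp add: vec_eq_iff)
      then have "A *v (axis 1 1 - (P (0,0) / R (0,0)) *s axis 2 1 - c *s axis 3 1) = 0"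
        by (simp add: a1_def a2_def AB(3)[symmetric] matrix_vector_mult_diff_distrib vector_scalar_commute)
      then have "axis 1 1 - (P (0,0) / R (0,0)) *s axis 2 1 - c *s axis 3 1 = (0 :: complex^3)"
        using frame_eq_0_iff[OF AB(1,2)] by blast
      from arg_cong[OF this, of "\<lambda>v. v $ 1"] show False by (simp add: axis_def)
    qed
  qed
qed

lemma open_preimage_on: "open S \<Longrightarrow> continuous_on S f \<Longrightarrow> open B \<Longrightarrow> open (f -` B \<inter> S)"
  by (simp add: continuous_on_open_vimage)

text \<open>The conclusion of \<open>local_chart\<close>, named so that it can be passed on.\<close>

definition curve_chart ::
    "(complex^3 \<Rightarrow> complex) \<Rightarrow> complex^3 \<Rightarrow> (complex \<times> complex) set \<Rightarrow> (complex \<times> complex \<Rightarrow> complex^3) \<Rightarrow> bool" where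
  "curve_chart f v0 V u \<longleftrightarrow> open V \<and> (0, 0) \<in> V \<and> continuous_on V u \<and> (\<forall>z\<in>V. u z \<noteq> 0) \<and>
     (\<forall>z\<in>V. f (u z) = snd z) \<and> u (0, 0) = v0 \<and> inj_on (\<lambda>z. proj (u z)) V \<and>
     (\<forall>W. open W \<longrightarrow> W \<subseteq> V \<longrightarrow> open ((\<lambda>z. proj (u z)) ` W)) \<and>
     (\<forall>i. (\<lambda>x. u (x, 0) $ i) holomorphic_on {x. (x, 0) \<in> V}) \<and>
     (\<forall>c. (\<chi> i. deriv (\<lambda>x. u (x, 0) $ i) 0) \<noteq> c *s v0)"

lemma curve_chart_ex:
  assumes "hform d f" "v0 \<noteq> 0" "f v0 = 0" "hderiv f v0 (axis k 1) \<noteq> 0"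
  obtains V u where "curve_chart f v0 V u"
proof (rule local_chart[OF assms])
  fix V u
  assume "open V" "(0, 0) \<in> V" "continuous_on V u" "\<And>z. z \<in> V \<Longrightarrow> u z \<noteq> 0" "\<And>z. z \<in> V \<Longrightarrow> f (u z) = snd z"
    "u (0, 0) = v0" "inj_on (\<lambda>z. proj (u z)) V"
    "\<And>W. open W \<Longrightarrow> W \<subseteq> V \<Longrightarrow> open ((\<lambda>z. proj (u z)) ` W)"
    "\<And>i. (\<lambda>x. u (x, 0) $ i) holomorphic_on {x. (x, 0) \<in> V}"
    "\<And>c. (\<chi> i. deriv (\<lambda>x. u (x, 0) $ i) 0) \<noteq> c *s v0"
  then have "curve_chart f v0 V u" unfolding curve_chart_def by blast
  then show ?thesis by (rule that)
qed

lemma curve_chartD: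
  assumes "curve_chart f v0 V u"
  shows "open V" "(0, 0) \<in> V" "continuous_on V u" "\<And>z. z \<in> V \<Longrightarrow> u z \<noteq> 0" "\<And>z. z \<in> V \<Longrightarrow> f (u z) = snd z"
    "u (0, 0) = v0" "inj_on (\<lambda>z. proj (u z)) V"
    "\<And>W. open W \<Longrightarrow> W \<subseteq> V \<Longrightarrow> open ((\<lambda>z. proj (u z)) ` W)"
    "\<And>i. (\<lambda>x. u (x, 0) $ i) holomorphic_on {x. (x, 0) \<in> V}"
    "\<And>c. (\<chi> i. deriv (\<lambda>x. u (x, 0) $ i) 0) \<noteq> c *s v0"
  using assms unfolding curve_chart_def by simp_all

section \<open>Sections of fields given up to sign\<close>

text \<open>A vector field \<open>x\<close>, continuous or not, stands for the two-valued field \<open>\<plusminus> x\<close>, hence for the double cover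
  with fibres \<open>{x p, - x p}\<close>. The signs \<open>\<phi>\<close> select a continuous branch, a section of the cover.\<close>

definition sec :: "('a::topological_space \<Rightarrow> complex^'n) \<Rightarrow> 'a set \<Rightarrow> ('a \<Rightarrow> real) \<Rightarrow> bool" where
  "sec x A \<phi> \<longleftrightarrow> (\<forall>p\<in>A. \<phi> p = 1 \<or> \<phi> p = - 1) \<and> continuous_on A (\<lambda>p. \<phi> p *\<^sub>R x p)"

lemma sec_subset: "sec x A \<phi> \<Longrightarrow> B \<subseteq> A \<Longrightarrow> sec x B \<phi>"
  unfolding sec_def using continuous_on_subset by blast

lemma sec_cong: "(\<And>p. p \<in> A \<Longrightarrow> \<phi> p = \<psi> p) \<Longrightarrow> sec x A \<phi> \<longleftrightarrow> sec x A \<psi>"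
  unfolding sec_def by (intro conj_cong ball_cong continuous_on_cong) auto

lemma sec_cong_field: "(\<And>p. p \<in> A \<Longrightarrow> x p = y p) \<Longrightarrow> sec x A \<phi> \<longleftrightarrow> sec y A \<phi>"
  unfolding sec_def by (intro conj_cong refl continuous_on_cong) auto

lemma sec_sign: "sec x A \<phi> \<Longrightarrow> c = 1 \<or> c = -1 \<Longrightarrow> sec x A (\<lambda>p. c * \<phi> p)"
  unfolding sec_def by (auto intro: continuous_on_minus)

lemma sec_comp:
  assumes "sec x A \<phi>" "continuous_on B k" "k ` B \<subseteq> A"
  shows "sec (\<lambda>p. x (k p)) B (\<lambda>p. \<phi> (k p))"
  unfolding sec_def using assms(1,3) continuous_on_compose2[OF _ assms(2,3), of "\<lambda>p. \<phi> p *\<^sub>R x p"]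
  by (auto simp: sec_def)

lemma continuous_on_local:
  assumes "\<And>p. p \<in> A \<Longrightarrow> \<exists>U. open U \<and> p \<in> U \<and> continuous_on (A \<inter> U) f"
  shows "continuous_on A f"
  unfolding continuous_on_topological
proof (intro ballI allI impI)
  fix p B assume p: "p \<in> A" "open B" "f p \<in> B"
  then obtain U where U: "open U" "p \<in> U" "continuous_on (A \<inter> U) f" using assms by blast
  then obtain V where "open V" "p \<in> V" "\<forall>y\<in>A \<inter> U. y \<in> V \<longrightarrow> f y \<in> B"
    using p unfolding continuous_on_topological by blast
  with U show "\<exists>V. open V \<and> p \<in> V \<and> (\<forall>y\<in>A. y \<in> V \<longrightarrow> f y \<in> B)"
    by (intro exI[of _ "U \<inter> V"]) auto
qed

lemma sec_local:
  assumes "\<And>p. p \<in> A \<Longrightarrow> \<exists>U. open U \<and> p \<in> U \<and> sec x (A \<inter> U) \<phi>"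
  shows "sec x A \<phi>"
  unfolding sec_def
proof
  show "\<forall>p\<in>A. \<phi> p = 1 \<or> \<phi> p = - 1" using assms unfolding sec_def by blast
  show "continuous_on A (\<lambda>p. \<phi> p *\<^sub>R x p)"
    by (rule continuous_on_local) (use assms in \<open>auto simp: sec_def\<close>)
qed

text \<open>The quotient of two sections is the continuous function that compares the two branches; it is
  expressed by inner products, as the fields are vectors.\<close>

lemma sec_ratio_continuous:
  assumes "sec x A \<phi>" "sec x A \<psi>" "\<And>p. p \<in> A \<Longrightarrow> x p \<noteq> 0"
  shows "continuous_on A (\<lambda>p. \<phi> p * \<psi> p)"
proof -
  have "continuous_on A (\<lambda>p. ((\<phi> p *\<^sub>R x p) \<bullet> (\<psi> p *\<^sub>R x p)) / (norm (\<phi> p *\<^sub>R x p))\<^sup>2)"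
    using assms unfolding sec_def
    by (intro continuous_on_divide continuous_on_inner continuous_on_power continuous_on_norm) auto
  moreover have "((\<phi> p *\<^sub>R x p) \<bullet> (\<psi> p *\<^sub>R x p)) / (norm (\<phi> p *\<^sub>R x p))\<^sup>2 = \<phi> p * \<psi> p" if "p \<in> A" for p
    using assms that unfolding sec_def power2_norm_eq_inner by auto
  ultimately show ?thesis using continuous_on_cong by (metis (no_types, lifting))
qed

text \<open>Over a connected base two sections differ by a global sign, as their quotient is continuous with
  finitely many values.\<close>

lemma sec_unique:
  assumes "connected A" "sec x A \<phi>" "sec x A \<psi>" "\<And>p. p \<in> A \<Longrightarrow> x p \<noteq> 0"
  obtains c :: real where "c = 1 \<or> c = -1" "\<And>p. p \<in> A \<Longrightarrow> \<phi> p = c * \<psi> p"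
proof -
  have v: "\<phi> p * \<psi> p \<in> {1, -1}" if "p \<in> A" for p
    using assms(2,3) that unfolding sec_def by fastforce
  then have "(\<lambda>p. \<phi> p * \<psi> p) ` A \<subseteq> {1, -1}" by blast
  then have "finite ((\<lambda>p. \<phi> p * \<psi> p) ` A)" by (rule finite_subset) auto
  moreover have "connected ((\<lambda>p. \<phi> p * \<psi> p) ` A)"
    by (intro connected_continuous_image assms(1) sec_ratio_continuous[OF assms(2-4)])
  ultimately have "(\<lambda>p. \<phi> p * \<psi> p) ` A = {} \<or> (\<exists>c. (\<lambda>p. \<phi> p * \<psi> p) ` A = {c})"
    by (simp only: connected_finite_iff_sing)
  then obtain c where c: "(\<lambda>p. \<phi> p * \<psi> p) ` A \<subseteq> {c}" by blast
  show ?thesis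
  proof (cases "A = {}")
    case False
    then obtain q where "q \<in> A" by blast
    with c v have "c = 1 \<or> c = -1" by blast
    moreover have "\<phi> p = c * \<psi> p" if "p \<in> A" for p
    proof -
      have "\<phi> p * \<psi> p = c" using c that by blast
      moreover have "\<psi> p = 1 \<or> \<psi> p = -1" using assms(3) that unfolding sec_def by blast
      ultimately show ?thesis by auto
    qed
    ultimately show ?thesis using that by blast
  qed (use that in auto)
qed

text \<open>Where the overlap is connected, the two sections differ on it by a global sign, by which one of
  them is corrected.\<close>

lemma sec_glue:
  assumes U: "open U" and V: "open V" and \<phi>: "sec x (U \<inter> D) \<phi>" and \<psi>: "sec x (V \<inter> D) \<psi>"
    and conn: "connected (U \<inter> V \<inter> D)" and nz: "\<And>p. p \<in> D \<Longrightarrow> x p \<noteq> 0"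
  shows "\<exists>\<theta>. sec x ((U \<union> V) \<inter> D) \<theta>"
proof -
  have "sec x (U \<inter> V \<inter> D) \<phi>" "sec x (U \<inter> V \<inter> D) \<psi>" using \<phi> \<psi> by (auto elim!: sec_subset)
  from sec_unique[OF conn this] nz obtain c :: real where
    c: "c = 1 \<or> c = -1" "\<And>p. p \<in> U \<inter> V \<inter> D \<Longrightarrow> \<phi> p = c * \<psi> p" by (metis IntD2)
  define \<theta> where "\<theta> p = (if p \<in> U then \<phi> p else c * \<psi> p)" for p
  have 1: "sec x (U \<inter> D) \<theta>" using \<phi> by (subst sec_cong[of _ _ \<phi>]) (auto simp: \<theta>_def)
  have "sec x (V \<inter> D) (\<lambda>p. c * \<psi> p)" using \<psi> c(1) by (rule sec_sign)
  then have 2: "sec x (V \<inter> D) \<theta>"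
    by (subst sec_cong[of _ _ "\<lambda>p. c * \<psi> p"]) (auto simp: \<theta>_def c(2))
  have "sec x ((U \<union> V) \<inter> D) \<theta>"
  proof (rule sec_local)
    fix p assume "p \<in> (U \<union> V) \<inter> D"
    then consider "p \<in> U" | "p \<in> V" by blast
    then show "\<exists>W. open W \<and> p \<in> W \<and> sec x ((U \<union> V) \<inter> D \<inter> W) \<theta>"
    proof cases
      case 1
      then show ?thesis using U sec_subset[OF \<open>sec x (U \<inter> D) \<theta>\<close>] by (intro exI[of _ U]) auto
    next
      case 2
      then show ?thesis using V sec_subset[OF \<open>sec x (V \<inter> D) \<theta>\<close>] by (intro exI[of _ V]) auto
    qed
  qed
  then show ?thesis by blast
qed

text \<open>The tensor product of two fields given up to sign is again given up to sign; it represents the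
  product of the two double covers as torsors under the group of order two.\<close>

definition tensor :: "('a \<Rightarrow> complex^'n) \<Rightarrow> ('a \<Rightarrow> complex^'m) \<Rightarrow> 'a \<Rightarrow> complex^('n \<times> 'm)" where
  "tensor x y p = (\<chi> ij. x p $ fst ij * y p $ snd ij)"

lemma tensor_nz: "x p \<noteq> 0 \<Longrightarrow> y p \<noteq> 0 \<Longrightarrow> tensor x y p \<noteq> 0"
  unfolding tensor_def vec_eq_iff by auto

lemma sec_tensor:
  assumes "sec x A \<phi>" "sec y A \<psi>"
  shows "sec (tensor x y) A (\<lambda>p. \<phi> p * \<psi> p)"
proof -
  have "continuous_on A (\<lambda>p. \<chi> ij. (\<phi> p *\<^sub>R x p) $ fst ij * (\<psi> p *\<^sub>R y p) $ snd ij)"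
    using assms unfolding sec_def
    by (intro continuous_on_vec_lambda continuous_on_mult continuous_on_component) auto
  moreover have "(\<chi> ij. (\<phi> p *\<^sub>R x p) $ fst ij * (\<psi> p *\<^sub>R y p) $ snd ij) = (\<phi> p * \<psi> p) *\<^sub>R tensor x y p" for p
    by (simp add: vec_eq_iff tensor_def)
  ultimately show ?thesis using assms unfolding sec_def by fastforce
qed

text \<open>Contraction of the tensor product with a section of the second factor recovers the first factor,
  so that a cover is trivial if its product with a trivial cover is.\<close>

lemma sec_tensor_cancel:
  assumes "sec (tensor x y) A \<theta>" "sec y A \<psi>" "\<And>p. p \<in> A \<Longrightarrow> y p \<noteq> 0"
  shows "sec x A (\<lambda>p. \<theta> p * \<psi> p)"
proof -
  let ?N = "\<lambda>p. complex_of_real ((norm (\<psi> p *\<^sub>R y p))\<^sup>2)"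
  let ?f = "\<lambda>p i. (\<Sum>j\<in>UNIV. (\<theta> p *\<^sub>R tensor x y p) $ (i, j) * cnj ((\<psi> p *\<^sub>R y p) $ j)) / ?N p"
  have nz: "\<psi> p *\<^sub>R y p \<noteq> 0" if "p \<in> A" for p using assms that unfolding sec_def by auto
  define X Y where "X = (\<lambda>p. \<theta> p *\<^sub>R tensor x y p)" and "Y = (\<lambda>p. \<psi> p *\<^sub>R y p)"
  have XY: "continuous_on A X" "continuous_on A Y" "\<And>p. p \<in> A \<Longrightarrow> Y p \<noteq> 0"
    using assms nz unfolding sec_def X_def Y_def by auto
  have "continuous_on A (\<lambda>p. \<chi> i. (\<Sum>j\<in>UNIV. X p $ (i, j) * cnj (Y p $ j)) / complex_of_real ((norm (Y p))\<^sup>2))"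
    by (intro continuous_on_vec_lambda continuous_intros XY) (use XY in auto)
  then have "continuous_on A (\<lambda>p. \<chi> i. ?f p i)" unfolding X_def Y_def .
  moreover have "(\<chi> i. ?f p i) = (\<theta> p * \<psi> p) *\<^sub>R x p" if "p \<in> A" for p
  proof -
    have "\<psi> p = 1 \<or> \<psi> p = -1" using assms(2) that unfolding sec_def by blast
    then have N1: "?N p = (\<Sum>j\<in>UNIV. y p $ j * cnj (y p $ j))"
      unfolding norm_vec_def L2_set_def
      by (auto simp: complex_norm_square sum_nonneg simp flip: of_real_power)
    have "?N p \<noteq> 0" using nz[OF that] by simp
    note N = N1 this
    have "?f p i = ((\<theta> p * \<psi> p) *\<^sub>R x p) $ i" for i
    proof -
      have "(\<Sum>j\<in>UNIV. (\<theta> p *\<^sub>R tensor x y p) $ (i, j) * cnj ((\<psi> p *\<^sub>R y p) $ j))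
         = ((\<theta> p * \<psi> p) *\<^sub>R x p) $ i * (\<Sum>j\<in>UNIV. y p $ j * cnj (y p $ j))"
        unfolding sum_distrib_left by (intro sum.cong) (auto simp: tensor_def scaleR_conv_of_real[where 'a = complex])
      then show ?thesis unfolding N(1)[symmetric] using nonzero_mult_div_cancel_right[OF N(2)] by (simp only:)
    qed
    then show ?thesis by (simp add: vec_eq_iff)
  qed
  ultimately have "continuous_on A (\<lambda>p. (\<theta> p * \<psi> p) *\<^sub>R x p)"
    using continuous_on_cong by (metis (no_types, lifting))
  then show ?thesis using assms unfolding sec_def by fastforce
qed

lemma cbox_thicken:
  fixes a b :: "'a::euclidean_space"
  assumes "cbox a b \<subseteq> W" "open W" "\<And>i. i \<in> Basis \<Longrightarrow> a \<bullet> i \<le> b \<bullet> i"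
  obtains e where "e > 0" "box (a - e *\<^sub>R One) (b + e *\<^sub>R One) \<subseteq> W"
proof -
  obtain d where d: "d > 0" "(\<Union>x\<in>cbox a b. ball x d) \<subseteq> W"
    using compact_subset_open_imp_ball_epsilon_subset[OF compact_cbox assms(2,1)] .
  define e where "e = d / real DIM('a)"
  have "e > 0" using d by (simp add: e_def)
  moreover have "box (a - e *\<^sub>R One) (b + e *\<^sub>R One) \<subseteq> W"
  proof
    fix y assume y: "y \<in> box (a - e *\<^sub>R One) (b + e *\<^sub>R One)"
    define x where "x = (\<Sum>i\<in>Basis. (max (a \<bullet> i) (min (b \<bullet> i) (y \<bullet> i))) *\<^sub>R i)"
    have xi: "x \<bullet> i = max (a \<bullet> i) (min (b \<bullet> i) (y \<bullet> i))" if "i \<in> Basis" for i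
      using that by (simp add: x_def)
    have "x \<in> cbox a b" using assms(3) by (auto simp: mem_box xi)
    have "\<bar>(x - y) \<bullet> i\<bar> < e" if "i \<in> Basis" for i
      using y assms(3)[OF that] that \<open>e > 0\<close> by (auto simp: mem_box xi inner_diff_left inner_add_left max_def min_def)
    then have "(\<Sum>i\<in>Basis. \<bar>(x - y) \<bullet> i\<bar>) < (\<Sum>i\<in>(Basis::'a set). e)"
      by (intro sum_strict_mono) auto
    then have "norm (x - y) < d"
      using norm_le_l1[of "x - y"] by (simp add: e_def)
    then have "y \<in> ball x d" by (simp add: dist_norm)
    with \<open>x \<in> cbox a b\<close> show "y \<in> W" using d(2) by blast
  qed
  ultimately show ?thesis using that by blast
qed

text \<open>A double cover of a box splits, by induction on the number of directions in which the box extends.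
  In one such direction the box is cut into slices; Bolzano's principle reduces the claim to thin
  slabs around a single slice and to the gluing of two adjacent slabs. The base is \<open>D\<close>, which may
  be smaller than the box but meets all smaller boxes in connected sets.\<close>

lemma sec_cbox:
  fixes x :: "'a::euclidean_space \<Rightarrow> complex^'n"
  assumes nz: "\<And>p. p \<in> D \<Longrightarrow> x p \<noteq> 0"
    and S: "open S"
    and loc: "\<And>p. p \<in> S \<Longrightarrow> \<exists>U \<phi>. open U \<and> p \<in> U \<and> sec x (U \<inter> D) \<phi>"
    and conn: "\<And>c d. box c d \<subseteq> S \<Longrightarrow> connected (box c d \<inter> D)"
  shows "cbox a b \<subseteq> S \<Longrightarrow> (\<And>i. i \<in> Basis \<Longrightarrow> a \<bullet> i \<le> b \<bullet> i) \<Longrightarrow>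
    \<exists>W \<phi>. open W \<and> cbox a b \<subseteq> W \<and> sec x (W \<inter> D) \<phi>"
proof (induction "card {i\<in>Basis. a \<bullet> i < b \<bullet> i}" arbitrary: a b)
  case 0
  then have "{i\<in>Basis. a \<bullet> i < b \<bullet> i} = {}" by simp
  then have "a \<bullet> i = b \<bullet> i" if "i \<in> Basis" for i using 0(3)[OF that] that by force
  then have "a = b" by (rule euclidean_eqI)
  then have "a \<in> S" using 0 by auto
  then show ?case using loc[of a] \<open>a = b\<close> by auto
next
  case (Suc n)
  then have "{i\<in>Basis. a \<bullet> i < b \<bullet> i} \<noteq> {}" by (metis card.empty nat.distinct(1))
  then obtain k where k: "k \<in> Basis" "a \<bullet> k < b \<bullet> k" by blast
  define slc where "slc y s = (\<Sum>i\<in>Basis. (if i = k then s else y \<bullet> i) *\<^sub>R i)" for y :: 'a and s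
  have slc: "slc y s \<bullet> i = (if i = k then s else y \<bullet> i)" if "i \<in> Basis" for y s i
    using that by (simp add: slc_def)
  define P where "P s t \<longleftrightarrow> a \<bullet> k \<le> s \<longrightarrow> s \<le> t \<longrightarrow> t \<le> b \<bullet> k \<longrightarrow>
    (\<exists>W \<phi>. open W \<and> cbox (slc a s) (slc b t) \<subseteq> W \<and> sec x (W \<inter> D) \<phi>)" for s t
  have sub: "cbox (slc a s) (slc b t) \<subseteq> cbox a b" if "a \<bullet> k \<le> s" "t \<le> b \<bullet> k" for s t
    using that by (fastforce simp: mem_box slc split: if_splits)
  have "P (a \<bullet> k) (b \<bullet> k)"
  proof (rule Bolzano)
    show "a \<bullet> k \<le> b \<bullet> k" using k by simp
  next
    fix s t r assume P: "P s t" "P t r" "s \<le> t" "t \<le> r"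
    show "P s r" unfolding P_def
    proof (intro impI)
      assume sr: "a \<bullet> k \<le> s" "s \<le> r" "r \<le> b \<bullet> k"
      obtain W1 \<phi>1 where W1: "open W1" "cbox (slc a s) (slc b t) \<subseteq> W1" "sec x (W1 \<inter> D) \<phi>1"
        using P sr unfolding P_def by auto
      obtain W2 \<phi>2 where W2: "open W2" "cbox (slc a t) (slc b r) \<subseteq> W2" "sec x (W2 \<inter> D) \<phi>2"
        using P sr unfolding P_def by auto
      have le1: "slc a s \<bullet> i \<le> slc b t \<bullet> i" if "i \<in> Basis" for i using that P Suc.prems by (simp add: slc)
      have le2: "slc a t \<bullet> i \<le> slc b r \<bullet> i" if "i \<in> Basis" for i using that P Suc.prems by (simp add: slc)
      have S1: "cbox (slc a s) (slc b t) \<subseteq> W1 \<inter> S" and S2: "cbox (slc a t) (slc b r) \<subseteq> W2 \<inter> S"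
        using sub[of s t] sub[of t r] P sr W1 W2 Suc.prems by auto
      obtain e1 where e1: "e1 > 0" "box (slc a s - e1 *\<^sub>R One) (slc b t + e1 *\<^sub>R One) \<subseteq> W1 \<inter> S"
        using cbox_thicken[OF S1 _ le1] W1 S by auto
      obtain e2 where e2: "e2 > 0" "box (slc a t - e2 *\<^sub>R One) (slc b r + e2 *\<^sub>R One) \<subseteq> W2 \<inter> S"
        using cbox_thicken[OF S2 _ le2] W2 S by auto
      \<comment> \<open>both slabs are thickened by the same amount, so that their overlap is a box\<close>
      define e where "e = min e1 e2"
      have e: "e > 0" "e \<le> e1" "e \<le> e2" using e1 e2 by (auto simp: e_def)
      define T1 where "T1 = box (slc a s - e *\<^sub>R One) (slc b t + e *\<^sub>R One)"
      define T2 where "T2 = box (slc a t - e *\<^sub>R One) (slc b r + e *\<^sub>R One)"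
      have "T1 \<subseteq> W1 \<inter> S"
        unfolding T1_def by (rule order.trans[OF subset_box_imp(4)[of ] e1(2)]) (use e in \<open>simp add: inner_diff_left inner_add_left\<close>)
      have "T2 \<subseteq> W2 \<inter> S"
        unfolding T2_def by (rule order.trans[OF subset_box_imp(4) e2(2)]) (use e in \<open>simp add: inner_diff_left inner_add_left\<close>)
      have T12: "T1 \<inter> T2 = box (slc a t - e *\<^sub>R One) (slc b t + e *\<^sub>R One)"
        unfolding T1_def T2_def set_eq_iff Int_iff mem_box using P(3,4)
        by (auto simp: slc inner_diff_left inner_add_left split: if_splits)
      have "connected (T1 \<inter> T2 \<inter> D)" unfolding T12
        by (rule conn) (use T12 \<open>T1 \<subseteq> W1 \<inter> S\<close> in auto)
      moreover have "sec x (T1 \<inter> D) \<phi>1" "sec x (T2 \<inter> D) \<phi>2"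
        using W1(3) W2(3) \<open>T1 \<subseteq> W1 \<inter> S\<close> \<open>T2 \<subseteq> W2 \<inter> S\<close> by (auto elim!: sec_subset)
      ultimately obtain \<theta> where "sec x ((T1 \<union> T2) \<inter> D) \<theta>"
        using sec_glue[of T1 T2 x D \<phi>1 \<phi>2] nz unfolding T1_def T2_def by blast
      moreover have "open (T1 \<union> T2)" unfolding T1_def T2_def by auto
      moreover have "cbox (slc a s) (slc b r) \<subseteq> T1 \<union> T2"
      proof
        fix y assume y: "y \<in> cbox (slc a s) (slc b r)"
        show "y \<in> T1 \<union> T2"
        proof (cases "y \<bullet> k \<le> t")
          case True
          have "y \<in> T1" unfolding T1_def mem_box
          proof
            fix i :: 'a assume i: "i \<in> Basis"
            have "slc a s \<bullet> i \<le> y \<bullet> i \<and> y \<bullet> i \<le> slc b r \<bullet> i" using y i by (simp add: mem_box)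
            then show "(slc a s - e *\<^sub>R One) \<bullet> i < y \<bullet> i \<and> y \<bullet> i < (slc b t + e *\<^sub>R One) \<bullet> i"
              using True e(1) i by (cases "i = k") (simp_all add: slc inner_diff_left inner_add_left)
          qed
          then show ?thesis ..
        next
          case False
          have "y \<in> T2" unfolding T2_def mem_box
          proof
            fix i :: 'a assume i: "i \<in> Basis"
            have "slc a s \<bullet> i \<le> y \<bullet> i \<and> y \<bullet> i \<le> slc b r \<bullet> i" using y i by (simp add: mem_box)
            then show "(slc a t - e *\<^sub>R One) \<bullet> i < y \<bullet> i \<and> y \<bullet> i < (slc b r + e *\<^sub>R One) \<bullet> i"
              using False e(1) i by (cases "i = k") (simp_all add: slc inner_diff_left inner_add_left)
          qed
          then show ?thesis ..
        qed
      qed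
      ultimately show "\<exists>W \<phi>. open W \<and> cbox (slc a s) (slc b r) \<subseteq> W \<and> sec x (W \<inter> D) \<phi>" by blast
    qed
  next
    fix t assume t: "a \<bullet> k \<le> t" "t \<le> b \<bullet> k"
    have "{i\<in>Basis. slc a t \<bullet> i < slc b t \<bullet> i} = {i\<in>Basis. a \<bullet> i < b \<bullet> i} - {k}"
      by (auto simp: slc split: if_splits)
    then have "n = card {i\<in>Basis. slc a t \<bullet> i < slc b t \<bullet> i}" using Suc.hyps(2) k by simp
    moreover have le: "slc a t \<bullet> i \<le> slc b t \<bullet> i" if "i \<in> Basis" for i using that Suc.prems by (simp add: slc)
    moreover have "cbox (slc a t) (slc b t) \<subseteq> S" using sub[of t t] t Suc.prems by auto
    ultimately obtain W \<phi> where W: "open W" "cbox (slc a t) (slc b t) \<subseteq> W" "sec x (W \<inter> D) \<phi>"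
      using Suc.hyps(1)[of "slc a t" "slc b t"] by blast
    obtain e where e: "e > 0" "box (slc a t - e *\<^sub>R One) (slc b t + e *\<^sub>R One) \<subseteq> W"
      using cbox_thicken[OF W(2,1) le] by blast
    show "\<exists>d>0. \<forall>s r. s \<le> t \<and> t \<le> r \<and> r - s < d \<longrightarrow> P s r"
    proof (intro exI[of _ e] conjI allI impI \<open>e > 0\<close>)
      fix s r assume sr: "s \<le> t \<and> t \<le> r \<and> r - s < e"
      have "cbox (slc a s) (slc b r) \<subseteq> box (slc a t - e *\<^sub>R One) (slc b t + e *\<^sub>R One)"
        unfolding subset_iff mem_box
      proof (intro allI impI ballI)
        fix y and i :: 'a assume y: "\<forall>i\<in>Basis. slc a s \<bullet> i \<le> y \<bullet> i \<and> y \<bullet> i \<le> slc b r \<bullet> i" and i: "i \<in> Basis"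
        show "(slc a t - e *\<^sub>R One) \<bullet> i < y \<bullet> i \<and> y \<bullet> i < (slc b t + e *\<^sub>R One) \<bullet> i"
          using bspec[OF y i] sr e(1) i
          by (cases "i = k") (simp_all add: slc inner_diff_left inner_add_left)
      qed
      with W e(2) show "P s r" unfolding P_def by blast
    qed
  qed
  then have "\<exists>W \<phi>. open W \<and> cbox (slc a (a \<bullet> k)) (slc b (b \<bullet> k)) \<subseteq> W \<and> sec x (W \<inter> D) \<phi>"
    unfolding P_def using less_imp_le[OF k(2)] by blast
  moreover have "slc a (a \<bullet> k) = a" by (rule euclidean_eqI) (simp add: slc)
  moreover have "slc b (b \<bullet> k) = b" by (rule euclidean_eqI) (simp add: slc)
  ultimately show ?case by (simp only:)
qed

text \<open>Sections over the members of an increasing sequence of boxes are normalised at the common point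
  \<open>q0\<close>; by uniqueness they then extend each other.\<close>

lemma sec_exhaust:
  fixes x :: "'a::euclidean_space \<Rightarrow> complex^'n"
  assumes nz: "\<And>p. p \<in> D \<Longrightarrow> x p \<noteq> 0"
    and S: "open S"
    and loc: "\<And>p. p \<in> S \<Longrightarrow> \<exists>U \<phi>. open U \<and> p \<in> U \<and> sec x (U \<inter> D) \<phi>"
    and conn: "\<And>c d. box c d \<subseteq> S \<Longrightarrow> connected (box c d \<inter> D)"
    and a: "\<And>n::nat. cbox (a n) (b n) \<subseteq> S" "\<And>n i. i \<in> Basis \<Longrightarrow> a n \<bullet> i \<le> b n \<bullet> i"
    and mono: "\<And>m n. m \<le> n \<Longrightarrow> box (a m) (b m) \<subseteq> box (a n) (b n)"
    and exh: "S = (\<Union>n. box (a n) (b n))" and q0: "q0 \<in> box (a 0) (b 0) \<inter> D"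
  shows "\<exists>\<phi>. sec x (S \<inter> D) \<phi>"
proof -
  let ?B = "\<lambda>n. box (a n) (b n) \<inter> D"
  have "\<exists>\<phi>. sec x (?B n) \<phi> \<and> \<phi> q0 = 1" for n
  proof -
    have "\<exists>W \<phi>. open W \<and> cbox (a n) (b n) \<subseteq> W \<and> sec x (W \<inter> D) \<phi>"
      by (rule sec_cbox[OF nz S loc conn a(1) a(2)])
    then obtain W \<phi> where "cbox (a n) (b n) \<subseteq> W" "sec x (W \<inter> D) \<phi>" by blast
    then have \<phi>: "sec x (?B n) \<phi>" using box_subset_cbox by (blast intro: sec_subset)
    have "q0 \<in> ?B n" using mono[of 0 n] q0 by auto
    then have "\<phi> q0 = 1 \<or> \<phi> q0 = -1" using \<phi> unfolding sec_def by blast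
    then show ?thesis using \<phi> sec_sign[OF \<phi>, of "\<phi> q0"] by (intro exI[of _ "\<lambda>p. \<phi> q0 * \<phi> p"]) auto
  qed
  then obtain \<phi> where \<phi>: "\<And>n. sec x (?B n) (\<phi> n)" "\<And>n. \<phi> n q0 = 1" by metis
  have eq: "\<phi> m p = \<phi> n p" if "m \<le> n" "p \<in> ?B m" for m n p
  proof -
    have "box (a m) (b m) \<subseteq> S" using exh by blast
    moreover have "sec x (?B m) (\<phi> n)" using sec_subset[OF \<phi>(1)[of n]] mono[OF that(1)] by blast
    ultimately obtain c where c: "\<And>p. p \<in> ?B m \<Longrightarrow> \<phi> m p = c * \<phi> n p"
      using sec_unique[OF conn \<phi>(1)[of m]] nz by (metis IntD2)
    have "q0 \<in> ?B m" using mono[of 0 m] q0 by auto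
    from c[OF this] c[OF that(2)] \<phi>(2) show ?thesis by simp
  qed
  define N where "N p = (LEAST n. p \<in> box (a n) (b n))" for p
  define \<psi> where "\<psi> p = \<phi> (N p) p" for p
  have \<psi>: "\<psi> p = \<phi> n p" if "p \<in> ?B n" for n p
    using eq[of "N p" n p] that LeastI[of "\<lambda>n. p \<in> box (a n) (b n)" n] Least_le[of "\<lambda>n. p \<in> box (a n) (b n)" n]
    unfolding \<psi>_def N_def by auto
  have "sec x (S \<inter> D) \<psi>"
  proof (rule sec_local)
    fix p assume "p \<in> S \<inter> D"
    then obtain n where n: "p \<in> box (a n) (b n)" using exh by blast
    have "sec x (?B n) \<psi>" using \<phi>(1)[of n] \<psi> sec_cong[of "?B n" \<psi> "\<phi> n" x] by blast
    then have "sec x (S \<inter> D \<inter> box (a n) (b n)) \<psi>" by (rule sec_subset) auto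
    then show "\<exists>U. open U \<and> p \<in> U \<and> sec x (S \<inter> D \<inter> U) \<psi>" using n open_box by blast
  qed
  then show ?thesis by blast
qed

lemma sec_plane:
  fixes x :: "'a::euclidean_space \<Rightarrow> complex^'n"
  assumes nz: "\<And>p. p \<in> D \<Longrightarrow> x p \<noteq> 0"
    and loc: "\<And>p. \<exists>U \<phi>. open U \<and> p \<in> U \<and> sec x (U \<inter> D) \<phi>"
    and conn: "\<And>c d. connected (box c d \<inter> D)" and "q \<in> D"
  shows "\<exists>\<phi>. sec x D \<phi>"
proof -
  define R where "R n = norm q + 1 + real n" for n
  define a b :: "nat \<Rightarrow> 'a" where "a n = - R n *\<^sub>R One" and "b n = R n *\<^sub>R One" for n
  have "R n > 0" for n unfolding R_def using norm_ge_zero[of q] of_nat_0_le_iff[of n, where 'a = real] by linarith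
  have box: "p \<in> box (a n) (b n)" if "norm p < R n" for p n
    using that Basis_le_norm[of _ p] unfolding mem_box a_def b_def by (fastforce simp: abs_le_iff)
  have "\<exists>\<phi>. sec x (UNIV \<inter> D) \<phi>"
  proof (rule sec_exhaust[of D x UNIV a b q])
    show "a n \<bullet> i \<le> b n \<bullet> i" if "i \<in> Basis" for n i using that \<open>R n > 0\<close> by (simp add: a_def b_def)
    show "box (a m) (b m) \<subseteq> box (a n) (b n)" if "m \<le> n" for m n
      using that by (intro subset_box_imp) (auto simp: a_def b_def R_def)
    show "UNIV = (\<Union>n. box (a n) (b n))"
    proof (intro equalityI subsetI)
      fix p :: 'a
      obtain n where "norm p < real n" using reals_Archimedean2 by blast
      then have "norm p < R n" unfolding R_def by (simp add: add_strict_increasing2)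
      then show "p \<in> (\<Union>n. box (a n) (b n))" using box by blast
    qed auto
    show "q \<in> box (a 0) (b 0) \<inter> D" using box[of q 0] \<open>q \<in> D\<close> by (simp add: R_def)
  qed (use nz loc conn in auto)
  then show ?thesis by simp
qed

section \<open>Double covers of a punctured polydisc\<close>

text \<open>The first factor is a square instead of a disc so that its preimage below is a union of boxes.\<close>

definition pdisc :: "real \<Rightarrow> (complex \<times> complex) set" where
  "pdisc r = {p. \<bar>Re (fst p)\<bar> < r \<and> \<bar>Im (fst p)\<bar> < r \<and> snd p \<noteq> 0 \<and> norm (snd p) < r}"

text \<open>The universal cover of the punctured polydisc, with covering map \<open>pexp\<close> and deck translation
  \<open>pshift\<close>.\<close>

definition pcover :: "real \<Rightarrow> (complex \<times> complex) set" where
  "pcover r = {p. \<bar>Re (fst p)\<bar> < r \<and> \<bar>Im (fst p)\<bar> < r \<and> Re (snd p) < ln r}"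

definition pexp :: "complex \<times> complex \<Rightarrow> complex \<times> complex" where
  "pexp p = (fst p, exp (snd p))"

lemma continuous_on_pexp: "continuous_on S pexp"
  unfolding pexp_def by (intro continuous_intros)

lemma pexp_in: "r > 0 \<Longrightarrow> p \<in> pcover r \<Longrightarrow> pexp p \<in> pdisc r"
  unfolding pexp_def pdisc_def pcover_def
  by (auto simp: exp_less_cancel_iff[of _ "ln r", symmetric] simp del: exp_less_cancel_iff)

lemma mem_box_complex_pair:
  fixes a b p :: "complex \<times> complex"
  shows "p \<in> box a b \<longleftrightarrow> Re (fst a) < Re (fst p) \<and> Re (fst p) < Re (fst b) \<and>
    Im (fst a) < Im (fst p) \<and> Im (fst p) < Im (fst b) \<and> Re (snd a) < Re (snd p) \<and> Re (snd p) < Re (snd b) \<and>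
    Im (snd a) < Im (snd p) \<and> Im (snd p) < Im (snd b)"
  unfolding mem_box Basis_prod_def by (auto simp: Basis_complex_def inner_complex_def inner_prod_def)

lemma mem_cbox_complex_pair:
  fixes a b p :: "complex \<times> complex"
  shows "p \<in> cbox a b \<longleftrightarrow> Re (fst a) \<le> Re (fst p) \<and> Re (fst p) \<le> Re (fst b) \<and>
    Im (fst a) \<le> Im (fst p) \<and> Im (fst p) \<le> Im (fst b) \<and> Re (snd a) \<le> Re (snd p) \<and> Re (snd p) \<le> Re (snd b) \<and>
    Im (snd a) \<le> Im (snd p) \<and> Im (snd p) \<le> Im (snd b)"
  unfolding mem_box Basis_prod_def by (auto simp: Basis_complex_def inner_complex_def inner_prod_def)

lemma open_pcover: "open (pcover r)"
  unfolding pcover_def by (intro open_Collect_conj open_Collect_less continuous_intros)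

lemma sec_pcover:
  fixes x :: "complex \<times> complex \<Rightarrow> complex^'n"
  assumes r: "r > 0" and nz: "\<And>p. p \<in> pcover r \<Longrightarrow> x p \<noteq> 0"
    and loc: "\<And>p. p \<in> pcover r \<Longrightarrow> \<exists>U \<phi>. open U \<and> p \<in> U \<and> sec x (U \<inter> pcover r) \<phi>"
  shows "\<exists>\<phi>. sec x (pcover r) \<phi>"
proof -
  \<comment> \<open>an exhaustion of the half-space \<open>pcover r\<close> by closed boxes\<close>
  define e where "e n = r - r / (real n + 2)" for n
  define a b :: "nat \<Rightarrow> complex \<times> complex" where
    "a n = (Complex (- e n) (- e n), Complex (ln r - real n - 2) (- real n - 1))" and
    "b n = (Complex (e n) (e n), Complex (ln r - 1 / (real n + 2)) (real n + 1))" for n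
  have e: "e n > 0" "e n < r" for n
  proof -
    have "r / (real n + 2) < r / 1" by (intro divide_strict_left_mono) (use r in auto)
    then show "e n > 0" "e n < r" using r by (simp_all add: e_def)
  qed
  have emono: "e m \<le> e n" if "m \<le> n" for m n
    using that r unfolding e_def by (intro diff_left_mono divide_left_mono) auto
  have inv: "1 / (real n + 2) \<le> 1 / (real m + 2)" if "m \<le> n" for m n
    using that by (intro divide_left_mono) auto
  have sub: "cbox (a n) (b n) \<subseteq> pcover r" for n
    using e[of n] unfolding subset_iff mem_cbox_complex_pair a_def b_def pcover_def
    by (auto simp: abs_less_iff) (smt (verit) divide_pos_pos of_nat_0_le_iff)+
  have "\<exists>\<phi>. sec x (pcover r \<inter> pcover r) \<phi>"
  proof (rule sec_exhaust[of "pcover r" x "pcover r" a b "(0, Complex (ln r - 1) 0)"])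
    show "a n \<bullet> i \<le> b n \<bullet> i" if "i \<in> Basis" for n i
    proof -
      have "(1 :: real) / (real n + 2) \<le> 1" by simp
      then have "ln r - real n - 2 \<le> ln r - 1 / (real n + 2)" "- real n - 1 \<le> real n + 1" by linarith+
      then show ?thesis
        using that e[of n] unfolding a_def b_def Basis_prod_def
        by (auto simp: Basis_complex_def inner_complex_def inner_prod_def)
    qed
    show "box (a m) (b m) \<subseteq> box (a n) (b n)" if "m \<le> n" for m n
      using emono[OF that] inv[OF that] that unfolding subset_iff mem_box_complex_pair a_def b_def by auto
    show "pcover r = (\<Union>n. box (a n) (b n))"
    proof (intro equalityI subsetI)
      fix p assume p: "p \<in> pcover r"
      define M where "M = r / (r - \<bar>Re (fst p)\<bar>) + r / (r - \<bar>Im (fst p)\<bar>) + 1 / (ln r - Re (snd p)) +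
         (ln r - Re (snd p)) + \<bar>Im (snd p)\<bar>"
      obtain n where n: "M < real n" using reals_Archimedean2 by blast
      have pos: "r / (r - \<bar>Re (fst p)\<bar>) > 0" "r / (r - \<bar>Im (fst p)\<bar>) > 0" "1 / (ln r - Re (snd p)) > 0"
        "ln r - Re (snd p) > 0"
        using p r by (auto simp: pcover_def)
      have "r / (r - \<bar>Re (fst p)\<bar>) < real n + 2" "r / (r - \<bar>Im (fst p)\<bar>) < real n + 2"
        "1 / (ln r - Re (snd p)) < real n + 2" "ln r - Re (snd p) < real n + 2" "\<bar>Im (snd p)\<bar> < real n + 1"
        using n pos unfolding M_def by linarith+
      moreover from this have "r / (real n + 2) < r - \<bar>Re (fst p)\<bar>" "r / (real n + 2) < r - \<bar>Im (fst p)\<bar>"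
        "1 / (real n + 2) < ln r - Re (snd p)"
        using p r by (auto simp: pcover_def pos_divide_less_eq mult.commute)
      ultimately show "p \<in> (\<Union>n. box (a n) (b n))"
        unfolding UN_iff mem_box_complex_pair a_def b_def e_def
        by (intro bexI[of _ n]) (auto simp: abs_less_iff)
    qed (use sub box_subset_cbox in blast)
    show "(0, Complex (ln r - 1) 0) \<in> box (a 0) (b 0) \<inter> pcover r"
      using e[of 0] r by (auto simp: mem_box_complex_pair a_def b_def pcover_def)
    show "connected (box c d \<inter> pcover r)" if "box c d \<subseteq> pcover r" for c d
    proof -
      have "box c d \<inter> pcover r = box c d" using that by blast
      then show ?thesis by (simp add: convex_connected)
    qed
  qed (use nz loc sub open_pcover in auto)
  then show ?thesis by simp
qed

definition pshift :: "complex \<times> complex \<Rightarrow> complex \<times> complex" where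
  "pshift p = (fst p, snd p + 2 * pi * \<i>)"

lemma pexp_pshift: "pexp (pshift p) = pexp p"
  by (simp add: pexp_def pshift_def exp_add exp_two_pi_i')

lemma convex_pcover: "convex (pcover r)"
proof -
  have "pcover r = (\<lambda>p. Re (fst p)) -` {-r<..<r} \<inter> (\<lambda>p. Im (fst p)) -` {-r<..<r} \<inter> (\<lambda>p. Re (snd p)) -` {..<ln r}"
    unfolding pcover_def by (auto simp: abs_less_iff)
  also have "convex \<dots>"
    by (intro convex_Int convex_linear_vimage) (auto intro!: linearI)
  finally show ?thesis .
qed

text \<open>The pullback to the universal cover splits, and by uniqueness the deck translation acts on the
  section by a sign, the monodromy around the puncture.\<close>

lemma sec_monodromy:
  fixes x :: "complex \<times> complex \<Rightarrow> complex^'n"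
  assumes r: "r > 0" and nz: "\<And>p. p \<in> pdisc r \<Longrightarrow> x p \<noteq> 0"
    and loc: "\<And>p. p \<in> pdisc r \<Longrightarrow> \<exists>U \<phi>. open U \<and> p \<in> U \<and> sec x (U \<inter> pdisc r) \<phi>"
  obtains \<phi> \<mu> where "sec (\<lambda>p. x (pexp p)) (pcover r) \<phi>" "\<mu> = 1 \<or> \<mu> = - 1"
    "\<And>p. p \<in> pcover r \<Longrightarrow> \<phi> (pshift p) = \<mu> * \<phi> p"
proof -
  have "\<exists>\<phi>. sec (\<lambda>p. x (pexp p)) (pcover r) \<phi>"
  proof (rule sec_pcover[OF r])
    show "x (pexp p) \<noteq> 0" if "p \<in> pcover r" for p using nz pexp_in[OF r that] .
    fix p assume "p \<in> pcover r"
    from loc[OF pexp_in[OF r this]] obtain U \<phi> where U: "open U" "pexp p \<in> U" "sec x (U \<inter> pdisc r) \<phi>" by blast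
    have "sec (\<lambda>p. x (pexp p)) (pexp -` U \<inter> pcover r) (\<lambda>p. \<phi> (pexp p))"
      by (rule sec_comp[OF U(3) continuous_on_pexp]) (use pexp_in[OF r] in blast)
    moreover have "open (pexp -` U)" using U(1) continuous_on_pexp by (intro open_vimage) auto
    ultimately show "\<exists>U \<phi>. open U \<and> p \<in> U \<and> sec (\<lambda>p. x (pexp p)) (U \<inter> pcover r) \<phi>" using U(2) by blast
  qed
  then obtain \<phi> where \<phi>: "sec (\<lambda>p. x (pexp p)) (pcover r) \<phi>" by blast
  have "sec (\<lambda>p. x (pexp (pshift p))) (pcover r) (\<lambda>p. \<phi> (pshift p))"
    by (rule sec_comp[OF \<phi>]) (auto simp: pshift_def pcover_def intro!: continuous_intros)
  then have "sec (\<lambda>p. x (pexp p)) (pcover r) (\<lambda>p. \<phi> (pshift p))" by (simp add: pexp_pshift)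
  from sec_unique[OF convex_connected[OF convex_pcover] this \<phi> nz[OF pexp_in[OF r]]] \<phi> that
  show ?thesis by metis
qed

text \<open>A section that is invariant under the deck translation descends. It is read off through two
  branches of the logarithm whose domains cover the punctured disc; the values agree because the
  branches differ by a deck translation.\<close>

lemma sec_descend:
  fixes x :: "complex \<times> complex \<Rightarrow> complex^'n"
  assumes r: "r > 0" and \<phi>: "sec (\<lambda>p. x (pexp p)) (pcover r) \<phi>"
    and per: "\<And>p. p \<in> pcover r \<Longrightarrow> \<phi> (pshift p) = \<phi> p"
  shows "\<exists>\<psi>. sec x (pdisc r) \<psi>"
proof -
  define l1 l2 :: "complex \<times> complex \<Rightarrow> complex \<times> complex" where
    "l1 p = (fst p, Ln (snd p))" and "l2 p = (fst p, Ln (- snd p) + pi * \<i>)" for p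
  have norm: "Re (Ln z) < ln r" if "z \<noteq> 0" "norm z < r" for z using that r by (subst Re_Ln) (auto simp: ln_less_cancel_iff)
  have l: "l1 p \<in> pcover r" "l2 p \<in> pcover r" "pexp (l1 p) = p" "pexp (l2 p) = p" if "p \<in> pdisc r" for p
    using that norm[of "snd p"] norm[of "- snd p"]
    by (auto simp: pdisc_def pcover_def pexp_def l1_def l2_def exp_add)
  have eq: "\<phi> (l1 p) = \<phi> (l2 p)" if p: "p \<in> pdisc r" for p
  proof -
    have "snd p \<noteq> 0" using p by (auto simp: pdisc_def)
    then have "l2 p = l1 p \<or> l2 p = pshift (l1 p)"
      unfolding l1_def l2_def pshift_def by (auto simp: Ln_minus algebra_simps)
    then show ?thesis using per[OF l(1)[OF p]] by auto
  qed
  let ?U1 = "{p :: complex \<times> complex. snd p \<notin> \<real>\<^sub>\<le>\<^sub>0}" and ?U2 = "{p :: complex \<times> complex. - snd p \<notin> \<real>\<^sub>\<le>\<^sub>0}"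
  have U: "open ?U1" "open ?U2"
    using open_vimage[of "- \<real>\<^sub>\<le>\<^sub>0" "snd :: complex \<times> complex \<Rightarrow> complex"]
      open_vimage[of "- \<real>\<^sub>\<le>\<^sub>0" "\<lambda>p :: complex \<times> complex. - snd p"]
    by (auto simp: vimage_def open_Compl continuous_on_snd continuous_on_minus)
  have s1: "sec x (pdisc r \<inter> ?U1) (\<lambda>p. \<phi> (l1 p))"
  proof -
    have "sec (\<lambda>p. x (pexp (l1 p))) (pdisc r \<inter> ?U1) (\<lambda>p. \<phi> (l1 p))"
      by (rule sec_comp[OF \<phi>]) (use l in \<open>auto simp: l1_def intro!: continuous_intros\<close>)
    then show ?thesis by (rule sec_cong_field[THEN iffD1, rotated]) (use l in auto)
  qed
  have s2: "sec x (pdisc r \<inter> ?U2) (\<lambda>p. \<phi> (l1 p))"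
  proof -
    have "sec (\<lambda>p. x (pexp (l2 p))) (pdisc r \<inter> ?U2) (\<lambda>p. \<phi> (l2 p))"
      by (rule sec_comp[OF \<phi>]) (use l in \<open>auto simp: l2_def intro!: continuous_intros\<close>)
    then have "sec x (pdisc r \<inter> ?U2) (\<lambda>p. \<phi> (l2 p))"
      by (rule sec_cong_field[THEN iffD1, rotated]) (use l in auto)
    then show ?thesis by (rule sec_cong[THEN iffD1, rotated]) (use eq in auto)
  qed
  have "sec x (pdisc r) (\<lambda>p. \<phi> (l1 p))"
  proof (rule sec_local)
    fix p assume p: "p \<in> pdisc r"
    have "p \<in> ?U1 \<or> p \<in> ?U2"
      using p by (auto simp: pdisc_def complex_nonpos_Reals_iff complex_eq_iff)
    then show "\<exists>U. open U \<and> p \<in> U \<and> sec x (pdisc r \<inter> U) (\<lambda>p. \<phi> (l1 p))"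
      using U s1 s2 by blast
  qed
  then show ?thesis by blast
qed

text \<open>The monodromy of a non-trivial double cover of the punctured polydisc is \<open>-1\<close>, so the product of
  two such covers has monodromy 1 and is trivial.\<close>

lemma sec_tensor_pdisc:
  fixes x :: "complex \<times> complex \<Rightarrow> complex^'n" and y :: "complex \<times> complex \<Rightarrow> complex^'m"
  assumes r: "r > 0" and nz: "\<And>p. p \<in> pdisc r \<Longrightarrow> x p \<noteq> 0 \<and> y p \<noteq> 0"
    and loc: "\<And>p. p \<in> pdisc r \<Longrightarrow> \<exists>U \<phi>. open U \<and> p \<in> U \<and> sec x (U \<inter> pdisc r) \<phi>"
      "\<And>p. p \<in> pdisc r \<Longrightarrow> \<exists>U \<phi>. open U \<and> p \<in> U \<and> sec y (U \<inter> pdisc r) \<phi>"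
    and ram: "\<And>\<phi>. \<not> sec x (pdisc r) \<phi>" "\<And>\<phi>. \<not> sec y (pdisc r) \<phi>"
  shows "\<exists>\<phi>. sec (tensor x y) (pdisc r) \<phi>"
proof -
  obtain \<phi> \<mu> where \<phi>: "sec (\<lambda>p. x (pexp p)) (pcover r) \<phi>" "\<mu> = 1 \<or> \<mu> = - 1"
    "\<And>p. p \<in> pcover r \<Longrightarrow> \<phi> (pshift p) = \<mu> * \<phi> p"
    using sec_monodromy[of r x] r nz loc by metis
  obtain \<psi> \<nu> where \<psi>: "sec (\<lambda>p. y (pexp p)) (pcover r) \<psi>" "\<nu> = 1 \<or> \<nu> = - 1"
    "\<And>p. p \<in> pcover r \<Longrightarrow> \<psi> (pshift p) = \<nu> * \<psi> p"
    using sec_monodromy[of r y] r nz loc by metis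
  have "\<mu> \<noteq> 1" using sec_descend[OF r \<phi>(1)] \<phi>(3) ram(1) by auto
  moreover have "\<nu> \<noteq> 1" using sec_descend[OF r \<psi>(1)] \<psi>(3) ram(2) by auto
  ultimately have \<mu>\<nu>: "\<mu> = -1" "\<nu> = -1" using \<phi>(2) \<psi>(2) by auto
  have "sec (\<lambda>p. tensor x y (pexp p)) (pcover r) (\<lambda>p. \<phi> p * \<psi> p)"
    using sec_tensor[OF \<phi>(1) \<psi>(1)] by (simp add: tensor_def[abs_def])
  then show ?thesis
    by (rule sec_descend[OF r]) (simp add: \<phi>(3) \<psi>(3) \<mu>\<nu>)
qed

section \<open>The double cover branched along a quartic\<close>

text \<open>Homogeneous coordinates of a point, chosen arbitrarily and without any continuity.\<close>

definition rep :: "cp2 \<Rightarrow> complex^3" where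
  "rep p = (SOME v. v \<noteq> 0 \<and> proj v = p)"

lemma rep: "rep p \<noteq> 0" "proj (rep p) = p"
  using someI_ex[OF proj_surj[of p]] by (simp_all add: rep_def)

text \<open>The tensor \<open>v \<otimes> v / s\<close>. It is unchanged when \<open>v\<close> is scaled by \<open>c\<close> and \<open>s\<close> by \<open>c\<^sup>2\<close>, as happens to
  the square roots \<open>s\<close> of a quartic form at \<open>v\<close>.\<close>

definition outer :: "complex^3 \<Rightarrow> complex \<Rightarrow> complex^(3 \<times> 3)" where
  "outer v s = (\<chi> ij. v $ fst ij * v $ snd ij / s)"

text \<open>One of the two tensors \<open>v \<otimes> v / s\<close> with \<open>s\<^sup>2 = f v\<close>. The choices of \<open>v\<close> and of the branch only affect
  the sign, so that the two-valued field is the double cover of the complement of the quartic \<open>f\<close>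
  given by the square roots of \<open>f\<close>.\<close>

definition qroot :: "(complex^3 \<Rightarrow> complex) \<Rightarrow> cp2 \<Rightarrow> complex^(3 \<times> 3)" where
  "qroot f p = outer (rep p) (csqrt (f (rep p)))"

lemma outer_nz:
  assumes "v \<noteq> 0" "s \<noteq> 0" shows "outer v s \<noteq> 0"
proof -
  obtain i where "v $ i \<noteq> 0" using assms(1) by (auto simp: vec_eq_iff)
  then have "outer v s $ (i, i) \<noteq> 0" using assms(2) by (simp add: outer_def)
  then show ?thesis by auto
qed

lemma qroot_outer:
  assumes f: "hform 4 f" and v: "v \<noteq> 0" "f v \<noteq> 0"
  obtains s where "s\<^sup>2 = f v" "s \<noteq> 0" "qroot f (proj v) = outer v s"
proof -
  obtain c where c: "c \<noteq> 0" "rep (proj v) = c *s v"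
    using proj_eqE[of v "rep (proj v)"] rep[of "proj v"] v(1) by metis
  define t where "t = csqrt (f (rep (proj v)))"
  have t2: "t\<^sup>2 = c ^ 4 * f v" unfolding t_def c(2) hform_scale[OF f] by simp
  define s where "s = t / c\<^sup>2"
  have "s\<^sup>2 = t\<^sup>2 / c ^ 4" by (simp add: s_def power_divide flip: power_mult)
  then have s2: "s\<^sup>2 = f v" using c by (simp add: t2)
  have "qroot f (proj v) = outer v s"
    unfolding qroot_def t_def[symmetric] unfolding c(2) outer_def s_def
    by (simp add: vec_eq_iff power2_eq_square)
  with s2 v(2) that[of s] show ?thesis by force
qed

lemma qroot_nz: "hform 4 f \<Longrightarrow> v \<noteq> 0 \<Longrightarrow> f v \<noteq> 0 \<Longrightarrow> qroot f (proj v) \<noteq> 0"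
  using qroot_outer outer_nz by metis

lemma outer_minus: "outer v (- s) = - outer v s"
  by (simp add: outer_def vec_eq_iff)

lemma continuous_on_outer:
  assumes "continuous_on A u" "continuous_on A s" "\<And>z. z \<in> A \<Longrightarrow> s z \<noteq> 0"
  shows "continuous_on A (\<lambda>z. outer (u z) (s z))"
  unfolding outer_def using assms by (intro continuous_on_vec_lambda continuous_intros) auto

text \<open>In homogeneous coordinates \<open>u\<close>, sections of the double cover are continuous square roots of the
  equation; this is one direction of the correspondence.\<close>

lemma sec_qroot_of_sqrt:
  assumes f: "hform 4 f" and u: "continuous_on A u" "\<And>z. z \<in> A \<Longrightarrow> u z \<noteq> 0"
    and s: "continuous_on A s" "\<And>z. z \<in> A \<Longrightarrow> s z \<noteq> 0" "\<And>z. z \<in> A \<Longrightarrow> (s z)\<^sup>2 = f (u z)"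
  obtains \<phi> where "sec (\<lambda>z. qroot f (proj (u z))) A \<phi>"
    "\<And>z. z \<in> A \<Longrightarrow> \<phi> z *\<^sub>R qroot f (proj (u z)) = outer (u z) (s z)"
proof -
  have "\<exists>c::real. (c = 1 \<or> c = -1) \<and> c *\<^sub>R qroot f (proj (u z)) = outer (u z) (s z)" if z: "z \<in> A" for z
  proof -
    have "f (u z) \<noteq> 0" using s(2,3)[OF z] by (metis zero_eq_power2)
    then obtain t where t: "t\<^sup>2 = f (u z)" "qroot f (proj (u z)) = outer (u z) t"
      using qroot_outer[OF f u(2)[OF z]] by metis
    then have "s z = t \<or> s z = - t" using s(3)[OF z] by (metis power2_eq_iff)
    then show ?thesis using t(2) outer_minus[of "u z" t]
      by (elim disjE) (auto intro: exI[of _ "1::real"] exI[of _ "-1::real"])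
  qed
  then obtain \<phi> :: "_ \<Rightarrow> real" where \<phi>: "\<And>z. z \<in> A \<Longrightarrow> \<phi> z = 1 \<or> \<phi> z = -1"
    "\<And>z. z \<in> A \<Longrightarrow> \<phi> z *\<^sub>R qroot f (proj (u z)) = outer (u z) (s z)" by metis
  have "continuous_on A (\<lambda>z. \<phi> z *\<^sub>R qroot f (proj (u z)))"
    using continuous_on_outer[OF u(1) s(1,2)] \<phi>(2) by (simp cong: continuous_on_cong)
  with \<phi> that show ?thesis unfolding sec_def by blast
qed

lemma sqrt_of_sec_qroot:
  assumes f: "hform 4 f" and u: "continuous_on A u" "\<And>z. z \<in> A \<Longrightarrow> u z \<noteq> 0" "\<And>z. z \<in> A \<Longrightarrow> f (u z) \<noteq> 0"
    and \<phi>: "sec (\<lambda>z. qroot f (proj (u z))) A \<phi>"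
  obtains s where "continuous_on A s" "\<And>z. z \<in> A \<Longrightarrow> (s z)\<^sup>2 = f (u z)"
    "\<And>z. z \<in> A \<Longrightarrow> \<phi> z *\<^sub>R qroot f (proj (u z)) = outer (u z) (s z)"
proof -
  define X where "X z = \<phi> z *\<^sub>R qroot f (proj (u z))" for z
  have contX: "continuous_on A X" using \<phi> unfolding sec_def X_def by blast
  have "\<exists>s. s\<^sup>2 = f (u z) \<and> X z = outer (u z) s" if z: "z \<in> A" for z
  proof -
    obtain t where t: "t\<^sup>2 = f (u z)" "qroot f (proj (u z)) = outer (u z) t"
      using qroot_outer[OF f u(2,3)] z by metis
    have "\<phi> z = 1 \<or> \<phi> z = -1" using \<phi> z unfolding sec_def by blast
    then show ?thesis unfolding X_def t(2)
      using t(1) outer_minus[of "u z" t] by (elim disjE) (auto intro: exI[of _ t] exI[of _ "- t"])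
  qed
  then obtain s where s: "\<And>z. z \<in> A \<Longrightarrow> (s z)\<^sup>2 = f (u z)" "\<And>z. z \<in> A \<Longrightarrow> X z = outer (u z) (s z)" by metis
  have "continuous_on A s"
  proof (rule continuous_on_local)
    fix q assume q: "q \<in> A"
    then obtain i where i: "u q $ i \<noteq> 0" using u(2)[OF q] by (auto simp: vec_eq_iff)
    have "open (- {0 :: complex})" by auto
    moreover have "continuous_on A (\<lambda>z. u z $ i)" using u(1) by (rule continuous_on_component)
    ultimately obtain W where W: "open W" "W \<inter> A = (\<lambda>z. u z $ i) -` (- {0}) \<inter> A"
      unfolding continuous_on_open_invariant by blast
    have nz: "u z $ i \<noteq> 0" if "z \<in> A \<inter> W" for z using W that by blast
    have snz: "s z \<noteq> 0" if "z \<in> A" for z using s(1)[OF that] u(3)[OF that] by auto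
    have Xnz: "X z $ (i, i) \<noteq> 0" and sX: "s z = u z $ i * u z $ i / X z $ (i, i)" if "z \<in> A \<inter> W" for z
      using nz[OF that] snz[of z] s(2)[of z] that by (auto simp: outer_def)
    have "continuous_on (A \<inter> W) u" "continuous_on (A \<inter> W) X"
      using u(1) contX by (auto elim: continuous_on_subset)
    then have "continuous_on (A \<inter> W) (\<lambda>z. u z $ i * u z $ i / X z $ (i, i))"
      using Xnz by (intro continuous_intros) auto
    then have "continuous_on (A \<inter> W) s" by (rule continuous_on_eq) (rule sX[symmetric])
    moreover have "q \<in> W" using W q i by blast
    ultimately show "\<exists>U. open U \<and> q \<in> U \<and> continuous_on (A \<inter> U) s" using W(1) by blast
  qed
  with s that show ?thesis unfolding X_def by blast
qed

definition zeros :: "(complex^3 \<Rightarrow> complex) \<Rightarrow> cp2 set" where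
  "zeros f = proj ` {v. v \<noteq> 0 \<and> f v = 0}"

lemma proj_in_zeros:
  assumes f: "hform d f" and v: "v \<noteq> 0"
  shows "proj v \<in> zeros f \<longleftrightarrow> f v = 0"
proof
  assume "proj v \<in> zeros f"
  then obtain w where w: "w \<noteq> 0" "f w = 0" "proj w = proj v" by (auto simp: zeros_def)
  then obtain c where "v = c *s w" using v proj_eqE by metis
  then show "f v = 0" using w hform_scale[OF f] by simp
qed (use v in \<open>auto simp: zeros_def\<close>)

lemma closed_zeros:
  assumes f: "hform d f" shows "closed (zeros f)"
proof -
  have "{v. v \<noteq> 0 \<and> proj v \<in> - zeros f} = {v. v \<noteq> 0 \<and> f v \<noteq> 0}"
    using proj_in_zeros[OF f] by auto
  moreover have "open {v. v \<noteq> 0 \<and> f v \<noteq> 0}"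
    by (intro open_Collect_conj open_Collect_neq continuous_intros hform_continuous[OF f])
  ultimately show ?thesis by (simp add: closed_def open_cp2_def)
qed

lemma sec_comp_inj:
  assumes V: "open V" "inj_on k V" "\<And>W. open W \<Longrightarrow> W \<subseteq> V \<Longrightarrow> open (k ` W)"
    and \<phi>: "sec (\<lambda>z. x (k z)) B \<phi>" and B: "B \<subseteq> V"
  shows "sec x (k ` B) (\<lambda>p. \<phi> (inv_into V k p))"
proof -
  have oV: "open (k ` V)" using V by blast
  have "continuous_on (k ` V) (inv_into V k)"
    unfolding continuous_on_open_vimage[OF oV]
  proof (intro allI impI)
    fix W :: "'a set" assume "open W"
    have "inv_into V k -` W \<inter> k ` V = k ` (W \<inter> V)"
      using V(2) by (auto simp: inv_into_f_f)
    then show "open (inv_into V k -` W \<inter> k ` V)" using V(1,3) \<open>open W\<close> by (simp add: open_Int)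
  qed
  then have "continuous_on (k ` B) (inv_into V k)" by (rule continuous_on_subset) (use B in auto)
  moreover have "inv_into V k ` k ` B \<subseteq> B" using V(2) B by (auto simp: inv_into_f_f subset_iff)
  ultimately have "sec (\<lambda>p. x (k (inv_into V k p))) (k ` B) (\<lambda>p. \<phi> (inv_into V k p))"
    by (rule sec_comp[OF \<phi>])
  moreover have "k (inv_into V k p) = p" if "p \<in> k ` B" for p using that B by (blast intro: f_inv_into_f)
  ultimately show ?thesis unfolding sec_def by (simp cong: continuous_on_cong)
qed

lemma qroot_local:
  assumes f: "hform 4 f" and p: "p \<notin> zeros f"
  shows "\<exists>U \<phi>. open U \<and> p \<in> U \<and> U \<inter> zeros f = {} \<and> sec (qroot f) U \<phi>"
proof -
  obtain k where k: "rep p $ k \<noteq> 0" using rep(1)[of p] by (auto simp: vec_eq_iff)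
  define u where "u q = inverse (rep q $ k) *s rep q" for q
  define N where "N = {q. rep q $ k \<noteq> 0}"
  have repk: "rep (proj v) $ k \<noteq> 0 \<longleftrightarrow> v $ k \<noteq> 0" and uproj: "v $ k \<noteq> 0 \<Longrightarrow> u (proj v) = inverse (v $ k) *s v"
    if v: "v \<noteq> 0" for v
  proof -
    obtain c where c: "c \<noteq> 0" "rep (proj v) = c *s v" using proj_eqE[of v "rep (proj v)"] rep v by metis
    then show "rep (proj v) $ k \<noteq> 0 \<longleftrightarrow> v $ k \<noteq> 0" by simp
    show "v $ k \<noteq> 0 \<Longrightarrow> u (proj v) = inverse (v $ k) *s v" using c by (simp add: u_def vec_eq_iff)
  qed
  have vnz: "v \<noteq> 0" if "v $ k \<noteq> 0" for v :: "complex^3" using that by auto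
  then have "{v. v \<noteq> 0 \<and> proj v \<in> N} = {v. v $ k \<noteq> 0}" using repk by (auto simp: N_def)
  moreover have "open {v :: complex^3. v $ k \<noteq> 0}" by (intro open_Collect_neq continuous_intros)
  ultimately have oN: "open N" by (simp add: open_cp2_def)
  have "continuous_on {v :: complex^3. v $ k \<noteq> 0} (\<lambda>v. inverse (v $ k) *s v)"
    by (intro continuous_on_vec_smult continuous_intros) auto
  then have "continuous_on {v. v \<noteq> 0 \<and> proj v \<in> N} (\<lambda>v. u (proj v))"
    unfolding \<open>{v. v \<noteq> 0 \<and> proj v \<in> N} = {v. v $ k \<noteq> 0}\<close>
    by (rule continuous_on_eq) (use uproj vnz in simp)
  then have contu: "continuous_on N u" by (rule continuous_on_cp2)
  have u: "u q \<noteq> 0" "proj (u q) = q" if "q \<in> N" for q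
    using that rep[of q] proj_scale[of "rep q" "inverse (rep q $ k)"] by (auto simp: N_def u_def vec_smult_eq_0_iff)
  have pN: "p \<in> N" using k by (simp add: N_def)
  \<comment> \<open>on a neighbourhood on which \<open>f (u q) / c\<close> stays in the right half-plane the principal branch of its root is continuous\<close>
  define c where "c = f (u p)"
  have c: "c \<noteq> 0" using p proj_in_zeros[OF f u(1)[OF pN]] u(2)[OF pN] by (simp add: c_def)
  define U where "U = (\<lambda>q. Re (f (u q) / c)) -` {0<..} \<inter> N"
  have contf: "continuous_on N (\<lambda>q. f (u q) / c)"
    using c by (intro continuous_intros hform_continuous_comp[OF f contu]) auto
  then have "continuous_on N (\<lambda>q. Re (f (u q) / c))" by (rule continuous_on_Re)
  then have oU: "open U" unfolding U_def by (rule open_preimage_on[OF oN]) simp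
  have UN: "U \<subseteq> N" by (auto simp: U_def)
  have fnz: "f (u q) \<noteq> 0" if "q \<in> U" for q using that by (auto simp: U_def)
  have "continuous_on U (\<lambda>q. csqrt (f (u q) / c))"
  proof (rule continuous_on_compose2[of "{z. Re z > 0}" csqrt])
    show "continuous_on {z. Re z > 0} csqrt"
      by (intro continuous_at_imp_continuous_on ballI continuous_at_csqrt) (auto simp: complex_nonpos_Reals_iff)
    show "continuous_on U (\<lambda>q. f (u q) / c)" by (rule continuous_on_subset[OF contf UN])
  qed (auto simp: U_def)
  then have s1: "continuous_on U (\<lambda>q. csqrt (f (u q) / c) * csqrt c)" by (intro continuous_intros)
  have s2: "(csqrt (f (u q) / c) * csqrt c)\<^sup>2 = f (u q)" for q
    using c by (simp add: power_mult_distrib)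
  have s3: "csqrt (f (u q) / c) * csqrt c \<noteq> 0" if "q \<in> U" for q using fnz[OF that] c by simp
  have s4: "u q \<noteq> 0" if "q \<in> U" for q using u(1) UN that by blast
  obtain \<phi> where \<phi>: "sec (\<lambda>z. qroot f (proj (u z))) U \<phi>"
    using sec_qroot_of_sqrt[OF f continuous_on_subset[OF contu UN] s4 s1 s3 s2] by blast
  then have "sec (qroot f) U \<phi>" using u(2) UN unfolding sec_def by (simp cong: continuous_on_cong add: subset_iff)
  moreover have "p \<in> U" using pN c by (simp add: U_def c_def)
  moreover have "U \<inter> zeros f = {}" using proj_in_zeros[OF f u(1)] u(2) fnz UN by (metis disjoint_iff subsetD)
  ultimately show ?thesis using oU by blast
qed

text \<open>Divided by the half-angle rotation, a continuous square root on a circle would be a continuous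
  function with two values, hence constant; but this quotient changes sign along a full turn.\<close>

lemma no_sqrt_circle:
  assumes "r > 0" "continuous_on (sphere 0 r) s" "\<And>z::complex. z \<in> sphere 0 r \<Longrightarrow> (s z)\<^sup>2 = z"
  shows False
proof -
  define g where "g t = s (of_real r * cis t) / cis (t / 2)" for t
  have in_sphere: "of_real r * cis t \<in> sphere 0 r" for t using assms(1) by (simp add: norm_mult)
  have "continuous_on {0..2*pi} (\<lambda>t. s (of_real r * cis t))"
    by (rule continuous_on_compose2[OF assms(2)]) (use in_sphere in \<open>auto intro!: continuous_intros\<close>)
  then have contg: "continuous_on {0..2*pi} g" unfolding g_def by (intro continuous_intros) auto
  have "(cis (t / 2))\<^sup>2 = cis t" for t by (simp add: power2_eq_square cis_mult)
  then have "(g t)\<^sup>2 = of_real r" for t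
    using assms(3)[OF in_sphere[of t]] by (simp add: g_def power_divide)
  then have "g t = csqrt r \<or> g t = - csqrt r" for t by (metis power2_csqrt power2_eq_iff)
  then have "g ` {0..2*pi} \<subseteq> {csqrt r, - csqrt r}" by blast
  then have "finite (g ` {0..2*pi})" by (rule finite_subset) auto
  moreover have "connected (g ` {0..2*pi})" by (intro connected_continuous_image contg) auto
  ultimately have "g ` {0..2*pi} = {} \<or> (\<exists>c. g ` {0..2*pi} = {c})" by (simp only: connected_finite_iff_sing)
  then have "g 0 = g (2*pi)" using pi_gt_zero by (metis atLeastAtMost_iff empty_iff image_eqI less_eq_real_def mult_nonneg_nonneg singletonD zero_le_numeral)
  moreover have "g 0 = s r" "g (2*pi) = - s r" by (simp_all add: g_def)
  ultimately have "s r = 0" by simp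
  then show False using assms(1) assms(3)[of "of_real r"] by simp
qed

text \<open>In a chart whose second coordinate is the value of \<open>f\<close>, a section near the curve would be a
  continuous square root of that coordinate on a small circle around zero.\<close>

lemma qroot_ramified:
  assumes f: "hform 4 f" and v0: "v0 \<noteq> 0" "f v0 = 0" "hderiv f v0 (axis k 1) \<noteq> 0"
    and U: "open U" "proj v0 \<in> U"
  shows "\<not> sec (qroot f) (U - zeros f) \<phi>"
proof
  assume \<phi>: "sec (qroot f) (U - zeros f) \<phi>"
  obtain V u where "curve_chart f v0 V u" by (rule curve_chart_ex[OF f v0])
  note V = curve_chartD[OF this]
  define V' where "V' = (\<lambda>z. proj (u z)) -` U \<inter> V"
  have "continuous_on V (\<lambda>z. proj (u z))" by (intro continuous_on_proj_comp V)
  then have "open V'" unfolding V'_def using continuous_on_open_vimage[OF V(1)] U(1) by blast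
  then have "open {z. (0, z) \<in> V'}"
    using open_vimage[of V' "\<lambda>z. (0, z)"] by (simp add: vimage_def continuous_intros)
  moreover have "0 \<in> {z. (0, z) \<in> V'}" using V U by (simp add: V'_def)
  ultimately obtain r where r: "r > 0" "cball 0 r \<subseteq> {z. (0, z) \<in> V'}" using open_contains_cball by metis
  define S where "S = sphere (0::complex) r"
  have S: "(0, z) \<in> V'" "z \<noteq> 0" if "z \<in> S" for z using that r by (auto simp: S_def subset_iff)
  have contu: "continuous_on S (\<lambda>z. u (0, z))"
    by (rule continuous_on_compose2[OF V(3)]) (use S in \<open>auto simp: V'_def intro!: continuous_intros\<close>)
  have nz: "u (0, z) \<noteq> 0" "f (u (0, z)) = z" if "z \<in> S" for z using S[OF that] V by (auto simp: V'_def)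
  have "sec (\<lambda>z. qroot f (proj (u (0, z)))) S (\<lambda>z. \<phi> (proj (u (0, z))))"
  proof (rule sec_comp[OF \<phi>])
    show "continuous_on S (\<lambda>z. proj (u (0, z)))" by (intro continuous_on_proj_comp contu nz)
    show "(\<lambda>z. proj (u (0, z))) ` S \<subseteq> U - zeros f"
      using S nz proj_in_zeros[OF f] by (auto simp: V'_def)
  qed
  then obtain s where "continuous_on S s" "\<And>z. z \<in> S \<Longrightarrow> (s z)\<^sup>2 = f (u (0, z))"
    using sqrt_of_sec_qroot[OF f contu] nz S by metis
  then show False using no_sqrt_circle[OF r(1), of s] nz unfolding S_def by metis
qed

section \<open>Global sections over the complement of a curve\<close>

lemma vector_frame:
  fixes a :: "complex^3"
  assumes "a \<noteq> 0"
  obtains A B :: "complex^3^3" where "A ** B = mat 1" "B ** A = mat 1" "A *v axis 3 1 = a"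
proof -
  obtain i where i: "a $ i \<noteq> 0" using assms by (auto simp: vec_eq_iff)
  have "\<exists>j k. j \<noteq> i \<and> k \<noteq> i \<and> j \<noteq> k"
  proof -
    have "card (UNIV - {i} :: 3 set) = 2" by simp
    then obtain j k where "UNIV - {i} = {j, k}" "j \<noteq> k" unfolding card_2_iff by blast
    then show ?thesis by blast
  qed
  then obtain j k where jk: "j \<noteq> i" "k \<noteq> i" "j \<noteq> k" by blast
  obtain A B :: "complex^3^3" where AB: "A ** B = mat 1" "B ** A = mat 1"
    "\<And>v. A *v v = (v $ 1) *s axis j 1 + (v $ 2) *s axis k 1 + (v $ 3) *s a"
  proof (rule matrix_of_columns[of "axis j 1" "axis k 1" a])
    fix x y c assume 0: "x *s axis j 1 + y *s axis k 1 + c *s a = 0"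
    have "(x *s axis j 1 + y *s axis k 1 + c *s a) $ i = 0" by (simp add: 0)
    then have c: "c = 0" using i jk by (simp add: axis_def)
    have "(x *s axis j 1 + y *s axis k 1 + c *s a) $ j = 0" by (simp add: 0)
    then have x: "x = 0" using c jk by (simp add: axis_def)
    have "(x *s axis j 1 + y *s axis k 1 + c *s a) $ k = 0" by (simp add: 0)
    then have "y = 0" using c x jk by (simp add: axis_def)
    with x c show "x = 0 \<and> y = 0 \<and> c = 0" by simp
  qed blast
  have "A *v axis 3 1 = a" unfolding AB(3) by (simp add: axis_def)
  with AB that show ?thesis by blast
qed

text \<open>A frame whose last column is the coefficient vector of \<open>l\<close>, transposed.\<close>

lemma covector_frame:
  assumes l: "hform 1 l" "l w \<noteq> 0"
  obtains A B :: "complex^3^3" where "A ** B = mat 1" "B ** A = mat 1" "\<And>v. (B *v v) $ 3 = l v"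
proof -
  obtain c where c: "l = (\<lambda>v. \<Sum>i\<in>UNIV. c i * v $ i)" using l(1) unfolding hform_1_iff by blast
  have "\<exists>i. c i \<noteq> 0" using l(2) unfolding c by (metis (no_types, lifting) mult_zero_left sum.neutral)
  then have "(\<chi> i. c i) \<noteq> 0" by (auto simp: vec_eq_iff)
  then obtain A0 B0 :: "complex^3^3" where A0: "A0 ** B0 = mat 1" "B0 ** A0 = mat 1" "A0 *v axis 3 1 = (\<chi> i. c i)"
    by (rule vector_frame)
  have "A0 $ i $ 3 = c i" for i
  proof -
    have "A0 $ i $ 3 = (A0 *v axis 3 1) $ i" by (simp add: matrix_vector_mult_def axis_def if_distrib cong: if_cong)
    then show ?thesis by (simp add: A0(3))
  qed
  then have "(transpose A0 *v v) $ 3 = l v" for v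
    by (simp add: matrix_vector_mult_def transpose_def c)
  moreover have "transpose B0 ** transpose A0 = mat 1" "transpose A0 ** transpose B0 = mat 1"
    using A0(1,2) by (simp_all flip: matrix_transpose_mul add: transpose_mat)
  ultimately show ?thesis using that by blast
qed

lemma hform_common_nonzero:
  assumes F: "hform d F" "F v \<noteq> 0" and G: "hform e G" "G w \<noteq> 0"
  obtains u where "F u \<noteq> 0" "G u \<noteq> 0"
proof -
  obtain p where p: "\<And>s. poly p s = F (v + s *s (w - v))" using hform_poly[OF F(1)] by metis
  obtain q where q: "\<And>s. poly q s = G (v + s *s (w - v))" using hform_poly[OF G(1)] by metis
  have "p \<noteq> 0" using p[of 0] F(2) by auto
  moreover have "q \<noteq> 0" using q[of 1] G(2) by auto
  ultimately have "finite ({s. poly p s = 0} \<union> {s. poly q s = 0})" by (simp add: poly_roots_finite)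
  then obtain s where "s \<notin> {s. poly p s = 0} \<union> {s. poly q s = 0}"
    using ex_new_if_finite infinite_UNIV_char_0 by blast
  then have "F (v + s *s (w - v)) \<noteq> 0" "G (v + s *s (w - v)) \<noteq> 0" unfolding p[symmetric] q[symmetric] by auto
  then show ?thesis by (rule that)
qed

lemma connected_form_complement:
  assumes F: "hform (Suc d) F"
  shows "connected (proj ` {v. F v \<noteq> 0})"
proof (rule connected_continuous_image)
  have "F 0 = 0" using hform_scale[OF F, of 0 0] by simp
  then show "continuous_on {v. F v \<noteq> 0} proj"
    by (intro continuous_on_subset[OF continuous_on_proj]) auto
  have "connected {v \<in> UNIV. F v \<noteq> 0}"
  proof (rule connected_nonzero_set)
    fix x y :: "complex^3"
    obtain p where "\<And>s. poly p s = F (x + s *s (y - x))" using hform_poly[OF F] by metis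
    then show "\<exists>m p. continuous_on UNIV m \<and> m 0 = x \<and> m 1 = y \<and> convex {t. m t \<in> UNIV} \<and> (\<forall>t. F (m t) = poly p t)"
      by (intro exI[of _ "\<lambda>t. x + t *s (y - x)"] exI[of _ p])
         (auto intro!: continuous_intros continuous_on_vec_smult)
  qed auto
  then show "connected {v. F v \<noteq> 0}" by simp
qed

lemma aff_line: "aff (fst x + t * (fst y - fst x), snd x + t * (snd y - snd x)) = aff x + t *s (aff y - aff x)"
  by (simp add: vec_eq_iff forall_3 algebra_simps)

text \<open>Affine space is contractible, and removing a curve keeps boxes connected, so that a cover of the
  complement of the curve which is trivial around every point of the affine plane is trivial.\<close>

lemma sec_affine:
  fixes y :: "cp2 \<Rightarrow> complex^'n"
  assumes AB: "A ** B = mat 1" "B ** A = mat 1" and F: "hform d F" "F (A *v aff z0) \<noteq> 0"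
    and D: "\<And>z. achart A z \<in> D \<longleftrightarrow> F (A *v aff z) \<noteq> 0"
    and nz: "\<And>p. p \<in> D \<Longrightarrow> y p \<noteq> 0"
    and loc: "\<And>p. p \<in> range (achart A) \<Longrightarrow> \<exists>U \<phi>. open U \<and> p \<in> U \<and> sec y (U \<inter> D) \<phi>"
  shows "\<exists>\<phi>. sec y (range (achart A) \<inter> D) \<phi>"
proof -
  define D' where "D' = {z. F (A *v aff z) \<noteq> 0}"
  have "\<exists>\<phi>. sec (\<lambda>z. y (achart A z)) D' \<phi>"
  proof (rule sec_plane)
    show "y (achart A z) \<noteq> 0" if "z \<in> D'" for z using that D nz by (simp add: D'_def)
    show "z0 \<in> D'" using F(2) by (simp add: D'_def)
    show "\<exists>U \<phi>. open U \<and> z \<in> U \<and> sec (\<lambda>z. y (achart A z)) (U \<inter> D') \<phi>" for z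
    proof -
      obtain U \<phi> where U: "open U" "achart A z \<in> U" "sec y (U \<inter> D) \<phi>" using loc[of "achart A z"] by blast
      have "sec (\<lambda>z. y (achart A z)) (achart A -` U \<inter> D') (\<lambda>z. \<phi> (achart A z))"
        by (rule sec_comp[OF U(3) continuous_on_achart[OF AB]]) (use D in \<open>auto simp: D'_def\<close>)
      moreover have "open (achart A -` U)" by (rule open_vimage[OF U(1) continuous_on_achart[OF AB]])
      ultimately show ?thesis using U(2) by blast
    qed
    show "connected (box c d \<inter> D')" for c d
    proof -
      have "connected {x \<in> box c d. F (A *v aff x) \<noteq> 0}"
      proof (rule connected_nonzero_set)
        fix x y :: "complex \<times> complex"
        obtain p where p: "\<And>s. poly p s = F (A *v aff x + s *s (A *v (aff y - aff x)))"
          using hform_poly[OF F(1)] by metis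
        define m where "m t = (fst x + t * (fst y - fst x), snd x + t * (snd y - snd x))" for t
        have "{t. m t \<in> box c d} = (\<lambda>t. (t * (fst y - fst x), t * (snd y - snd x))) -` ((\<lambda>z. z - x) ` box c d)"
        proof -
          have "w \<in> (\<lambda>z. z - x) ` S \<longleftrightarrow> w + x \<in> S" for w and S :: "(complex \<times> complex) set"
            by (auto simp: image_iff intro!: bexI[of _ "w + x"])
          moreover have "m t = (t * (fst y - fst x), t * (snd y - snd x)) + x" for t
            by (simp add: m_def prod_eq_iff)
          ultimately show ?thesis by auto
        qed
        moreover have "convex ((\<lambda>t. (t * (fst y - fst x), t * (snd y - snd x))) -` ((\<lambda>z. z - x) ` box c d))"
          by (intro convex_linear_vimage convex_translation_subtract) (auto intro!: linearI simp: algebra_simps)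
        moreover have "F (A *v aff (m t)) = poly p t" for t
          unfolding p m_def aff_line by (simp only: matrix_vector_right_distrib vector_scalar_commute)
        moreover have "continuous_on UNIV m" unfolding m_def by (intro continuous_intros)
        ultimately show "\<exists>m p. continuous_on UNIV m \<and> m 0 = x \<and> m 1 = y \<and> convex {t. m t \<in> box c d} \<and>
            (\<forall>t. F (A *v aff (m t)) = poly p t)"
          by (intro exI[of _ m] exI[of _ p]) (auto simp: m_def)
      qed auto
      then show ?thesis by (simp add: D'_def Int_def)
    qed
  qed
  then obtain \<phi> where \<phi>: "sec (\<lambda>z. y (achart A z)) D' \<phi>" by blast
  have "sec y (achart A ` D') (\<lambda>p. \<phi> (inv_into UNIV (achart A) p))"
    by (rule sec_comp_inj[where k = "achart A" and V = UNIV and x = y, OF _ _ _ \<phi>]) (auto intro: inj_achart[OF AB] open_achart_image[OF AB])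
  moreover have "achart A ` D' = range (achart A) \<inter> D" using D by (auto simp: D'_def)
  ultimately show ?thesis by auto
qed

text \<open>The hypothesis \<open>loc\<close> concerns the points of the curve, too: around these the cover is unramified.
  The cover then splits over each of the three standard affine planes, and the complement of the
  curve in the overlaps is connected, so that the three sections can be glued.\<close>

lemma sec_global:
  fixes y :: "cp2 \<Rightarrow> complex^'n"
  assumes f: "hform d f" "f w \<noteq> 0"
    and nz: "\<And>p. p \<notin> zeros f \<Longrightarrow> y p \<noteq> 0"
    and loc: "\<And>p. \<exists>U \<phi>. open U \<and> p \<in> U \<and> sec y (U - zeros f) \<phi>"
  shows "\<exists>\<phi>. sec y (- zeros f) \<phi>"
proof -
  let ?D = "- zeros f"
  have "\<exists>A B :: complex^3^3. A ** B = mat 1 \<and> B ** A = mat 1 \<and> (\<forall>v. (B *v v) $ 3 = v $ k)" for k :: 3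
  proof -
    have nz: "(axis k 1 :: complex^3) $ k \<noteq> 0" by (simp add: axis_def)
    show ?thesis by (rule covector_frame[OF hform_coord nz]) blast
  qed
  then obtain A B :: "3 \<Rightarrow> complex^3^3" where AB: "\<And>k. A k ** B k = mat 1" "\<And>k. B k ** A k = mat 1" "\<And>k v. (B k *v v) $ 3 = v $ (k::3)"
    by metis
  define U where "U k = range (achart (A k))" for k
  have U: "proj v \<in> U k \<longleftrightarrow> v $ k \<noteq> 0" if "v \<noteq> 0" for v k
    unfolding U_def range_achart[OF AB(1,2) that] AB(3) ..
  have oU: "open (U k)" for k unfolding U_def by (rule open_achart_image[OF AB(1,2)]) simp
  have c: "hform 1 (\<lambda>v. v $ k)" for k :: 3 by (rule hform_coord)
  \<comment> \<open>a point off the curve and off the coordinate lines, common to all charts\<close>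
  obtain u1 where u1: "f u1 \<noteq> 0" "u1 $ 1 \<noteq> 0" using hform_common_nonzero[OF f c[of 1], of "axis 1 1"] by (auto simp: axis_def)
  obtain u2 where u2: "f u2 * u2 $ 1 \<noteq> 0" "u2 $ 2 \<noteq> 0"
    using hform_common_nonzero[OF hform_mult[OF f(1) c[of 1]] _ c[of 2], of u1 "axis 2 1"] u1 by (auto simp: axis_def)
  obtain u where u: "f u \<noteq> 0" "u $ 1 \<noteq> 0" "u $ 2 \<noteq> 0" "u $ 3 \<noteq> 0"
    using hform_common_nonzero[OF hform_mult[OF hform_mult[OF f(1) c[of 1]] c[of 2]] _ c[of 3], of u2 "axis 3 1"] u2
    by (auto simp: axis_def)
  then have u0: "u \<noteq> 0" by auto
  have uk: "u $ k \<noteq> 0" for k using u exhaust_3[of k] by auto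
  have sec: "\<exists>\<phi>. sec y (U k \<inter> ?D) \<phi>" for k
  proof -
    have "proj u \<in> U k" using U[OF u0] uk by blast
    then obtain z0 where "proj u = achart (A k) z0" by (auto simp: U_def)
    then have "achart (A k) z0 \<notin> zeros f" using proj_in_zeros[OF f(1) u0] u(1) by auto
    have zer: "achart (A k) z \<in> ?D \<longleftrightarrow> f (A k *v aff z) \<noteq> 0" for z
      unfolding achart_def using proj_in_zeros[OF f(1) achart_nz[OF AB(1,2)]] by blast
    show ?thesis unfolding U_def
    proof (rule sec_affine[OF AB(1,2) f(1) _ zer])
      show "f (A k *v aff z0) \<noteq> 0" using zer \<open>achart (A k) z0 \<notin> zeros f\<close> by blast
      show "\<exists>U \<phi>. open U \<and> p \<in> U \<and> sec y (U \<inter> - zeros f) \<phi>" for p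
        using loc[of p] by (simp add: Diff_eq)
    qed (use nz in auto)
  qed
  have conn: "connected (U i \<inter> U j \<inter> ?D)" and inh: "proj u \<in> U i \<inter> U j \<inter> ?D" for i j
  proof -
    have "hform (Suc (Suc d)) (\<lambda>v. v $ i * (v $ j * f v))" using hform_mult[OF c hform_mult[OF c f(1)]] by simp
    then have "connected (proj ` {v. v $ i * (v $ j * f v) \<noteq> 0})" by (rule connected_form_complement)
    moreover have "proj ` {v. v $ i * (v $ j * f v) \<noteq> 0} = U i \<inter> U j \<inter> ?D"
    proof (intro equalityI subsetI)
      fix p assume "p \<in> U i \<inter> U j \<inter> ?D"
      then show "p \<in> proj ` {v. v $ i * (v $ j * f v) \<noteq> 0}"
        using rep[of p] U[OF rep(1)[of p]] proj_in_zeros[OF f(1) rep(1)[of p]] by (intro image_eqI[of _ _ "rep p"]) auto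
    next
      fix p assume "p \<in> proj ` {v. v $ i * (v $ j * f v) \<noteq> 0}"
      then obtain v where v: "p = proj v" "v $ i \<noteq> 0" "v $ j \<noteq> 0" "f v \<noteq> 0" by auto
      then have "v \<noteq> 0" by auto
      with v show "p \<in> U i \<inter> U j \<inter> ?D" using U proj_in_zeros[OF f(1)] by auto
    qed
    ultimately show "connected (U i \<inter> U j \<inter> ?D)" by simp
    show "proj u \<in> U i \<inter> U j \<inter> ?D" using U[OF u0] uk proj_in_zeros[OF f(1) u0] u(1) by auto
  qed
  have nz': "y p \<noteq> 0" if "p \<in> ?D" for p using nz that by blast
  obtain \<phi> where \<phi>: "sec y ((U 1 \<union> U 2) \<inter> ?D) \<phi>"
    using sec_glue[where x = y, OF oU oU _ _ conn nz'] sec[of 1] sec[of 2] by blast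
  have "connected ((U 1 \<union> U 2) \<inter> U 3 \<inter> ?D)"
  proof -
    have "connected (U 1 \<inter> U 3 \<inter> ?D \<union> U 2 \<inter> U 3 \<inter> ?D)"
      using inh by (intro connected_Un conn) blast
    moreover have "U 1 \<inter> U 3 \<inter> ?D \<union> U 2 \<inter> U 3 \<inter> ?D = (U 1 \<union> U 2) \<inter> U 3 \<inter> ?D" by blast
    ultimately show ?thesis by simp
  qed
  then obtain \<psi> where "sec y ((U 1 \<union> U 2 \<union> U 3) \<inter> ?D) \<psi>"
    using sec_glue[where x = y, OF open_Un[OF oU oU] oU \<phi> _ _ nz'] sec[of 3] by blast
  moreover have "?D \<subseteq> (U 1 \<union> U 2 \<union> U 3) \<inter> ?D"
  proof
    fix p assume "p \<in> ?D"
    have "rep p $ 1 \<noteq> 0 \<or> rep p $ 2 \<noteq> 0 \<or> rep p $ 3 \<noteq> 0"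
      using rep(1)[of p] by (auto simp: vec_eq_iff forall_3)
    then show "p \<in> (U 1 \<union> U 2 \<union> U 3) \<inter> ?D"
      using U[OF rep(1)[of p]] rep(2)[of p] \<open>p \<in> ?D\<close> by auto
  qed
  ultimately show ?thesis using sec_subset by blast
qed

definition smooth_form :: "(complex^3 \<Rightarrow> complex) \<Rightarrow> bool" where
  "smooth_form f \<longleftrightarrow> (\<forall>v. v \<noteq> 0 \<and> f v = 0 \<longrightarrow> (\<exists>k. hderiv f v (axis k 1) \<noteq> 0))"

lemma qroot_ramified_on_curve:
  assumes f: "hform 4 f" "smooth_form f" and U: "open U" "p \<in> U" "p \<in> zeros f"
  shows "\<not> sec (qroot f) (U - zeros f) \<phi>"
proof -
  have "f (rep p) = 0" using proj_in_zeros[OF f(1) rep(1)[of p]] U(3) rep(2)[of p] by simp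
  then show ?thesis using qroot_ramified[OF f(1) rep(1)] f(2) U rep unfolding smooth_form_def by metis
qed

lemma qroot_nonzero: "hform 4 f \<Longrightarrow> p \<notin> zeros f \<Longrightarrow> qroot f p \<noteq> 0"
  using qroot_nz[of f "rep p"] rep[of p] proj_in_zeros[of 4 f "rep p"] by auto

section \<open>Homeomorphisms preserve the double cover\<close>

text \<open>The product of the double cover \<open>?x\<close> with its pullback \<open>?y\<close> under \<open>h\<close> is trivial around every point
  of the quartic by \<open>sec_tensor_pdisc\<close>, as both factors are ramified there; hence it splits over the
  complement of the quartic by \<open>sec_global\<close>. Cancelling the pullback of the given section leaves a
  section of \<open>?x\<close>.\<close>

lemma qroot_sec_homeo:
  assumes f: "hform 4 f" "smooth_form f" and w: "f w \<noteq> 0"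
    and h: "homeomorphism UNIV UNIV h g" "h ` zeros f = zeros f"
    and \<phi>: "sec (qroot f) (h ` A) \<phi>" and A: "A \<subseteq> - zeros f"
  shows "\<exists>\<psi>. sec (qroot f) A \<psi>"
proof -
  let ?x = "qroot f" and ?y = "\<lambda>p. qroot f (h p)"
  have hg: "h (g p) = p" "g (h p) = p" for p using h(1) by (auto simp: homeomorphism_def)
  have conth: "continuous_on S h" "continuous_on S g" for S
    using h(1) continuous_on_subset unfolding homeomorphism_def by blast+
  have hz: "h p \<in> zeros f \<longleftrightarrow> p \<in> zeros f" for p
  proof
    assume "h p \<in> zeros f"
    then obtain q where "q \<in> zeros f" "h q = h p" using h(2) by (metis imageE)
    then show "p \<in> zeros f" using hg by metis
  qed (use h(2) in blast)
  have hopen: "open (h ` U)" if "open U" for U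
  proof -
    have "h ` U = g -` U" using hg by (auto simp: image_iff) metis
    then show ?thesis using open_vimage[OF that conth(2)] by simp
  qed
  have locy: "\<exists>U \<phi>. open U \<and> p \<in> U \<and> U \<inter> zeros f = {} \<and> sec ?y U \<phi>" if "p \<notin> zeros f" for p
  proof -
    have "h p \<notin> zeros f" using that hz by blast
    from qroot_local[OF f(1) this] obtain U \<phi> where
      U: "open U" "h p \<in> U" "U \<inter> zeros f = {}" "sec (qroot f) U \<phi>" by blast
    have "sec ?y (h -` U) (\<lambda>p. \<phi> (h p))" by (rule sec_comp[OF U(4) conth(1)]) auto
    moreover have "h -` U \<inter> zeros f = {}" using U(3) hz by blast
    ultimately show ?thesis using U open_vimage[OF U(1) conth(1)] by blast
  qed
  have ramy: "\<not> sec ?y (U - zeros f) \<phi>" if U: "open U" "p \<in> U" "p \<in> zeros f" for U p \<phi>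
  proof
    assume "sec ?y (U - zeros f) \<phi>"
    then have "sec (\<lambda>q. ?y (g q)) (h ` U - zeros f) (\<lambda>q. \<phi> (g q))"
      by (rule sec_comp) (use conth(2) hg hz in auto)
    then have "sec (qroot f) (h ` U - zeros f) (\<lambda>q. \<phi> (g q))" by (simp add: hg)
    moreover have "\<not> sec (qroot f) (h ` U - zeros f) (\<lambda>q. \<phi> (g q))"
      using that hz by (intro qroot_ramified_on_curve[OF f hopen, of U "h p"]) auto
    ultimately show False by blast
  qed
  have "\<exists>\<sigma>. sec (tensor ?x ?y) (- zeros f) \<sigma>"
  proof (rule sec_global[OF f(1) w])
    show "tensor ?x ?y p \<noteq> 0" if "p \<notin> zeros f" for p
      using that hz qroot_nonzero[OF f(1)] by (intro tensor_nz) auto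
    show "\<exists>U \<phi>. open U \<and> p \<in> U \<and> sec (tensor ?x ?y) (U - zeros f) \<phi>" for p
    proof (cases "p \<in> zeros f")
      case False
      obtain U \<phi> where U: "open U" "p \<in> U" "sec ?x U \<phi>" using qroot_local[OF f(1) False] by blast
      obtain V \<psi> where V: "open V" "p \<in> V" "sec ?y V \<psi>" using locy[OF False] by blast
      have "sec (tensor ?x ?y) (U \<inter> V - zeros f) (\<lambda>p. \<phi> p * \<psi> p)"
        by (intro sec_tensor sec_subset[OF U(3)] sec_subset[OF V(3)]) auto
      then show ?thesis using U V by blast
    next
      case True
      have fr: "f (rep p) = 0" using proj_in_zeros[OF f(1) rep(1)[of p]] True rep(2)[of p] by simp
      then obtain k where k: "hderiv f (rep p) (axis k 1) \<noteq> 0" using f(2) rep(1) unfolding smooth_form_def by blast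
      obtain V u where "curve_chart f (rep p) V u" by (rule curve_chart_ex[OF f(1) rep(1)[of p] fr k])
      note V = curve_chartD[OF this]
      define K where "K z = proj (u z)" for z
      have K: "K z \<in> zeros f \<longleftrightarrow> snd z = 0" if "z \<in> V" for z
        unfolding K_def using proj_in_zeros[OF f(1) V(4)[OF that]] V(5)[OF that] by simp
      have contK: "continuous_on V K" unfolding K_def by (intro continuous_on_proj_comp V)
      obtain e where e: "e > 0" "ball (0, 0) e \<subseteq> V" using V(1,2) open_contains_ball by metis
      \<comment> \<open>a polydisc of this radius fits into the ball of radius \<open>e\<close>\<close>
      define r where "r = e / 4"
      define P where "P = {z :: complex \<times> complex. \<bar>Re (fst z)\<bar> < r \<and> \<bar>Im (fst z)\<bar> < r \<and> norm (snd z) < r}"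
      have r: "r > 0" using e by (simp add: r_def)
      have PV: "P \<subseteq> V"
      proof
        fix z assume z: "z \<in> P"
        have "norm z \<le> norm (fst z) + norm (snd z)" using norm_Pair_le[of "fst z" "snd z"] by simp
        moreover have "norm (fst z) < r + r" using cmod_le[of "fst z"] z by (auto simp: P_def)
        ultimately have "norm z < e" using z by (auto simp: P_def r_def)
        then show "z \<in> V" using e(2) by (auto simp: dist_norm norm_minus_commute zero_prod_def[symmetric])
      qed
      have oP: "open P" unfolding P_def
        by (intro open_Collect_conj open_Collect_less continuous_intros)
      have pd: "pdisc r = P - {z. snd z = 0}" unfolding pdisc_def P_def by auto
      have KP: "K ` pdisc r = K ` P - zeros f" using K PV pd by auto
      have oKP: "open (K ` P)" unfolding K_def by (rule V(8)[OF oP PV])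
      have pKP: "p \<in> K ` P" using V(6) rep(2)[of p] r by (auto simp: K_def P_def intro!: image_eqI[of _ _ "(0, 0)"])
      \<comment> \<open>sections can be carried back and forth along the chart \<open>K\<close>\<close>
      have push: "sec y (K ` P - zeros f) (\<lambda>p. \<theta> (inv_into V K p))" if "sec (\<lambda>z. y (K z)) (pdisc r) \<theta>"
        for y :: "cp2 \<Rightarrow> complex^'n" and \<theta>
        unfolding KP[symmetric]
        by (rule sec_comp_inj[where k = K and x = y, OF V(1) _ _ that]) (use V(7,8) PV pd in \<open>auto simp: K_def[abs_def]\<close>)
      have pull: "\<exists>U \<phi>. open U \<and> z \<in> U \<and> sec (\<lambda>z. y (K z)) (U \<inter> pdisc r) \<phi>"
        if z: "z \<in> pdisc r" and y: "\<exists>U \<phi>. open U \<and> K z \<in> U \<and> U \<inter> zeros f = {} \<and> sec y U \<phi>"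
        for y :: "cp2 \<Rightarrow> complex^'n" and z
      proof -
        obtain U \<phi> where U: "open U" "K z \<in> U" "sec y U \<phi>" using y by blast
        have "continuous_on (K -` U \<inter> V) K" using contK by (rule continuous_on_subset) auto
        then have "sec (\<lambda>z. y (K z)) (K -` U \<inter> V) (\<lambda>z. \<phi> (K z))" by (rule sec_comp[OF U(3)]) auto
        then have "sec (\<lambda>z. y (K z)) ((K -` U \<inter> V) \<inter> pdisc r) (\<lambda>z. \<phi> (K z))" by (rule sec_subset) auto
        moreover have "open (K -` U \<inter> V)" using continuous_on_open_vimage[OF V(1), of K] contK U(1) by blast
        moreover have "z \<in> K -` U \<inter> V" using U z PV pd by auto
        ultimately show ?thesis by blast
      qed
      have Kz: "K z \<notin> zeros f" if "z \<in> pdisc r" for z using that K PV pd by blast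
      have "\<exists>\<theta>. sec (tensor (\<lambda>z. ?x (K z)) (\<lambda>z. ?y (K z))) (pdisc r) \<theta>"
      proof (rule sec_tensor_pdisc[OF r])
        show "?x (K z) \<noteq> 0 \<and> ?y (K z) \<noteq> 0" if "z \<in> pdisc r" for z
          using Kz[OF that] hz qroot_nonzero[OF f(1)] by blast
        show "\<exists>U \<phi>. open U \<and> z \<in> U \<and> sec (\<lambda>z. ?x (K z)) (U \<inter> pdisc r) \<phi>" if "z \<in> pdisc r" for z
          by (rule pull[OF that qroot_local[OF f(1) Kz[OF that]]])
        show "\<exists>U \<phi>. open U \<and> z \<in> U \<and> sec (\<lambda>z. ?y (K z)) (U \<inter> pdisc r) \<phi>" if "z \<in> pdisc r" for z
          by (rule pull[OF that locy[OF Kz[OF that]]])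
        show "\<not> sec (\<lambda>z. ?x (K z)) (pdisc r) \<theta>" for \<theta>
          using push[of ?x \<theta>] qroot_ramified_on_curve[OF f oKP pKP True] by blast
        show "\<not> sec (\<lambda>z. ?y (K z)) (pdisc r) \<theta>" for \<theta>
          using push[of ?y \<theta>] ramy[OF oKP pKP True] by blast
      qed
      then obtain \<theta> where "sec (\<lambda>z. tensor ?x ?y (K z)) (pdisc r) \<theta>" by (auto simp: tensor_def[abs_def])
      then have "sec (tensor ?x ?y) (K ` P - zeros f) (\<lambda>p. \<theta> (inv_into V K p))" unfolding KP[symmetric]
        by (rule sec_comp_inj[where k = K, OF V(1), rotated 2]) (use V(7,8) PV pd in \<open>auto simp: K_def[abs_def]\<close>)
      then show ?thesis using oKP pKP by blast
    qed
  qed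
  then obtain \<sigma> where "sec (tensor ?x ?y) (- zeros f) \<sigma>" by blast
  then have "sec (tensor ?x ?y) A \<sigma>" using A by (rule sec_subset)
  moreover have "sec ?y A (\<lambda>p. \<phi> (h p))" by (rule sec_comp[OF \<phi> conth(1)]) auto
  moreover have "?y p \<noteq> 0" if "p \<in> A" for p using that A hz qroot_nonzero[OF f(1)] by auto
  ultimately show ?thesis using sec_tensor_cancel by blast
qed

text \<open>Over the complement of a line, an affine plane, every double cover splits, whereas the double cover
  of the complement of the quartic is ramified along the quartic.\<close>

lemma zeros_quartic_not_line:
  assumes f: "hform 4 f" "smooth_form f" and p: "p \<in> zeros f"
    and h: "homeomorphism UNIV UNIV h g" and l: "hform 1 l" "l w \<noteq> 0" "h ` zeros f = zeros l"
  shows False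
proof -
  have hg: "h (g p) = p" "g (h p) = p" for p using h(1) by (auto simp: homeomorphism_def)
  have conth: "continuous_on S h" "continuous_on S g" for S
    using h(1) continuous_on_subset unfolding homeomorphism_def by blast+
  have gz: "g q \<in> zeros f \<longleftrightarrow> q \<in> zeros l" for q using l(3) hg by (metis image_iff)
  obtain A B :: "complex^3^3" where AB: "A ** B = mat 1" "B ** A = mat 1" "\<And>v. (B *v v) $ 3 = l v"
    using covector_frame[OF l(1,2)] by metis
  have ran: "q \<in> range (achart A) \<longleftrightarrow> q \<notin> zeros l" for q
    using range_achart[OF AB(1,2) rep(1)[of q]] proj_in_zeros[OF l(1) rep(1)[of q]] rep(2)[of q] AB(3) by simp
  have "\<exists>\<phi>. sec (\<lambda>q. qroot f (g q)) (range (achart A) \<inter> range (achart A)) \<phi>"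
  proof (rule sec_affine[OF AB(1,2) hform_const[of 1]])
    show "qroot f (g q) \<noteq> 0" if "q \<in> range (achart A)" for q
      using that ran gz qroot_nonzero[OF f(1)] by blast
    show "\<exists>U \<phi>. open U \<and> q \<in> U \<and> sec (\<lambda>q. qroot f (g q)) (U \<inter> range (achart A)) \<phi>" if "q \<in> range (achart A)" for q
    proof -
      have "g q \<notin> zeros f" using that ran gz by blast
      from qroot_local[OF f(1) this] obtain U \<phi> where U: "open U" "g q \<in> U" "sec (qroot f) U \<phi>" by blast
      have "sec (\<lambda>q. qroot f (g q)) (g -` U) (\<lambda>p. \<phi> (g p))" by (rule sec_comp[OF U(3) conth(2)]) auto
      then have "sec (\<lambda>q. qroot f (g q)) (g -` U \<inter> range (achart A)) (\<lambda>p. \<phi> (g p))" by (rule sec_subset) auto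
      then show ?thesis using U open_vimage[OF U(1) conth(2)] by blast
    qed
  qed auto
  then obtain \<phi> where "sec (\<lambda>q. qroot f (g q)) (range (achart A)) \<phi>" by auto
  moreover have "h ` (UNIV - zeros f) \<subseteq> range (achart A)"
  proof clarify
    fix p assume "p \<notin> zeros f"
    then show "h p \<in> range (achart A)" using ran[of "h p"] gz[of "h p"] hg by simp
  qed
  ultimately have "sec (\<lambda>p. qroot f (g (h p))) (UNIV - zeros f) (\<lambda>p. \<phi> (h p))"
    by (rule sec_comp[OF _ conth(1)])
  then have "sec (qroot f) (UNIV - zeros f) (\<lambda>p. \<phi> (h p))" by (simp add: hg)
  then show False using qroot_ramified_on_curve[OF f open_UNIV UNIV_I p] by blast
qed

section \<open>Recognising the components\<close>

text \<open>A topological substitute for irreducibility of a germ: the point does not disconnect small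
  neighbourhoods. A smooth complex curve has this property everywhere, as a punctured disc is
  connected; a union of several branches has not.\<close>

definition locally_irreducible_at :: "'a::topological_space set \<Rightarrow> 'a \<Rightarrow> bool" where
  "locally_irreducible_at K p \<longleftrightarrow>
     (\<forall>U. open U \<longrightarrow> p \<in> U \<longrightarrow> (\<exists>N. open N \<and> p \<in> N \<and> N \<subseteq> U \<and> connected (N \<inter> K - {p})))"

lemma locally_irreducibleD:
  assumes "locally_irreducible_at K p" "open U" "p \<in> U"
  obtains N where "open N" "p \<in> N" "N \<subseteq> U" "connected (N \<inter> K - {p})"
  using assms unfolding locally_irreducible_at_def by blast

lemma locally_irreducible_homeo:
  assumes h: "homeomorphism UNIV UNIV h g" and "locally_irreducible_at K p"
  shows "locally_irreducible_at (h ` K) (h p)"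
  unfolding locally_irreducible_at_def
proof (intro allI impI)
  have hg: "h (g q) = q" "g (h q') = q'" for q q' using h(1) by (auto simp: homeomorphism_def)
  have conth: "continuous_on S h" "continuous_on S' g" for S S'
    using h(1) continuous_on_subset unfolding homeomorphism_def by blast+
  fix U assume U: "open U" "h p \<in> U"
  have "open (h -` U)" by (rule open_vimage[OF U(1) conth(1)])
  then obtain N where N: "open N" "p \<in> N" "N \<subseteq> h -` U" "connected (N \<inter> K - {p})"
    using assms(2) U(2) unfolding locally_irreducible_at_def by (metis vimageI)
  have "connected (h ` (N \<inter> K - {p}))" by (intro connected_continuous_image conth N)
  moreover have "h ` (N \<inter> K - {p}) = g -` N \<inter> h ` K - {h p}"
  proof (intro equalityI subsetI)
    fix q assume "q \<in> h ` (N \<inter> K - {p})"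
    then obtain q' where "q = h q'" "q' \<in> N" "q' \<in> K" "q' \<noteq> p" by blast
    then show "q \<in> g -` N \<inter> h ` K - {h p}" using hg by (auto dest: arg_cong[of _ _ g])
  next
    fix q assume "q \<in> g -` N \<inter> h ` K - {h p}"
    then obtain q' where "q = h q'" "q' \<in> K" "g q \<in> N" "q \<noteq> h p" by blast
    then show "q \<in> h ` (N \<inter> K - {p})" using hg by auto
  qed
  moreover have "open (g -` N)" by (rule open_vimage[OF N(1) conth(2)])
  moreover have "h p \<in> g -` N" using N hg by simp
  moreover have "g -` N \<subseteq> U" using N(3) hg by (metis subsetD subsetI vimageE vimageI2)
  ultimately show "\<exists>N. open N \<and> h p \<in> N \<and> N \<subseteq> U \<and> connected (N \<inter> h ` K - {h p})" by metis
qed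

lemma islimpt_homeo:
  assumes h: "homeomorphism UNIV UNIV h g" and "p islimpt K"
  shows "h p islimpt (h ` K)"
  unfolding islimpt_def
proof (intro allI impI)
  have hg: "g (h q') = q'" for q' using h(1) by (auto simp: homeomorphism_def)
  have conth: "continuous_on UNIV h" using h(1) unfolding homeomorphism_def by blast
  fix T assume T: "h p \<in> T" "open T"
  have "open (h -` T)" by (rule open_vimage[OF T(2) conth])
  then obtain y where "y \<in> K" "y \<in> h -` T" "y \<noteq> p" using assms(2) T(1) unfolding islimpt_def by (metis vimageI)
  then show "\<exists>y\<in>h ` K. y \<in> T \<and> y \<noteq> h p" using hg by (metis image_eqI vimageE)
qed

lemma islimpt_diff_finite:
  fixes p :: "'a::t1_space"
  assumes "p islimpt K" "finite F" shows "p islimpt (K - F)"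
proof -
  have "p islimpt (F \<union> (K - F))" using assms(1) by (rule islimpt_subset) auto
  then show ?thesis using islimpt_Un_finite[OF assms(2)] by blast
qed

lemma finite_Int_Union:
  assumes "finite \<K>" "\<And>K'. K' \<in> \<K> \<Longrightarrow> finite (K \<inter> K')" shows "finite (K \<inter> \<Union>\<K>)"
  unfolding Int_Union using assms by (rule finite_UN_I)

text \<open>A chart of \<open>local_chart\<close>, restricted to the curve and to small neighbourhoods.\<close>

lemma smooth_point_disc:
  assumes f: "hform d f" "smooth_form f" and p: "p \<in> zeros f" and U: "open U" "p \<in> U"
  obtains N e \<gamma> where "open N" "p \<in> N" "N \<subseteq> U" "e > 0" "\<gamma> 0 = rep p"
    "\<And>i. (\<lambda>x. \<gamma> x $ i) holomorphic_on ball 0 e" "\<And>x. x \<in> ball 0 e \<Longrightarrow> \<gamma> x \<noteq> 0"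
    "inj_on (\<lambda>x. proj (\<gamma> x)) (ball 0 e)" "N \<inter> zeros f = (\<lambda>x. proj (\<gamma> x)) ` ball 0 e"
    "\<And>c. (\<chi> i. deriv (\<lambda>x. \<gamma> x $ i) 0) \<noteq> c *s rep p"
proof -
  have fr: "f (rep p) = 0" using proj_in_zeros[OF f(1) rep(1)[of p]] p rep(2)[of p] by simp
  then obtain k where k: "hderiv f (rep p) (axis k 1) \<noteq> 0" using f(2) rep(1) unfolding smooth_form_def by blast
  obtain V u where "curve_chart f (rep p) V u" by (rule curve_chart_ex[OF f(1) rep(1)[of p] fr k])
  note V = curve_chartD[OF this]
  define K where "K z = proj (u z)" for z
  have K0: "K (0, 0) = p" using V(6) rep(2) by (simp add: K_def)
  have Kz: "K z \<in> zeros f \<longleftrightarrow> snd z = 0" if "z \<in> V" for z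
    unfolding K_def using proj_in_zeros[OF f(1) V(4)[OF that]] V(5)[OF that] by simp
  have contK: "continuous_on V K" unfolding K_def by (intro continuous_on_proj_comp V)
  have injK: "inj_on K V" using V(7) by (simp add: K_def[abs_def])
  have "open (K -` U \<inter> V)" by (rule open_preimage_on[OF V(1) contK U(1)])
  moreover have "(0, 0) \<in> K -` U \<inter> V" using V(2) K0 U(2) by simp
  ultimately obtain A B where AB: "open A" "open B" "(0, 0) \<in> A \<times> B" "A \<times> B \<subseteq> K -` U \<inter> V"
    using open_prod_elim[of "K -` U \<inter> V" "(0, 0)"] by blast
  then obtain e where e: "e > 0" "ball 0 e \<subseteq> A" using open_contains_ball by (metis mem_Times_iff fst_conv)
  define P where "P = ball (0 :: complex) e \<times> B"
  have P: "open P" "P \<subseteq> K -` U \<inter> V" "(0, 0) \<in> P" using AB e by (auto simp: P_def open_Times)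
  have xP: "(x, 0) \<in> P" if "x \<in> ball 0 e" for x using AB(3) that by (auto simp: P_def)
  show ?thesis
  proof (rule that[of "K ` P" e "\<lambda>x. u (x, 0)"])
    show "open (K ` P)" unfolding K_def using V(8)[of P] P by auto
    show "p \<in> K ` P" using P(3) K0 by force
    show "K ` P \<subseteq> U" using P by auto
    show "(\<lambda>x. u (x, 0) $ i) holomorphic_on ball 0 e" for i
      by (rule holomorphic_on_subset[OF V(9)]) (use xP P in auto)
    show "u (x, 0) \<noteq> 0" if "x \<in> ball 0 e" for x using xP[OF that] P V(4) by blast
    show "inj_on (\<lambda>x. proj (u (x, 0))) (ball 0 e)"
    proof (rule inj_onI)
      fix x y assume "x \<in> ball 0 e" "y \<in> ball 0 e" "proj (u (x, 0)) = proj (u (y, 0))"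
      then have "(x, 0 :: complex) = (y, 0)" using inj_onD[OF injK, of "(x, 0)" "(y, 0)"] xP P by (auto simp: K_def)
      then show "x = y" by simp
    qed
    show "K ` P \<inter> zeros f = (\<lambda>x. proj (u (x, 0))) ` ball 0 e"
    proof (intro equalityI subsetI)
      fix q assume "q \<in> K ` P \<inter> zeros f"
      then obtain z where z: "z \<in> P" "q = K z" "K z \<in> zeros f" by blast
      then have "snd z = 0" using Kz P by blast
      then have "z = (fst z, 0)" by (simp add: prod_eq_iff)
      then have "q = proj (u (fst z, 0))" using z(2) unfolding K_def by metis
      moreover have "fst z \<in> ball 0 e" using z(1) by (auto simp: P_def)
      ultimately show "q \<in> (\<lambda>x. proj (u (x, 0))) ` ball 0 e" by blast
    next
      fix q assume "q \<in> (\<lambda>x. proj (u (x, 0))) ` ball 0 e"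
      then obtain x where x: "q = K (x, 0)" "x \<in> ball 0 e" unfolding K_def by blast
      then show "q \<in> K ` P \<inter> zeros f" using xP[OF x(2)] Kz[of "(x, 0)"] P by auto
    qed
    show "(\<chi> i. deriv (\<lambda>x. u (x, 0) $ i) 0) \<noteq> c *s rep p" for c by (rule V(10))
  qed (use e V(6) in auto)
qed

lemma continuous_on_holomorphic_vec:
  fixes \<gamma> :: "complex \<Rightarrow> complex^'n"
  assumes "\<And>i. (\<lambda>x. \<gamma> x $ i) holomorphic_on S" shows "continuous_on S \<gamma>"
proof -
  have "continuous_on S (\<lambda>x. \<chi> i. \<gamma> x $ i)"
    by (intro continuous_on_vec_lambda holomorphic_on_imp_continuous_on assms)
  then show ?thesis by simp
qed

lemma smooth_point_irreducible:
  assumes f: "hform d f" "smooth_form f" and p: "p \<in> zeros f"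
  shows "locally_irreducible_at (zeros f) p" "p islimpt zeros f"
proof -
  have key: "\<exists>N. open N \<and> p \<in> N \<and> N \<subseteq> U \<and> connected (N \<inter> zeros f - {p}) \<and> N \<inter> zeros f - {p} \<noteq> {}"
    if U: "open U" "p \<in> U" for U
  proof (rule smooth_point_disc[OF f p U])
    fix N e \<gamma>
    assume N: "open N" "p \<in> N" "N \<subseteq> U" "e > 0" "\<gamma> 0 = rep p"
      "\<And>i. (\<lambda>x. \<gamma> x $ i) holomorphic_on ball 0 e" "\<And>x. x \<in> ball 0 e \<Longrightarrow> \<gamma> x \<noteq> 0"
      "inj_on (\<lambda>x. proj (\<gamma> x)) (ball 0 e)" "N \<inter> zeros f = (\<lambda>x. proj (\<gamma> x)) ` ball 0 e"
    have "proj (\<gamma> 0) = p" using N(5) rep(2) by simp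
    then have eq: "N \<inter> zeros f - {p} = (\<lambda>x. proj (\<gamma> x)) ` (ball 0 e - {0})"
      unfolding N(9) using inj_on_image_set_diff[OF N(8), of "ball 0 e" "{0}"] N(4) by auto
    have "connected ((\<lambda>x. proj (\<gamma> x)) ` (ball 0 e - {0}))"
    proof (rule connected_continuous_image)
      show "continuous_on (ball 0 e - {0}) (\<lambda>x. proj (\<gamma> x))"
        by (rule continuous_on_subset[OF continuous_on_proj_comp[OF continuous_on_holomorphic_vec[OF N(6)] N(7)]]) auto
      show "connected (ball 0 e - {0::complex})" by (intro connected_open_delete) auto
    qed
    moreover have "complex_of_real (e / 2) \<in> ball 0 e - {0}" using N(4) by auto
    then have "(\<lambda>x. proj (\<gamma> x)) ` (ball 0 e - {0}) \<noteq> {}" by blast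
    ultimately show ?thesis using N(1-3) unfolding eq[symmetric] by blast
  qed
  show "locally_irreducible_at (zeros f) p" unfolding locally_irreducible_at_def using key by meson
  show "p islimpt zeros f" unfolding islimpt_def
  proof (intro allI impI)
    fix T assume "p \<in> T" "open T"
    then show "\<exists>y\<in>zeros f. y \<in> T \<and> y \<noteq> p" using key[of T] by blast
  qed
qed

definition line :: "cp2 set \<Rightarrow> (complex^3 \<Rightarrow> complex) \<Rightarrow> bool" where
  "line M l \<longleftrightarrow> hform 1 l \<and> (\<exists>w. l w \<noteq> 0) \<and> M = zeros l"

lemma hderiv_linear:
  assumes "hform 1 l" shows "hderiv l v w = l w"
proof -
  have "((\<lambda>t. l (v + t *s w)) has_field_derivative hderiv l (v + 0 *s w) w) (at 0)"
    by (rule hform_has_field_derivative[OF assms, of "\<lambda>t. v + t *s w" w 0]) (auto intro!: derivative_eq_intros)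
  moreover have "((\<lambda>t. l (v + t *s w)) has_field_derivative l w) (at 0)"
    unfolding hform_1_linear[OF assms] by (auto intro!: derivative_eq_intros)
  ultimately show ?thesis using DERIV_unique by fastforce
qed

lemma smooth_line:
  assumes "hform 1 l" "l w \<noteq> 0" shows "smooth_form l"
proof -
  obtain c where c: "l = (\<lambda>v. \<Sum>i\<in>UNIV. c i * v $ i)" using assms(1) unfolding hform_1_iff by blast
  have "\<exists>k. c k \<noteq> 0" using assms(2) unfolding c by (metis (no_types, lifting) mult_zero_left sum.neutral)
  then obtain k where "c k \<noteq> 0" by blast
  moreover have "l (axis k 1) = c k" by (simp add: c axis_def if_distrib cong: if_cong)
  ultimately show ?thesis unfolding smooth_form_def using hderiv_linear[OF assms(1)] by metis
qed

lemma line_basis: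
  assumes "hform 1 l" "l w \<noteq> 0"
  obtains a b where "l a = 0" "l b = 0" "\<And>s. a + s *s b \<noteq> 0" "b \<noteq> 0"
    "\<And>v. l v = 0 \<Longrightarrow> \<exists>s t. v = s *s a + t *s b" "\<And>s t. s *s a + t *s b = 0 \<Longrightarrow> s = 0 \<and> t = 0"
proof -
  obtain A B :: "complex^3^3" where AB: "A ** B = mat 1" "B ** A = mat 1" "\<And>v. (B *v v) $ 3 = l v"
    using covector_frame[OF assms] by metis
  note BA = frame_inverse[OF AB(1,2)]
  define a b where "a = A *v axis 1 1" and "b = A *v axis 2 1"
  have ab: "s *s a + t *s b = A *v (s *s axis 1 1 + t *s axis 2 1)" for s t
    by (simp add: a_def b_def matrix_vector_right_distrib vector_scalar_commute)
  have indep: "s = 0 \<and> t = 0" if "s *s a + t *s b = 0" for s t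
  proof -
    have "s *s axis 1 1 + t *s axis 2 1 = (0 :: complex^3)" using that unfolding ab frame_eq_0_iff[OF AB(1,2)] .
    then show ?thesis by (simp add: vec_eq_iff forall_3 axis_def)
  qed
  show ?thesis
  proof (rule that)
    show "l a = 0" "l b = 0" unfolding AB(3)[symmetric] a_def b_def BA by (simp_all add: axis_def)
    show "a + s *s b \<noteq> 0" for s using indep[of 1 s] by auto
    show "b \<noteq> 0" using indep[of 0 1] by auto
    show "\<exists>s t. v = s *s a + t *s b" if "l v = 0" for v
    proof -
      have "B *v v = (B *v v) $ 1 *s axis 1 1 + (B *v v) $ 2 *s axis 2 1"
        using that unfolding AB(3)[symmetric] by (simp add: vec_eq_iff forall_3 axis_def)
      then have "v = (B *v v) $ 1 *s a + (B *v v) $ 2 *s b" unfolding ab using BA(1) by metis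
      then show ?thesis by blast
    qed
    show "s = 0 \<and> t = 0" if "s *s a + t *s b = 0" for s t by (rule indep[OF that])
  qed
qed

text \<open>On the line \<open>F\<close> restricts to a nonzero polynomial in one variable, which has finitely many roots.\<close>

lemma zeros_on_line:
  assumes l: "hform 1 l" "l w \<noteq> 0" and F: "hform d F" and v: "l v = 0" "F v \<noteq> 0"
  shows "finite (zeros l \<inter> zeros F)"
proof -
  obtain a b where ab: "\<And>s. a + s *s b \<noteq> 0" "b \<noteq> 0" "\<And>v. l v = 0 \<Longrightarrow> \<exists>s t. v = s *s a + t *s b"
    using line_basis[OF l] by metis
  obtain p where p: "\<And>s. poly p s = F (a + s *s b)" "coeff p d = F b" using hform_poly[OF F] by metis
  have "p \<noteq> 0"
  proof
    assume "p = 0"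
    obtain s t where st: "v = s *s a + t *s b" using ab(3)[OF v(1)] by blast
    show False
    proof (cases "s = 0")
      case True
      then have "v = t *s b" using st by simp
      then have "F v = t ^ d * F b" using hform_scale[OF F] by simp
      then show False using v(2) p(2) \<open>p = 0\<close> by simp
    next
      case False
      then have "v = s *s (a + (t / s) *s b)" using st by (simp add: vec_eq_iff field_simps)
      then have "F v = s ^ d * F (a + (t / s) *s b)" by (simp only: hform_scale[OF F])
      then show False using v(2) p(1)[of "t / s"] \<open>p = 0\<close> by simp
    qed
  qed
  have "zeros l \<inter> zeros F \<subseteq> insert (proj b) ((\<lambda>s. proj (a + s *s b)) ` {s. poly p s = 0})"
  proof
    fix q assume q: "q \<in> zeros l \<inter> zeros F"
    then have "l (rep q) = 0" "F (rep q) = 0"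
      using proj_in_zeros[OF l(1) rep(1)[of q]] proj_in_zeros[OF F rep(1)[of q]] rep(2)[of q] by auto
    then obtain s t where st: "rep q = s *s a + t *s b" using ab(3) by blast
    show "q \<in> insert (proj b) ((\<lambda>s. proj (a + s *s b)) ` {s. poly p s = 0})"
    proof (cases "s = 0")
      case True
      then have "rep q = t *s b" "t \<noteq> 0" using st rep(1)[of q] by auto
      then have "q = proj b" using proj_scale[OF ab(2)] rep(2)[of q] by metis
      then show ?thesis by simp
    next
      case False
      then have rq: "rep q = s *s (a + (t / s) *s b)" using st by (simp add: vec_eq_iff field_simps)
      then have "q = proj (a + (t / s) *s b)" using proj_scale[OF ab(1) False] rep(2)[of q] by metis
      moreover have "poly p (t / s) = 0"
      proof -
        have "F (s *s (a + (t / s) *s b)) = 0" using \<open>F (rep q) = 0\<close> unfolding rq .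
        then have "s ^ d * F (a + (t / s) *s b) = 0" by (simp only: hform_scale[OF F])
        then show ?thesis unfolding p using False by simp
      qed
      ultimately show ?thesis by blast
    qed
  qed
  then show ?thesis by (rule finite_subset) (simp add: poly_roots_finite \<open>p \<noteq> 0\<close>)
qed

text \<open>Without its point at infinity \<open>b\<close>, the line is an affine line, which stays connected when finitely
  many points are removed; the point at infinity lies in the closure of what is left.\<close>

lemma line_minus_finite_connected:
  assumes l: "hform 1 l" "l w \<noteq> 0" and F: "finite F"
  shows "connected (zeros l - F)"
proof -
  obtain a b where ab: "l a = 0" "l b = 0" "\<And>s. a + s *s b \<noteq> 0" "b \<noteq> 0" "\<And>v. l v = 0 \<Longrightarrow> \<exists>s t. v = s *s a + t *s b"
    "\<And>s t. s *s a + t *s b = 0 \<Longrightarrow> s = 0 \<and> t = 0"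
    using line_basis[OF l] by metis
  define \<gamma> where "\<gamma> s = proj (a + s *s b)" for s
  have inj: "inj \<gamma>"
  proof (rule injI)
    fix s t assume "\<gamma> s = \<gamma> t"
    then obtain c where c: "a + t *s b = c *s (a + s *s b)" unfolding \<gamma>_def using proj_eqE ab(3) by metis
    then have "(1 - c) *s a + (t - c * s) *s b = 0" by (simp add: vec_eq_iff algebra_simps)
    from ab(6)[OF this] show "s = t" by auto
  qed
  have "finite (\<gamma> -` F)" using finite_vimageI[OF F inj] .
  then have "connected (UNIV - \<gamma> -` F)" by (intro connected_open_delete_finite) auto
  moreover have "continuous_on (UNIV - \<gamma> -` F) \<gamma>"
    unfolding \<gamma>_def by (intro continuous_on_proj_comp continuous_intros continuous_on_vec_smult ab(3))
  ultimately have conn: "connected (\<gamma> ` (UNIV - \<gamma> -` F))" by (rule connected_continuous_image[rotated])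
  have eq: "zeros l - insert (proj b) F \<subseteq> \<gamma> ` (UNIV - \<gamma> -` F)"
  proof
    fix q assume q: "q \<in> zeros l - insert (proj b) F"
    then have "l (rep q) = 0" using proj_in_zeros[OF l(1) rep(1)[of q]] rep(2)[of q] by auto
    then obtain s t where st: "rep q = s *s a + t *s b" using ab(5) by blast
    have "s \<noteq> 0"
    proof
      assume "s = 0"
      then have "rep q = t *s b" "t \<noteq> 0" using st rep(1)[of q] by auto
      then have "q = proj b" using proj_scale[OF ab(4)] rep(2)[of q] by metis
      then show False using q by simp
    qed
    then have rq: "rep q = s *s (a + (t / s) *s b)" using st by (simp add: vec_eq_iff field_simps)
    then have "q = \<gamma> (t / s)" unfolding \<gamma>_def using proj_scale[OF ab(3) \<open>s \<noteq> 0\<close>] rep(2)[of q] by metis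
    then show "q \<in> \<gamma> ` (UNIV - \<gamma> -` F)" using q by auto
  qed
  have sub: "\<gamma> ` (UNIV - \<gamma> -` F) \<subseteq> zeros l - F"
    using proj_in_zeros[OF l(1) ab(3)] ab(1,2) by (auto simp: \<gamma>_def hform_1_linear[OF l(1)])
  have "zeros l - F \<subseteq> closure (\<gamma> ` (UNIV - \<gamma> -` F))"
  proof
    fix q assume "q \<in> zeros l - F"
    then have "q islimpt zeros l" using smooth_point_irreducible(2)[OF l(1) smooth_line[OF l]] by blast
    then have "q islimpt (zeros l - insert (proj b) F)" using F by (intro islimpt_diff_finite) auto
    then have "q islimpt (\<gamma> ` (UNIV - \<gamma> -` F))" using eq by (rule islimpt_subset)
    then show "q \<in> closure (\<gamma> ` (UNIV - \<gamma> -` F))" by (simp add: closure_def)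
  qed
  with conn sub show ?thesis by (rule connected_intermediate_closure)
qed

section \<open>Configurations of a curve and lines\<close>

text \<open>The topological properties of a smooth curve with finitely many lines on which the recognition of
  the components rests.\<close>

definition configuration :: "cp2 set \<Rightarrow> cp2 set set \<Rightarrow> bool" where
  "configuration Q \<M> \<longleftrightarrow> finite \<M> \<and> Q \<notin> \<M> \<and>
     (\<forall>K\<in>insert Q \<M>. closed K \<and> (\<forall>p\<in>K. locally_irreducible_at K p \<and> p islimpt K)) \<and>
     (\<forall>K\<in>insert Q \<M>. \<forall>K'\<in>insert Q \<M>. K \<noteq> K' \<longrightarrow> finite (K \<inter> K')) \<and>
     (\<forall>M\<in>\<M>. M \<noteq> {} \<and> (\<forall>F. finite F \<longrightarrow> connected (M - F))) \<and>
     (\<forall>M\<in>\<M>. \<forall>M'\<in>\<M>. M \<inter> M' \<noteq> {})"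

definition multiple_points :: "cp2 set set \<Rightarrow> cp2 set" where
  "multiple_points \<K> = {p. \<exists>K\<in>\<K>. \<exists>K'\<in>\<K>. K \<noteq> K' \<and> p \<in> K \<inter> K'}"

text \<open>Near a point of exactly one component the union coincides with this component. At a point of two
  components, the union without the point is locally the disjoint union of two nonempty closed sets.\<close>

lemma locally_irreducible_union_iff:
  fixes \<K> :: "cp2 set set"
  assumes fin: "finite \<K>"
    and K: "\<And>K p. K \<in> \<K> \<Longrightarrow> p \<in> K \<Longrightarrow> locally_irreducible_at K p \<and> p islimpt K" "\<And>K. K \<in> \<K> \<Longrightarrow> closed K"
    and inter: "\<And>K K'. K \<in> \<K> \<Longrightarrow> K' \<in> \<K> \<Longrightarrow> K \<noteq> K' \<Longrightarrow> finite (K \<inter> K')"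
    and p: "p \<in> \<Union>\<K>"
  shows "locally_irreducible_at (\<Union>\<K>) p \<longleftrightarrow> p \<notin> multiple_points \<K>"
proof -
  obtain K where KK: "K \<in> \<K>" "p \<in> K" using p by blast
  define R where "R = \<Union>(\<K> - {K})"
  have cR: "closed R" unfolding R_def using fin K(2) by (intro closed_Union) auto
  have un: "\<Union>\<K> = K \<union> R" using KK(1) unfolding R_def by blast
  show ?thesis
  proof (cases "p \<in> R")
    case False
    have "p \<notin> multiple_points \<K>"
    proof
      assume "p \<in> multiple_points \<K>"
      then obtain K1 K2 where "K1 \<in> \<K>" "K2 \<in> \<K>" "K1 \<noteq> K2" "p \<in> K1" "p \<in> K2" unfolding multiple_points_def by blast
      then show False using False unfolding R_def by blast
    qed
    moreover have "locally_irreducible_at (\<Union>\<K>) p" unfolding locally_irreducible_at_def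
    proof (intro allI impI)
      fix U assume U: "open U" "p \<in> U"
      then have "open (U - R)" "p \<in> U - R" using cR False by (auto intro: open_Diff)
      then obtain N where N: "open N" "p \<in> N" "N \<subseteq> U - R" "connected (N \<inter> K - {p})"
        using K(1)[OF KK] unfolding locally_irreducible_at_def by meson
      moreover have "N \<inter> \<Union>\<K> = N \<inter> K" unfolding un using N(3) by blast
      ultimately show "\<exists>N. open N \<and> p \<in> N \<and> N \<subseteq> U \<and> connected (N \<inter> \<Union>\<K> - {p})" by (metis Diff_subset order.trans)
    qed
    ultimately show ?thesis by blast
  next
    case True
    then obtain K' where K': "K' \<in> \<K>" "K' \<noteq> K" "p \<in> K'" unfolding R_def by blast
    then have "p \<in> multiple_points \<K>" unfolding multiple_points_def using KK by blast
    moreover have "\<not> locally_irreducible_at (\<Union>\<K>) p"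
    proof
      assume g: "locally_irreducible_at (\<Union>\<K>) p"
      have finKR: "finite (K \<inter> R)" unfolding R_def
        by (rule finite_Int_Union) (use fin inter[OF KK(1)] in auto)
      then have "open (- (K \<inter> R - {p}))" by (intro open_Compl finite_imp_closed) auto
      with g obtain N where N: "open N" "p \<in> N" "N \<subseteq> - (K \<inter> R - {p})" "connected (N \<inter> \<Union>\<K> - {p})"
        by (elim locally_irreducibleD) auto
      have "K \<inter> R \<inter> (N \<inter> \<Union>\<K> - {p}) = {}" using N(3) by blast
      moreover have "N \<inter> \<Union>\<K> - {p} \<subseteq> K \<union> R" using un by blast
      ultimately have "K \<inter> (N \<inter> \<Union>\<K> - {p}) = {} \<or> R \<inter> (N \<inter> \<Union>\<K> - {p}) = {}"
        using connected_closedD[OF N(4), of K R] K(2)[OF KK(1)] cR by blast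
      moreover have "K \<inter> (N \<inter> \<Union>\<K> - {p}) \<noteq> {}"
        using K(1)[OF KK] N(1,2) KK(1) unfolding islimpt_def by blast
      moreover have "R \<inter> (N \<inter> \<Union>\<K> - {p}) \<noteq> {}"
      proof -
        obtain y where "y \<in> K'" "y \<in> N" "y \<noteq> p" using K(1)[OF K'(1,3)] N(1,2) unfolding islimpt_def by blast
        then show ?thesis using K' unfolding R_def by blast
      qed
      ultimately show False by blast
    qed
    ultimately show ?thesis by blast
  qed
qed

lemma configurationD:
  assumes "configuration Q \<M>"
  shows "finite \<M>" "Q \<notin> \<M>" "\<And>K. K \<in> insert Q \<M> \<Longrightarrow> closed K"
    "\<And>K p. K \<in> insert Q \<M> \<Longrightarrow> p \<in> K \<Longrightarrow> locally_irreducible_at K p \<and> p islimpt K"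
    "\<And>K K'. K \<in> insert Q \<M> \<Longrightarrow> K' \<in> insert Q \<M> \<Longrightarrow> K \<noteq> K' \<Longrightarrow> finite (K \<inter> K')"
    "\<And>M. M \<in> \<M> \<Longrightarrow> M \<noteq> {}" "\<And>M F. M \<in> \<M> \<Longrightarrow> finite F \<Longrightarrow> connected (M - F)"
    "\<And>M M'. M \<in> \<M> \<Longrightarrow> M' \<in> \<M> \<Longrightarrow> M \<inter> M' \<noteq> {}"
proof -
  note * = assms[unfolded configuration_def]
  from * show "finite \<M>" by (elim conjE)
  from * show "Q \<notin> \<M>" by (elim conjE)
  from * have 1: "\<forall>K\<in>insert Q \<M>. closed K \<and> (\<forall>p\<in>K. locally_irreducible_at K p \<and> p islimpt K)" by (elim conjE)
  show "\<And>K. K \<in> insert Q \<M> \<Longrightarrow> closed K" using 1 by blast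
  show "\<And>K p. K \<in> insert Q \<M> \<Longrightarrow> p \<in> K \<Longrightarrow> locally_irreducible_at K p \<and> p islimpt K" using 1 by blast
  from * have 2: "\<forall>K\<in>insert Q \<M>. \<forall>K'\<in>insert Q \<M>. K \<noteq> K' \<longrightarrow> finite (K \<inter> K')" by (elim conjE)
  show "\<And>K K'. K \<in> insert Q \<M> \<Longrightarrow> K' \<in> insert Q \<M> \<Longrightarrow> K \<noteq> K' \<Longrightarrow> finite (K \<inter> K')" using 2 by blast
  from * have 3: "\<forall>M\<in>\<M>. M \<noteq> {} \<and> (\<forall>F. finite F \<longrightarrow> connected (M - F))" by (elim conjE)
  show "\<And>M. M \<in> \<M> \<Longrightarrow> M \<noteq> {}" "\<And>M F. M \<in> \<M> \<Longrightarrow> finite F \<Longrightarrow> connected (M - F)" using 3 by blast+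
  from * have 4: "\<forall>M\<in>\<M>. \<forall>M'\<in>\<M>. M \<inter> M' \<noteq> {}" by (elim conjE)
  show "\<And>M M'. M \<in> \<M> \<Longrightarrow> M' \<in> \<M> \<Longrightarrow> M \<inter> M' \<noteq> {}" using 4 by blast
qed

lemma configuration_multiple_points:
  assumes c: "configuration Q \<M>"
  shows "finite (multiple_points (insert Q \<M>))"
    "p \<in> Q \<union> \<Union>\<M> \<Longrightarrow> locally_irreducible_at (Q \<union> \<Union>\<M>) p \<longleftrightarrow> p \<notin> multiple_points (insert Q \<M>)"
proof -
  note C = configurationD[OF c]
  have "multiple_points (insert Q \<M>) \<subseteq>
      (\<Union>K\<in>insert Q \<M>. \<Union>K'\<in>insert Q \<M> - {K}. K \<inter> K')"
    unfolding multiple_points_def by blast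
  moreover have "finite (\<Union>K\<in>insert Q \<M>. \<Union>K'\<in>insert Q \<M> - {K}. K \<inter> K')"
    using C(1,5) by (intro finite_UN_I) auto
  ultimately show "finite (multiple_points (insert Q \<M>))" by (rule finite_subset)
  show "p \<in> Q \<union> \<Union>\<M> \<Longrightarrow> locally_irreducible_at (Q \<union> \<Union>\<M>) p \<longleftrightarrow> p \<notin> multiple_points (insert Q \<M>)"
    using locally_irreducible_union_iff[of "insert Q \<M>" p] C(1,3,4,5) by simp
qed

lemma homeo_multiple_points:
  assumes c: "configuration Q \<M>\<^sub>1" "configuration Q \<M>\<^sub>2" and h: "homeomorphism UNIV UNIV h g"
    and im: "h ` (Q \<union> \<Union>\<M>\<^sub>1) = Q \<union> \<Union>\<M>\<^sub>2" and p: "p \<in> Q \<union> \<Union>\<M>\<^sub>1"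
  shows "h p \<in> multiple_points (insert Q \<M>\<^sub>2) \<longleftrightarrow> p \<in> multiple_points (insert Q \<M>\<^sub>1)"
proof -
  have h': "homeomorphism UNIV UNIV g h" using h by (rule homeomorphism_symD)
  have gh: "g (h p) = p" for p using h by (auto simp: homeomorphism_def)
  have im': "g ` (Q \<union> \<Union>\<M>\<^sub>2) = Q \<union> \<Union>\<M>\<^sub>1" unfolding im[symmetric] image_image gh by simp
  have hp: "h p \<in> Q \<union> \<Union>\<M>\<^sub>2" using imageI[OF p, of h] unfolding im .
  have "locally_irreducible_at (Q \<union> \<Union>\<M>\<^sub>2) (h p) \<longleftrightarrow> locally_irreducible_at (Q \<union> \<Union>\<M>\<^sub>1) p"
    using locally_irreducible_homeo[OF h, of "Q \<union> \<Union>\<M>\<^sub>1" p] locally_irreducible_homeo[OF h', of "Q \<union> \<Union>\<M>\<^sub>2" "h p"]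
    unfolding im im' gh by blast
  then show ?thesis
    using configuration_multiple_points(2)[OF c(1) p] configuration_multiple_points(2)[OF c(2) hp] by blast
qed

text \<open>The line without its multiple points is connected and avoids the multiple points of the image, so
  it is mapped into a single component; that component is closed and contains the limit points.\<close>

lemma line_image_dichotomy:
  assumes c: "configuration Q \<M>\<^sub>1" "configuration Q \<M>\<^sub>2" and h: "homeomorphism UNIV UNIV h g"
    and im: "h ` (Q \<union> \<Union>\<M>\<^sub>1) = Q \<union> \<Union>\<M>\<^sub>2"
    and L: "L \<in> \<M>\<^sub>1" and p: "p \<in> L - multiple_points (insert Q \<M>\<^sub>1)" and K: "K \<in> insert Q \<M>\<^sub>2" "h p \<in> K"
  shows "h ` L \<subseteq> K"
proof -
  note C1 = configurationD[OF c(1)] and C2 = configurationD[OF c(2)]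
  let ?S1 = "multiple_points (insert Q \<M>\<^sub>1)" and ?S2 = "multiple_points (insert Q \<M>\<^sub>2)"
  have conth: "continuous_on S h" for S
    using h continuous_on_subset unfolding homeomorphism_def by blast
  define R where "R = \<Union>(insert Q \<M>\<^sub>2 - {K})"
  have "closed R" unfolding R_def using C2(1,3) by (intro closed_Union) auto
  have "connected (h ` (L - ?S1))"
    by (intro connected_continuous_image conth C1(7) L configuration_multiple_points c)
  moreover have sub: "h ` (L - ?S1) \<subseteq> Q \<union> \<Union>\<M>\<^sub>2 - ?S2"
  proof
    fix q assume "q \<in> h ` (L - ?S1)"
    then obtain x where x: "q = h x" "x \<in> L" "x \<notin> ?S1" by blast
    then have "x \<in> Q \<union> \<Union>\<M>\<^sub>1" using L by blast
    have "h x \<in> Q \<union> \<Union>\<M>\<^sub>2" using imageI[OF \<open>x \<in> Q \<union> \<Union>\<M>\<^sub>1\<close>, of h] unfolding im .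
    moreover have "h x \<notin> ?S2" using homeo_multiple_points[OF c h im \<open>x \<in> Q \<union> \<Union>\<M>\<^sub>1\<close>] x(3) by simp
    ultimately show "q \<in> Q \<union> \<Union>\<M>\<^sub>2 - ?S2" using x(1) by blast
  qed
  moreover have "K \<inter> R \<inter> h ` (L - ?S1) = {}"
  proof -
    have "K \<inter> R \<subseteq> ?S2" unfolding R_def multiple_points_def using K(1) by blast
    then show ?thesis using sub by blast
  qed
  moreover have "h ` (L - ?S1) \<subseteq> K \<union> R" using sub K(1) unfolding R_def by blast
  ultimately have "K \<inter> h ` (L - ?S1) = {} \<or> R \<inter> h ` (L - ?S1) = {}"
    using connected_closedD[of "h ` (L - ?S1)" K R] C2(3)[OF K(1)] \<open>closed R\<close> by blast
  moreover have "h p \<in> K \<inter> h ` (L - ?S1)" using p K(2) by blast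
  ultimately have sub2: "h ` (L - ?S1) \<subseteq> K" using \<open>h ` (L - ?S1) \<subseteq> K \<union> R\<close> by blast
  have "L \<subseteq> closure (L - ?S1)"
  proof
    fix x assume "x \<in> L"
    then have "x islimpt (L - ?S1)"
      using C1(4)[of L x] L configuration_multiple_points(1)[OF c(1)] by (intro islimpt_diff_finite) auto
    then show "x \<in> closure (L - ?S1)" by (simp add: closure_def)
  qed
  moreover have "h ` closure (L - ?S1) \<subseteq> K"
    by (rule image_closure_subset[OF conth C2(3)[OF K(1)] sub2])
  ultimately show ?thesis by blast
qed

text \<open>The preimage \<open>J\<close> of \<open>Q\<close> is locally irreducible and contained in the union of \<open>Q\<close> and the lines. Suppose
  that it contains a line \<open>L\<close>. Local irreducibility makes \<open>L\<close> open in \<open>J\<close>, and as all lines meet, \<open>J\<close>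
  contains no other line. The rest \<open>J'\<close> of \<open>J\<close> is then an open and closed part of \<open>Q\<close> that is disjoint
  from \<open>L\<close>, hence empty by \<open>meets\<close>; but then \<open>L\<close> is mapped onto \<open>Q\<close>, which \<open>noline\<close> excludes.\<close>

lemma preimage_of_curve_subset:
  assumes c: "configuration Q \<M>\<^sub>1" "configuration Q \<M>\<^sub>2" and h: "homeomorphism UNIV UNIV h g"
    and im: "h ` (Q \<union> \<Union>\<M>\<^sub>1) = Q \<union> \<Union>\<M>\<^sub>2"
    and noline: "\<And>L. L \<in> \<M>\<^sub>1 \<Longrightarrow> h ` L \<noteq> Q"
    and meets: "\<And>L K U. L \<in> \<M>\<^sub>1 \<Longrightarrow> closed K \<Longrightarrow> open U \<Longrightarrow> K = Q \<inter> U \<Longrightarrow> K \<inter> L = {} \<Longrightarrow> K = {}"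
  shows "h -` Q \<subseteq> Q"
proof -
  note C1 = configurationD[OF c(1)] and C2 = configurationD[OF c(2)]
  let ?S1 = "multiple_points (insert Q \<M>\<^sub>1)" and ?S2 = "multiple_points (insert Q \<M>\<^sub>2)"
  have hg: "h (g q) = q" "g (h q') = q'" for q q' using h by (auto simp: homeomorphism_def)
  have h': "homeomorphism UNIV UNIV g h" using h by (rule homeomorphism_symD)
  have conth: "continuous_on S h" for S
    using h continuous_on_subset unfolding homeomorphism_def by blast
  define J where "J = h -` Q"
  have Jg: "J = g ` Q" unfolding J_def using hg by (auto simp: image_iff) metis
  have J1: "J \<subseteq> Q \<union> \<Union>\<M>\<^sub>1" unfolding J_def using im hg by (metis UnCI imageE subsetI vimageE)
  have cJ: "closed J" unfolding J_def using C2(3)[of Q] conth by (intro closed_vimage) auto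
  have Jirr: "locally_irreducible_at J p \<and> p islimpt J" if "p \<in> J" for p
  proof -
    have "h p \<in> Q" using that by (simp add: J_def)
    then show ?thesis using C2(4)[of Q "h p"] locally_irreducible_homeo[OF h', of Q "h p"] islimpt_homeo[OF h', of "h p" Q]
      unfolding Jg hg by blast
  qed
  have step: "L \<subseteq> J" if "L \<in> \<M>\<^sub>1" "J \<inter> (L - ?S1) \<noteq> {}" for L
    using line_image_dichotomy[OF c h im that(1), of _ Q] that(2) unfolding J_def by blast
  have no_line: "J \<inter> (L - ?S1) = {}" if L: "L \<in> \<M>\<^sub>1" for L
  proof (rule ccontr)
    assume "J \<inter> (L - ?S1) \<noteq> {}"
    then have LJ: "L \<subseteq> J" using step L by blast
    define R where "R = \<Union>(insert Q \<M>\<^sub>1 - {L})"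
    have cR: "closed R" unfolding R_def using C1(1,3) by (intro closed_Union) auto
    have finLR: "finite (L \<inter> R)" unfolding R_def
      by (rule finite_Int_Union) (use C1(1) C1(5)[of L] L in auto)
    have JLR: "J - L \<subseteq> R" using J1 unfolding R_def by blast
    \<comment> \<open>\<open>L\<close> is open in \<open>J\<close>: at a common limit point, \<open>L\<close> and the other components would separate the punctured germ of \<open>J\<close>\<close>
    have disj: "L \<inter> closure (J - L) = {}"
    proof (rule ccontr)
      assume "L \<inter> closure (J - L) \<noteq> {}"
      then obtain p where p: "p \<in> L" "p \<in> closure (J - L)" by blast
      then have lim: "p islimpt (J - L)" by (auto simp: closure_def)
      have "p \<in> R" using p(2) closure_minimal[OF JLR cR] by blast
      have "open (- (L \<inter> R - {p}))" using finLR by (intro open_Compl finite_imp_closed) auto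
      moreover have "locally_irreducible_at J p" using Jirr LJ p(1) by blast
      ultimately obtain N where N: "open N" "p \<in> N" "N \<subseteq> - (L \<inter> R - {p})" "connected (N \<inter> J - {p})"
        by (elim locally_irreducibleD[of J p]) auto
      have "L \<inter> R \<inter> (N \<inter> J - {p}) = {}" "N \<inter> J - {p} \<subseteq> L \<union> R" using N(3) JLR by blast+
      then have "L \<inter> (N \<inter> J - {p}) = {} \<or> R \<inter> (N \<inter> J - {p}) = {}"
        using connected_closedD[OF N(4), of L R] C1(3)[of L] L cR by blast
      moreover have "L \<inter> (N \<inter> J - {p}) \<noteq> {}"
        using C1(4)[of L p] L p(1) N(1,2) LJ unfolding islimpt_def by blast
      moreover have "R \<inter> (N \<inter> J - {p}) \<noteq> {}"
        using lim N(1,2) JLR unfolding islimpt_def by blast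
      ultimately show False by blast
    qed
    define J' where "J' = J - L"
    have clJ': "closure J' \<subseteq> J" unfolding J'_def using cJ by (intro closure_minimal) auto
    then have "closure J' = J'" using disj closure_subset[of J'] unfolding J'_def by blast
    then have cJ': "closed J'" by (metis closed_closure)
    have oJ': "J' = J \<inter> - L" unfolding J'_def by blast
    have oL: "open (- L)" using C1(3)[of L] L by auto
    have noother: "J \<inter> (M - ?S1) = {}" if M: "M \<in> \<M>\<^sub>1" "M \<noteq> L" for M
    proof (rule ccontr)
      assume "J \<inter> (M - ?S1) \<noteq> {}"
      then have "M \<subseteq> J" using step M(1) by blast
      obtain q where q: "q \<in> L" "q \<in> M" using C1(8)[OF L M(1)] by blast
      have "q islimpt (M - (M \<inter> L))"
        using C1(4)[of M q] C1(5)[of M L] M q L by (intro islimpt_diff_finite) auto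
      then have "q islimpt (J - L)" by (rule islimpt_subset) (use \<open>M \<subseteq> J\<close> in auto)
      then show False using disj q by (auto simp: closure_def)
    qed
    have J'QS: "J' \<subseteq> Q \<union> ?S1" using noother J1 unfolding J'_def by blast
    have limJ': "p islimpt J'" if "p \<in> J'" for p
      unfolding islimpt_def
    proof (intro allI impI)
      fix T assume T: "p \<in> T" "open T"
      have "p islimpt J" using Jirr that unfolding J'_def by blast
      moreover have "open (T \<inter> - L)" "p \<in> T \<inter> - L" using T oL that unfolding J'_def by auto
      ultimately obtain y where "y \<in> J" "y \<in> T \<inter> - L" "y \<noteq> p" by (elim islimptE[of p J "T \<inter> - L"])
      then show "\<exists>y\<in>J'. y \<in> T \<and> y \<noteq> p" unfolding J'_def by blast
    qed
    have J'Q: "J' \<subseteq> Q"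
    proof
      fix p assume "p \<in> J'"
      then have "p islimpt (J' - ?S1)" by (intro islimpt_diff_finite limJ' configuration_multiple_points[OF c(1)])
      then have "p islimpt Q" by (rule islimpt_subset) (use J'QS in blast)
      then show "p \<in> Q" using C1(3)[of Q] by (simp add: closed_limpt)
    qed
    \<comment> \<open>\<open>J'\<close> is open in \<open>Q\<close> at simple points, since the image of such a point has a neighbourhood that meets only \<open>Q\<close>\<close>
    have reg: "\<exists>U. open U \<and> p \<in> U \<and> Q \<inter> U \<subseteq> J'" if p: "p \<in> J'" "p \<notin> ?S1" for p
    proof -
      have pC: "p \<in> Q \<union> \<Union>\<M>\<^sub>1" "h p \<in> Q" using p J'Q unfolding J'_def J_def by auto
      then have "h p \<notin> ?S2" using homeo_multiple_points[OF c h im] p(2) by blast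
      have "h p \<notin> \<Union>\<M>\<^sub>2"
      proof
        assume "h p \<in> \<Union>\<M>\<^sub>2"
        then obtain M where "M \<in> \<M>\<^sub>2" "h p \<in> M" by blast
        then have "h p \<in> ?S2" unfolding multiple_points_def using pC(2) C2(2)
          by (intro CollectI bexI[of _ M] bexI[of _ Q]) auto
        with \<open>h p \<notin> ?S2\<close> show False by blast
      qed
      moreover have "closed (\<Union>\<M>\<^sub>2)" using C2(1,3) by (intro closed_Union) auto
      then have "open (h -` (- \<Union>\<M>\<^sub>2))" by (intro open_vimage conth) auto
      then have "open (h -` (- \<Union>\<M>\<^sub>2) \<inter> - L)" using oL by auto
      moreover have "Q \<inter> (h -` (- \<Union>\<M>\<^sub>2) \<inter> - L) \<subseteq> J'"
      proof
        fix x assume x: "x \<in> Q \<inter> (h -` (- \<Union>\<M>\<^sub>2) \<inter> - L)"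
        then have "h x \<in> h ` (Q \<union> \<Union>\<M>\<^sub>1)" by blast
        then show "x \<in> J'" using x unfolding im J'_def J_def by blast
      qed
      moreover have "p \<notin> L" using p unfolding J'_def by blast
      ultimately show ?thesis by blast
    qed
    \<comment> \<open>at the finitely many other points the punctured germ of \<open>Q\<close> is connected, so it lies in \<open>J'\<close> as soon as it meets \<open>J'\<close>\<close>
    have reg': "\<exists>U. open U \<and> p \<in> U \<and> Q \<inter> U \<subseteq> J'" if p: "p \<in> J'" for p
    proof -
      have "open (- (?S1 - {p}))" using configuration_multiple_points(1)[OF c(1)] by (intro open_Compl finite_imp_closed) auto
      moreover have "locally_irreducible_at Q p" using C1(4)[of Q p] p J'Q by blast
      ultimately obtain N where N: "open N" "p \<in> N" "N \<subseteq> - (?S1 - {p})" "connected (N \<inter> Q - {p})"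
        by (elim locally_irreducibleD[of Q p]) auto
      define U where "U = \<Union>{U. open U \<and> Q \<inter> U \<subseteq> J'}"
      have U: "open U" "Q \<inter> U \<subseteq> J'" unfolding U_def by auto
      have "J' - ?S1 \<subseteq> U" unfolding U_def using reg by blast
      then have sub: "J' \<inter> (N \<inter> Q - {p}) \<subseteq> U" using N(3) by blast
      have "U \<inter> - J' \<inter> (N \<inter> Q - {p}) = {}" using U(2) by blast
      moreover have "N \<inter> Q - {p} \<subseteq> U \<union> - J'" using sub by blast
      ultimately have "U \<inter> (N \<inter> Q - {p}) = {} \<or> - J' \<inter> (N \<inter> Q - {p}) = {}"
        using connectedD[OF N(4), of U "- J'"] U(1) cJ' by auto
      moreover have "U \<inter> (N \<inter> Q - {p}) \<noteq> {}"
      proof -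
        obtain y where "y \<in> J'" "y \<in> N" "y \<noteq> p" using limJ'[OF p] N(1,2) unfolding islimpt_def by blast
        then show ?thesis using sub J'Q by blast
      qed
      ultimately have "Q \<inter> N \<subseteq> J'" using p by blast
      then show ?thesis using N by blast
    qed
    define U where "U = \<Union>{U. open U \<and> Q \<inter> U \<subseteq> J'}"
    have "open U" unfolding U_def by auto
    moreover have "J' = Q \<inter> U"
    proof (intro equalityI subsetI)
      fix p assume "p \<in> J'"
      then show "p \<in> Q \<inter> U" using reg'[of p] J'Q unfolding U_def by auto
    qed (auto simp: U_def)
    moreover have "J' \<inter> L = {}" unfolding J'_def by blast
    ultimately have "J' = {}" using meets[OF L cJ'] by blast
    then have "J = L" using LJ unfolding J'_def by blast
    moreover have "h ` J = Q" unfolding Jg by (simp add: image_image hg)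
    ultimately have "h ` L = Q" by simp
    then show False using noline L by blast
  qed
  have "J \<subseteq> Q"
  proof
    fix p assume "p \<in> J"
    then have "p islimpt (J - ?S1)" using Jirr configuration_multiple_points[OF c(1)] by (intro islimpt_diff_finite) auto
    then have "p islimpt Q" by (rule islimpt_subset) (use no_line J1 in blast)
    then show "p \<in> Q" using C1(3)[of Q] by (simp add: closed_limpt)
  qed
  then show ?thesis unfolding J_def .
qed

text \<open>A line has a simple point, whose image is on a line as \<open>Q\<close> is preserved; so each line is mapped into a
  line, and so it is under the inverse. Two distinct lines are not contained in each other.\<close>

lemma homeo_maps_lines_to_lines:
  assumes c: "configuration Q \<M>\<^sub>1" "configuration Q \<M>\<^sub>2" and h: "homeomorphism UNIV UNIV h g"
    and im: "h ` (Q \<union> \<Union>\<M>\<^sub>1) = Q \<union> \<Union>\<M>\<^sub>2" and Q: "h ` Q = Q"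
    and L: "L \<in> \<M>\<^sub>1"
  shows "h ` L \<in> \<M>\<^sub>2"
proof -
  have hg: "h (g q) = q" "g (h q') = q'" for q q' using h by (auto simp: homeomorphism_def)
  have h': "homeomorphism UNIV UNIV g h" using h by (rule homeomorphism_symD)
  have im': "g ` (Q \<union> \<Union>\<M>\<^sub>2) = Q \<union> \<Union>\<M>\<^sub>1" unfolding im[symmetric] image_image hg by simp
  have Q': "g ` Q = Q" by (subst Q[symmetric]) (simp add: image_image hg)
  have into: "\<exists>M\<in>\<N>. k ` L \<subseteq> M"
    if k: "configuration Q \<M>" "configuration Q \<N>" "homeomorphism UNIV UNIV k k'" "k ` (Q \<union> \<Union>\<M>) = Q \<union> \<Union>\<N>" "k ` Q = Q"
      and L: "L \<in> \<M>" for k k' \<M> \<N> L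
  proof -
    note C = configurationD[OF k(1)]
    obtain q where "q \<in> L" using C(6)[OF L] by blast
    then have "q islimpt (L - multiple_points (insert Q \<M>))"
      using C(4)[of L q] L configuration_multiple_points(1)[OF k(1)] by (intro islimpt_diff_finite) auto
    then obtain p where p: "p \<in> L - multiple_points (insert Q \<M>)" unfolding islimpt_def by blast
    have "p \<notin> Q"
    proof
      assume "p \<in> Q"
      then have "p \<in> multiple_points (insert Q \<M>)" unfolding multiple_points_def
        using p L C(2) by (intro CollectI bexI[of _ L] bexI[of _ Q]) auto
      with p show False by blast
    qed
    then have "k p \<notin> Q" using k(3,5) unfolding homeomorphism_def by (metis UNIV_I imageE)
    moreover have "k p \<in> Q \<union> \<Union>\<N>" unfolding k(4)[symmetric] using p L by blast
    ultimately obtain M where "M \<in> \<N>" "k p \<in> M" by blast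
    then show ?thesis using line_image_dichotomy[OF k(1-4) L p, of M] by blast
  qed
  obtain M where M: "M \<in> \<M>\<^sub>2" "h ` L \<subseteq> M" using into[OF c h im Q L] by blast
  obtain L' where L': "L' \<in> \<M>\<^sub>1" "g ` M \<subseteq> L'" using into[OF c(2,1) h' im' Q' M(1)] by blast
  have LL': "L \<subseteq> L'" using M(2) L'(2) hg by (metis image_subset_iff subsetI subsetD)
  have "L = L'"
  proof (rule ccontr)
    assume "L \<noteq> L'"
    then have "finite (L \<inter> L')" using configurationD(5)[OF c(1), of L L'] L L' by blast
    then have "finite L" using LL' by (simp add: Int_absorb2)
    obtain q where "q \<in> L" using configurationD(6)[OF c(1) L] by blast
    then have "q islimpt (L - L)" using configurationD(4)[OF c(1), of L q] L \<open>finite L\<close> by (intro islimpt_diff_finite) auto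
    then show False by simp
  qed
  have "M \<subseteq> h ` L"
  proof
    fix x assume "x \<in> M"
    then have "g x \<in> L" using L'(2) \<open>L = L'\<close> by blast
    then show "x \<in> h ` L" using hg(1)[of x] by (intro image_eqI[of _ _ "g x"]) auto
  qed
  then have "h ` L = M" using M(2) by (rule subset_antisym[rotated])
  then show ?thesis using M(1) by simp
qed

text \<open>On a part \<open>K\<close> of a smooth curve that is open and closed in it and misses the line \<open>l\<close>, the quotient
  \<open>m / l\<close> is a continuous function on a compact space and holomorphic in the charts. The set on which
  it takes a value of maximal modulus is again open and closed in the curve.\<close>

lemma maximum_principle_step:
  assumes f: "hform d f" "smooth_form f" and l: "hform 1 l" and m: "hform 1 m"
    and K: "closed K" "open U" "K = zeros f \<inter> U" "K \<inter> zeros l = {}" "K \<noteq> {}"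
  obtains c K' U' where "K' \<subseteq> K" "closed K'" "open U'" "K' = zeros f \<inter> U'" "K' \<noteq> {}"
    "\<And>v. v \<noteq> 0 \<Longrightarrow> proj v \<in> K' \<Longrightarrow> m v = c * l v"
proof -
  define q where "q p = m (rep p) / l (rep p)" for p
  have q: "q (proj v) = m v / l v" if v: "v \<noteq> 0" for v
  proof -
    obtain c where "c \<noteq> 0" "rep (proj v) = c *s v" using proj_eqE[of v "rep (proj v)"] rep v by metis
    then show ?thesis unfolding q_def by (simp add: hform_1_linear(3)[OF l] hform_1_linear(3)[OF m])
  qed
  have lK: "l v \<noteq> 0" if "v \<noteq> 0" "proj v \<in> K" for v
    using that K(4) proj_in_zeros[OF l that(1)] by blast
  have contq: "continuous_on K q"
  proof (rule continuous_on_cp2)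
    have "continuous_on {v. v \<noteq> 0 \<and> proj v \<in> K} (\<lambda>v. m v / l v)"
      by (intro continuous_on_divide hform_continuous[OF l] hform_continuous[OF m]) (use lK in auto)
    then show "continuous_on {v. v \<noteq> 0 \<and> proj v \<in> K} (\<lambda>v. q (proj v))"
      by (rule continuous_on_eq) (use q in auto)
  qed
  have "compact K" using compact_Int_closed[OF compact_cp2 K(1)] by simp
  then obtain p0 where p0: "p0 \<in> K" "\<And>p. p \<in> K \<Longrightarrow> norm (q p) \<le> norm (q p0)"
    using continuous_attains_sup[of K "\<lambda>p. norm (q p)"] K(5) contq continuous_on_norm by blast
  define c where "c = q p0"
  define K' where "K' = {p \<in> K. q p = c}"
  have "closed K'" unfolding K'_def using continuous_closed_preimage_constant[OF contq K(1)] .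
  have loc: "\<exists>N. open N \<and> p \<in> N \<and> zeros f \<inter> N \<subseteq> K'" if p: "p \<in> K'" for p
  proof -
    have "p \<in> zeros f" "p \<in> U" using p K(3) unfolding K'_def by auto
    show ?thesis
    proof (rule smooth_point_disc[OF f \<open>p \<in> zeros f\<close> K(2) \<open>p \<in> U\<close>])
      fix N e \<gamma>
      assume N: "open N" "p \<in> N" "N \<subseteq> U" "e > 0" "\<gamma> 0 = rep p"
        "\<And>i. (\<lambda>x. \<gamma> x $ i) holomorphic_on ball 0 e" "\<And>x. x \<in> ball 0 e \<Longrightarrow> \<gamma> x \<noteq> 0"
        "inj_on (\<lambda>x. proj (\<gamma> x)) (ball 0 e)" "N \<inter> zeros f = (\<lambda>x. proj (\<gamma> x)) ` ball 0 e"
      have inK: "proj (\<gamma> x) \<in> K" if "x \<in> ball 0 e" for x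
      proof -
        have "proj (\<gamma> x) \<in> N \<inter> zeros f" unfolding N(9) using that by blast
        then show ?thesis using N(3) K(3) by blast
      qed
      have qp: "q p = c" using p unfolding K'_def by blast
      have "(\<lambda>x. m (\<gamma> x) / l (\<gamma> x)) constant_on ball 0 e"
      proof (rule maximum_modulus_principle[of _ _ "ball 0 e" 0])
        show "(\<lambda>x. m (\<gamma> x) / l (\<gamma> x)) holomorphic_on ball 0 e"
          by (intro holomorphic_on_divide hform_holomorphic[OF N(6) l] hform_holomorphic[OF N(6) m] lK N(7) inK)
        show "norm (m (\<gamma> x) / l (\<gamma> x)) \<le> norm (m (\<gamma> 0) / l (\<gamma> 0))" if "x \<in> ball 0 e" for x
          using p0(2)[OF inK[OF that]] qp q[OF N(7)[OF that]] unfolding N(5) c_def q_def[of p] by simp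
      qed (use N(4) in auto)
      then obtain c' where c': "\<And>x. x \<in> ball 0 e \<Longrightarrow> m (\<gamma> x) / l (\<gamma> x) = c'" unfolding constant_on_def by blast
      have "c' = c" using c'[of 0] N(4) qp unfolding N(5) q_def[of p] by simp
      then have "N \<inter> zeros f \<subseteq> K'" unfolding N(9) K'_def using inK c' q N(7) by auto
      then show ?thesis using N(1,2) by blast
    qed
  qed
  define U' where "U' = \<Union>{N. open N \<and> zeros f \<inter> N \<subseteq> K'}"
  show ?thesis
  proof (rule that[of K' U' c])
    show "K' \<subseteq> K" unfolding K'_def by blast
    show "open U'" unfolding U'_def by auto
    show "K' = zeros f \<inter> U'"
    proof (intro equalityI subsetI)
      fix p assume "p \<in> K'"
      then show "p \<in> zeros f \<inter> U'" using loc[of p] K(3) \<open>K' \<subseteq> K\<close> unfolding U'_def by auto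
    qed (auto simp: U'_def)
    show "K' \<noteq> {}" using p0(1) unfolding K'_def c_def by blast
    show "m v = c * l v" if "v \<noteq> 0" "proj v \<in> K'" for v
      using that q[OF that(1)] lK[OF that(1)] unfolding K'_def by (auto simp: field_simps)
  qed fact
qed

text \<open>If \<open>K\<close> missed the line \<open>l\<close>, then all coordinates divided by \<open>l\<close> would be constant on some nonempty open
  and closed part of \<open>K\<close>, which would be a single point; but no point of a smooth curve is isolated.\<close>

lemma curve_part_meets_line:
  assumes f: "hform d f" "smooth_form f" and l: "hform 1 l"
    and K: "closed K" "open U" "K = zeros f \<inter> U" "K \<inter> zeros l = {}"
  shows "K = {}"
proof (rule ccontr)
  assume ne: "K \<noteq> {}"
  obtain c1 K1 U1 where K1: "K1 \<subseteq> K" "closed K1" "open U1" "K1 = zeros f \<inter> U1" "K1 \<noteq> {}"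
    "\<And>v. v \<noteq> 0 \<Longrightarrow> proj v \<in> K1 \<Longrightarrow> v $ 1 = c1 * l v"
    by (rule maximum_principle_step[OF f l hform_coord[of 1] K ne]) (rule that)
  have d1: "K1 \<inter> zeros l = {}" using K(4) K1(1) by blast
  obtain c2 K2 U2 where K2: "K2 \<subseteq> K1" "closed K2" "open U2" "K2 = zeros f \<inter> U2" "K2 \<noteq> {}"
    "\<And>v. v \<noteq> 0 \<Longrightarrow> proj v \<in> K2 \<Longrightarrow> v $ 2 = c2 * l v"
    by (rule maximum_principle_step[OF f l hform_coord[of 2] K1(2-4) d1 K1(5)]) (rule that)
  have d2: "K2 \<inter> zeros l = {}" using d1 K2(1) by blast
  obtain c3 K3 U3 where K3: "K3 \<subseteq> K2" "closed K3" "open U3" "K3 = zeros f \<inter> U3" "K3 \<noteq> {}"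
    "\<And>v. v \<noteq> 0 \<Longrightarrow> proj v \<in> K3 \<Longrightarrow> v $ 3 = c3 * l v"
    by (rule maximum_principle_step[OF f l hform_coord[of 3] K2(2-4) d2 K2(5)]) (rule that)
  have "rep p = l (rep p) *s vector [c1, c2, c3]" if "p \<in> K3" for p
  proof -
    have p: "proj (rep p) \<in> K1" "proj (rep p) \<in> K2" "proj (rep p) \<in> K3"
      using that K3(1) K2(1) unfolding rep(2) by auto
    show ?thesis unfolding vec_eq_iff forall_3 vector_smult_component
      using K1(6)[OF rep(1) p(1)] K2(6)[OF rep(1) p(2)] K3(6)[OF rep(1) p(3)] by simp
  qed
  then have one: "p = proj (vector [c1, c2, c3])" if "p \<in> K3" for p
    using rep[of p] proj_scale that by (metis vec_smult_eq_0_iff)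
  obtain p where p: "p \<in> K3" using K3(5) by blast
  then have "p islimpt zeros f" using smooth_point_irreducible(2)[OF f] K3(4) by blast
  then obtain y where "y \<in> zeros f" "y \<in> U3" "y \<noteq> p" using p K3(3,4) unfolding islimpt_def by blast
  then show False using one[of y] one[OF p] K3(4) by blast
qed

lemma lines_meet:
  assumes "hform 1 l" "l w \<noteq> 0" "hform 1 l'"
  shows "zeros l \<inter> zeros l' \<noteq> {}"
proof -
  obtain a b where ab: "l a = 0" "l b = 0" "\<And>s. a + s *s b \<noteq> 0" "b \<noteq> 0" using line_basis[OF assms(1,2)] by metis
  have "l' b = 0 \<or> (\<exists>s. l' (a + s *s b) = 0)"
    using hform_zero_on_line[OF _ ab(3,4), of 0 l'] assms(3) by simp
  then obtain v where "v \<noteq> 0" "l' v = 0" "l v = 0"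
    using ab hform_1_linear[OF assms(1)] by (metis add_0 mult_zero_right)
  then have "proj v \<in> zeros l \<inter> zeros l'" unfolding zeros_def by blast
  then show ?thesis by blast
qed

text \<open>A linear form that vanishes on the kernel of another one is a multiple of it.\<close>

lemma distinct_lines:
  assumes l: "hform 1 l" "l w \<noteq> 0" and l': "hform 1 l'" "l' w' \<noteq> 0" and ne: "zeros l \<noteq> zeros l'"
  obtains u where "l u = 0" "l' u \<noteq> 0"
proof (rule ccontr)
  assume "\<not> thesis"
  then have 0: "l' v = 0" if "l v = 0" for v using that \<open>\<And>u. l u = 0 \<Longrightarrow> l' u \<noteq> 0 \<Longrightarrow> thesis\<close> by blast
  have "hform (Suc 0) l'" using l'(1) by simp
  from hform_dvd_linear[OF l this 0] obtain G where G: "hform 0 G" "\<And>v. l' v = l v * G v" by blast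
  then obtain c where "G = (\<lambda>_. c)" by (auto simp: hform.simps)
  then have "l' v = c * l v" for v using G(2) by simp
  moreover from this have "c \<noteq> 0" using l'(2) by auto
  ultimately have "zeros l = zeros l'" unfolding zeros_def by simp
  then show False using ne by blast
qed

lemma lines_finite_inter:
  assumes l: "hform 1 l" "l w \<noteq> 0" and l': "hform 1 l'" "l' w' \<noteq> 0" and ne: "zeros l \<noteq> zeros l'"
  shows "finite (zeros l \<inter> zeros l')"
proof -
  obtain u where "l u = 0" "l' u \<noteq> 0" by (rule distinct_lines[OF l l' ne])
  then show ?thesis by (rule zeros_on_line[OF l l'(1)])
qed

definition contains_no_line :: "(complex^3 \<Rightarrow> complex) \<Rightarrow> bool" where
  "contains_no_line f \<longleftrightarrow> (\<forall>l. hform 1 l \<longrightarrow> (\<exists>w. l w \<noteq> 0) \<longrightarrow> (\<exists>v. l v = 0 \<and> f v \<noteq> 0))"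

text \<open>The properties of single components follow from smoothness. The intersections are finite as neither
  the curve nor another line contains a given line.\<close>

lemma configuration_lines:
  assumes f: "hform 4 f" "smooth_form f" "contains_no_line f"
    and \<M>: "finite \<M>" "\<And>M. M \<in> \<M> \<Longrightarrow> \<exists>l. line M l"
  shows "configuration (zeros f) \<M>"
  unfolding configuration_def
proof (intro conjI)
  have nol: "finite (zeros f \<inter> M) \<and> zeros f \<noteq> M" if M: "M \<in> \<M>" for M
  proof -
    obtain l w where l: "hform 1 l" "l w \<noteq> 0" "M = zeros l" using \<M>(2)[OF M] unfolding line_def by blast
    then obtain v where v: "l v = 0" "f v \<noteq> 0" using f(3) unfolding contains_no_line_def by blast
    have "v \<noteq> 0" using v(2) hform_scale[OF f(1), of 0 0] by auto
    then have "proj v \<in> zeros l" "proj v \<notin> zeros f" using v proj_in_zeros[OF f(1)] by (auto simp: zeros_def)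
    moreover have "finite (zeros l \<inter> zeros f)" by (rule zeros_on_line[OF l(1,2) f(1) v])
    ultimately show ?thesis unfolding l(3) by (auto simp: Int_commute)
  qed
  show "finite \<M>" by fact
  show "zeros f \<notin> \<M>" using nol by blast
  have curve: "closed (zeros k) \<and> (\<forall>p\<in>zeros k. locally_irreducible_at (zeros k) p \<and> p islimpt zeros k)"
    if "hform d k" "smooth_form k" for d k
    using closed_zeros[OF that(1)] smooth_point_irreducible[OF that] by blast
  have lines: "closed M \<and> (\<forall>p\<in>M. locally_irreducible_at M p \<and> p islimpt M) \<and> M \<noteq> {} \<and>
      (\<forall>F. finite F \<longrightarrow> connected (M - F))" if M: "M \<in> \<M>" for M
  proof -
    obtain l w where l: "hform 1 l" "l w \<noteq> 0" "M = zeros l" using \<M>(2)[OF M] unfolding line_def by blast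
    show ?thesis
      using curve[OF l(1) smooth_line[OF l(1,2)]] lines_meet[OF l(1,2) l(1)] line_minus_finite_connected[OF l(1,2)]
      unfolding l(3) by blast
  qed
  show "\<forall>K\<in>insert (zeros f) \<M>. closed K \<and> (\<forall>p\<in>K. locally_irreducible_at K p \<and> p islimpt K)"
    using curve[OF f(1,2)] lines by blast
  show "\<forall>M\<in>\<M>. M \<noteq> {} \<and> (\<forall>F. finite F \<longrightarrow> connected (M - F))" using lines by blast
  show "\<forall>M\<in>\<M>. \<forall>M'\<in>\<M>. M \<inter> M' \<noteq> {}"
    using \<M>(2) lines_meet unfolding line_def by metis
  have "finite (M \<inter> M')" if "M \<in> \<M>" "M' \<in> \<M>" "M \<noteq> M'" for M M'
    using \<M>(2)[OF that(1)] \<M>(2)[OF that(2)] that(3) lines_finite_inter unfolding line_def by metis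
  then show "\<forall>K\<in>insert (zeros f) \<M>. \<forall>K'\<in>insert (zeros f) \<M>. K \<noteq> K' \<longrightarrow> finite (K \<inter> K')"
    using nol by (auto simp: Int_commute)
qed

text \<open>The lemma \<open>preimage_of_curve_subset\<close> applies to \<open>h\<close> and to its inverse: its hypothesis \<open>noline\<close> is
  \<open>zeros_quartic_not_line\<close>, and \<open>meets\<close> is \<open>curve_part_meets_line\<close>.\<close>

theorem homeo_preserves_components:
  assumes f: "hform 4 f" "smooth_form f" "contains_no_line f"
    and \<M>1: "finite \<M>\<^sub>1" "\<And>M. M \<in> \<M>\<^sub>1 \<Longrightarrow> \<exists>l. line M l"
    and \<M>2: "finite \<M>\<^sub>2" "\<And>M. M \<in> \<M>\<^sub>2 \<Longrightarrow> \<exists>l. line M l"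
    and h: "homeomorphism UNIV UNIV h g"
    and im: "h ` (zeros f \<union> \<Union>\<M>\<^sub>1) = zeros f \<union> \<Union>\<M>\<^sub>2"
  shows "h ` zeros f = zeros f" "\<And>L. L \<in> \<M>\<^sub>1 \<Longrightarrow> h ` L \<in> \<M>\<^sub>2"
proof -
  have hg: "h (g q) = q" "g (h q') = q'" for q q' using h by (auto simp: homeomorphism_def)
  have h': "homeomorphism UNIV UNIV g h" using h by (rule homeomorphism_symD)
  have im': "g ` (zeros f \<union> \<Union>\<M>\<^sub>2) = zeros f \<union> \<Union>\<M>\<^sub>1" unfolding im[symmetric] image_image hg by simp
  have c: "configuration (zeros f) \<M>\<^sub>1" "configuration (zeros f) \<M>\<^sub>2"
    using configuration_lines[OF f] \<M>1 \<M>2 by blast+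
  have noline: "k ` L \<noteq> zeros f"
    if k: "homeomorphism UNIV UNIV k k'" and L: "\<exists>l. line L l" for k k' L
  proof
    assume eq: "k ` L = zeros f"
    obtain l w where l: "hform 1 l" "l w \<noteq> 0" "L = zeros l" using L unfolding line_def by blast
    have k': "homeomorphism UNIV UNIV k' k" using k by (rule homeomorphism_symD)
    have "k' ` zeros f = zeros l" unfolding eq[symmetric] l(3) image_image using k by (simp add: homeomorphism_def)
    moreover obtain p where "p \<in> zeros l" using lines_meet[OF l(1,2) l(1)] by blast
    then have "k p \<in> zeros f" using eq l(3) by blast
    ultimately show False using zeros_quartic_not_line[OF f(1,2) _ k' l(1,2)] by blast
  qed
  have meets: "K = {}" if "\<exists>l. line L l" "closed K" "open U" "K = zeros f \<inter> U" "K \<inter> L = {}" for L K U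
    using that curve_part_meets_line[OF f(1,2)] unfolding line_def by metis
  have "h -` zeros f \<subseteq> zeros f"
  proof (rule preimage_of_curve_subset[OF c h im])
    show "h ` L \<noteq> zeros f" if "L \<in> \<M>\<^sub>1" for L by (rule noline[OF h \<M>1(2)[OF that]])
    show "K = {}" if "L \<in> \<M>\<^sub>1" "closed K" "open U" "K = zeros f \<inter> U" "K \<inter> L = {}" for L K U
      by (rule meets[OF \<M>1(2)[OF that(1)] that(2-5)])
  qed
  moreover have "g -` zeros f \<subseteq> zeros f"
  proof (rule preimage_of_curve_subset[OF c(2,1) h' im'])
    show "g ` L \<noteq> zeros f" if "L \<in> \<M>\<^sub>2" for L by (rule noline[OF h' \<M>2(2)[OF that]])
    show "K = {}" if "L \<in> \<M>\<^sub>2" "closed K" "open U" "K = zeros f \<inter> U" "K \<inter> L = {}" for L K U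
      by (rule meets[OF \<M>2(2)[OF that(1)] that(2-5)])
  qed
  ultimately show eq: "h ` zeros f = zeros f"
    using hg by (metis (no_types, lifting) image_subset_iff subsetI subset_antisym vimageI2 subsetD image_eqI)
  show "h ` L \<in> \<M>\<^sub>2" if "L \<in> \<M>\<^sub>1" for L by (rule homeo_maps_lines_to_lines[OF c h im eq that])
qed

section \<open>Contact of a smooth curve with a line\<close>

lemma has_field_derivative_direction:
  assumes "hform d F"
  shows "((\<lambda>t. F (v + t *s u)) has_field_derivative hderiv F v u) (at 0)"
proof -
  have "((\<lambda>t. F (v + t *s u)) has_field_derivative hderiv F (v + 0 *s u) u) (at 0)"
    by (rule hform_has_field_derivative[OF assms, of "\<lambda>t. v + t *s u" u 0]) (auto intro!: derivative_eq_intros)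
  then show ?thesis by simp
qed

text \<open>By the product rule, the gradient of a product vanishes where both factors do.\<close>

lemma smooth_product:
  assumes f: "hform d f" "smooth_form f" and F: "hform d' F" and G: "hform e G" and fFG: "\<And>v. f v = F v * G v"
    and v: "F v = 0" "G v = 0"
  shows "v = 0"
proof (rule ccontr)
  assume "v \<noteq> 0"
  have "hderiv f v (axis k 1) = 0" for k
  proof -
    have "((\<lambda>t. f (v + t *s axis k 1)) has_field_derivative
        hderiv F v (axis k 1) * G (v + 0 *s axis k 1) + hderiv G v (axis k 1) * F (v + 0 *s axis k 1)) (at 0)"
      unfolding fFG by (rule DERIV_mult[OF has_field_derivative_direction[OF F] has_field_derivative_direction[OF G]])
    then show ?thesis using DERIV_unique[OF has_field_derivative_direction[OF f(1)]] v by simp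
  qed
  moreover have "f v = 0" using fFG v by simp
  ultimately show False using f(2) \<open>v \<noteq> 0\<close> unfolding smooth_form_def by blast
qed

text \<open>If the curve contained a line, its equation would split off the linear form, and the line would meet
  the residual curve in a singular point.\<close>

lemma smooth_no_line:
  assumes f: "hform (Suc (Suc d)) f" "smooth_form f"
  shows "contains_no_line f"
  unfolding contains_no_line_def
proof (intro allI impI, rule ccontr)
  fix l assume l1: "hform 1 l" "\<exists>w. l w \<noteq> 0" and "\<not> (\<exists>v. l v = 0 \<and> f v \<noteq> 0)"
  then obtain w where l: "hform 1 l" "l w \<noteq> 0" by blast
  obtain G where G: "hform (Suc d) G" "\<And>v. f v = l v * G v"
    using hform_dvd_linear[OF l f(1)] \<open>\<not> (\<exists>v. l v = 0 \<and> f v \<noteq> 0)\<close> by blast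
  obtain a b where ab: "l a = 0" "l b = 0" "\<And>s. a + s *s b \<noteq> 0" "b \<noteq> 0" using line_basis[OF l] by metis
  obtain v where v: "v \<noteq> 0" "l v = 0" "G v = 0"
    using hform_zero_on_line[OF G(1) ab(3,4)] ab hform_1_linear[OF l(1)] by (metis add_0 mult_zero_right)
  show False using smooth_product[OF f l(1) G(1) G(2) v(2,3)] v(1) by blast
qed

lemma frame_kernel:
  fixes A B :: "complex^3^3"
  assumes AB: "A ** B = mat 1" "B ** A = mat 1" and v: "(B *v v) $ 3 = 0"
  shows "\<exists>x y. v = x *s (A *v axis 1 1) + y *s (A *v axis 2 1)"
proof -
  have "B *v v = (B *v v) $ 1 *s axis 1 1 + (B *v v) $ 2 *s axis 2 1"
    using v by (simp add: vec_eq_iff forall_3 axis_def)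
  then have "A *v (B *v v) = (B *v v) $ 1 *s (A *v axis 1 1) + (B *v v) $ 2 *s (A *v axis 2 1)"
    by (metis matrix_vector_right_distrib vector_scalar_commute)
  then show ?thesis using frame_inverse(1)[OF AB] by metis
qed

text \<open>Coordinates in which \<open>l\<close> is the third one and a given point of the line is the second basis vector.\<close>

lemma line_frame:
  assumes l: "hform 1 l" "l w \<noteq> 0" and b0: "l b0 = 0" "b0 \<noteq> 0"
  obtains A B :: "complex^3^3" where "A ** B = mat 1" "B ** A = mat 1" "\<And>v. (B *v v) $ 3 = l v" "A *v axis 2 1 = b0"
proof -
  obtain a b where ab: "l a = 0" "l b = 0" "\<And>v. l v = 0 \<Longrightarrow> \<exists>s t. v = s *s a + t *s b"
    "\<And>s t. s *s a + t *s b = 0 \<Longrightarrow> s = 0 \<and> t = 0" using line_basis[OF l] by metis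
  obtain s t where st: "b0 = s *s a + t *s b" using ab(3)[OF b0(1)] by blast
  define a' where "a' = (if t = 0 then b else a)"
  have indep: "x = 0 \<and> y = 0" if 0: "x *s a' + y *s b0 = 0" for x y
  proof (cases "t = 0")
    case True
    then have "s \<noteq> 0" using st b0(2) by auto
    have "(y * s) *s a + x *s b = x *s a' + y *s b0" using True st by (simp add: a'_def vec_eq_iff algebra_simps)
    then show ?thesis using ab(4)[of "y * s" x] 0 \<open>s \<noteq> 0\<close> by auto
  next
    case False
    have "(x + y * s) *s a + (y * t) *s b = x *s a' + y *s b0" using False st by (simp add: a'_def vec_eq_iff algebra_simps)
    then show ?thesis using ab(4)[of "x + y * s" "y * t"] 0 False by auto
  qed
  define e where "e = inverse (l w) *s w"
  have e: "l e = 1" using l by (simp add: e_def hform_1_linear(3)[OF l(1)])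
  have la': "l a' = 0" using ab by (simp add: a'_def)
  note lin = hform_1_linear[OF l(1)]
  obtain A B :: "complex^3^3" where AB: "A ** B = mat 1" "B ** A = mat 1"
    "\<And>v. A *v v = (v $ 1) *s a' + (v $ 2) *s b0 + (v $ 3) *s e"
  proof (rule matrix_of_columns[of a' b0 e])
    fix x y z assume 0: "x *s a' + y *s b0 + z *s e = 0"
    have "l (x *s a' + y *s b0 + z *s e) = z" by (simp add: lin(1,3) la' b0(1) e)
    then have "z = 0" unfolding 0 by (simp add: lin(4))
    then show "x = 0 \<and> y = 0 \<and> z = 0" using indep[of x y] 0 by simp
  qed blast
  have "(B *v v) $ 3 = l v" for v
  proof -
    have "l v = l (A *v (B *v v))" using frame_inverse(1)[OF AB(1,2)] by simp
    also have "\<dots> = (B *v v) $ 3" unfolding AB(3) by (simp add: lin(1,3) la' b0(1) e)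
    finally show ?thesis by simp
  qed
  moreover have "A *v axis 2 1 = b0" unfolding AB(3) by (simp add: axis_def)
  ultimately show ?thesis using that AB by blast
qed

text \<open>A local parametrisation of the curve, as in the definition of intersection multiplicities. In the
  locale, the order of a form along the germ is controlled only as far as contact of order 2, which
  is expressed by the derivative in the direction of the tangent.\<close>

locale curve_germ =
  fixes f :: "complex^3 \<Rightarrow> complex" and d :: nat and \<gamma> :: "complex \<Rightarrow> complex^3" and r :: real
  assumes f: "hform d f" "smooth_form f"
    and r: "r > 0" and hol: "\<And>i. (\<lambda>t. \<gamma> t $ i) holomorphic_on ball 0 r"
    and on_curve: "\<And>t. t \<in> ball 0 r \<Longrightarrow> \<gamma> t \<noteq> 0 \<and> f (\<gamma> t) = 0"
    and immersive: "\<And>c. (\<chi> i. deriv (\<lambda>t. \<gamma> t $ i) 0) \<noteq> c *s \<gamma> 0"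
begin

definition tangent :: "complex^3" where "tangent = (\<chi> i. deriv (\<lambda>t. \<gamma> t $ i) 0)"

lemma zero_in: "0 \<in> ball (0::complex) r" using r by simp

lemma germ_holomorphic: "hform e F \<Longrightarrow> (\<lambda>t. F (\<gamma> t)) holomorphic_on ball 0 r"
  by (rule hform_holomorphic[OF hol])

lemma germ_deriv: "hform e F \<Longrightarrow> deriv (\<lambda>t. F (\<gamma> t)) 0 = hderiv F (\<gamma> 0) tangent"
  by (rule DERIV_imp_deriv, rule hform_has_field_derivative)
     (auto simp: tangent_def intro!: holomorphic_derivI[OF hol open_ball zero_in])

lemma tangent_curve: "hderiv f (\<gamma> 0) tangent = 0"
proof -
  have "eventually (\<lambda>t. t \<in> ball 0 r) (nhds (0::complex))" using zero_in by (intro eventually_nhds_in_open) auto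
  then have "eventually (\<lambda>t. f (\<gamma> t) = 0) (nhds 0)" by eventually_elim (use on_curve in auto)
  then have "deriv (\<lambda>t. f (\<gamma> t)) 0 = deriv (\<lambda>t. 0) 0" by (intro deriv_cong_ev) auto
  then show ?thesis using germ_deriv[OF f(1)] by simp
qed

lemma order_nonzero: "hform e F \<Longrightarrow> F (\<gamma> 0) \<noteq> 0 \<Longrightarrow> zorder (\<lambda>t. F (\<gamma> t)) 0 = 0"
  by (rule zorder_eqI[OF open_ball zero_in germ_holomorphic]) auto

lemma order_ge_1: "hform e F \<Longrightarrow> zorder (\<lambda>t. F (\<gamma> t)) 0 \<ge> 1 \<Longrightarrow> F (\<gamma> 0) = 0"
  using order_nonzero by force

lemma order_1:
  assumes F: "hform e F" "F (\<gamma> 0) = 0" "hderiv F (\<gamma> 0) tangent \<noteq> 0"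
  shows "zorder (\<lambda>t. F (\<gamma> t)) 0 = 1"
  by (rule zorder_zero_eqI[OF germ_holomorphic[OF F(1)] open_ball zero_in])
     (use F germ_deriv[OF F(1)] in auto)

lemma order_ge_2:
  assumes F: "hform e F" "zorder (\<lambda>t. F (\<gamma> t)) 0 \<ge> 2"
  shows "F (\<gamma> 0) = 0" "hderiv F (\<gamma> 0) tangent = 0"
proof -
  show 0: "F (\<gamma> 0) = 0" using order_ge_1[OF F(1)] F(2) by simp
  show "hderiv F (\<gamma> 0) tangent = 0"
  proof (rule ccontr)
    assume "hderiv F (\<gamma> 0) tangent \<noteq> 0"
    from order_1[OF F(1) 0 this] F(2) show False by simp
  qed
qed

text \<open>Forms that vanish identically along the germ have to be excluded, since their order is not a
  meaningful number.\<close>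

lemma order_lower:
  assumes F: "hform e F" and nz: "t0 \<in> ball 0 r" "F (\<gamma> t0) \<noteq> 0" and 0: "F (\<gamma> 0) = 0"
  shows "zorder (\<lambda>t. F (\<gamma> t)) 0 \<ge> 1"
    "hderiv F (\<gamma> 0) tangent = 0 \<Longrightarrow> zorder (\<lambda>t. F (\<gamma> t)) 0 \<ge> 2"
proof -
  let ?g = "\<lambda>t. F (\<gamma> t)"
  have ex: "\<exists>w\<in>ball 0 r. ?g w \<noteq> 0" using nz by blast
  from zorder_exist_zero[OF germ_holomorphic[OF F] open_ball connected_ball zero_in ex]
  obtain \<rho> where n: "zorder ?g 0 > 0" and \<rho>: "\<rho> > 0" "zor_poly ?g 0 holomorphic_on cball 0 \<rho>"
    "\<And>w. w \<in> cball 0 \<rho> \<Longrightarrow> ?g w = zor_poly ?g 0 w * w ^ nat (zorder ?g 0) \<and> zor_poly ?g 0 w \<noteq> 0"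
    using 0 by auto
  show "zorder ?g 0 \<ge> 1" using n by simp
  assume d0: "hderiv F (\<gamma> 0) tangent = 0"
  have "zorder ?g 0 \<noteq> 1"
  proof
    assume "zorder ?g 0 = 1"
    then have eq: "?g w = zor_poly ?g 0 w * w" if "w \<in> ball 0 \<rho>" for w using \<rho>(3)[of w] that by auto
    have "zor_poly ?g 0 holomorphic_on ball 0 \<rho>" using \<rho>(2) by (rule holomorphic_on_subset) auto
    then have "(zor_poly ?g 0 has_field_derivative deriv (zor_poly ?g 0) 0) (at 0)"
      by (rule holomorphic_derivI) (use \<rho>(1) in auto)
    from DERIV_mult[OF this DERIV_ident]
    have "((\<lambda>w. zor_poly ?g 0 w * w) has_field_derivative zor_poly ?g 0 0) (at 0)" by simp
    then have "(?g has_field_derivative zor_poly ?g 0 0) (at 0)"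
      by (rule has_field_derivative_transform_within_open[of _ _ _ "ball 0 \<rho>"]) (use \<rho>(1) eq in auto)
    then have "deriv ?g 0 = zor_poly ?g 0 0" by (rule DERIV_imp_deriv)
    then show False using germ_deriv[OF F] d0 \<rho>(1) \<rho>(3)[of 0] by simp
  qed
  then show "zorder ?g 0 \<ge> 2" using n by simp
qed

end

lemma pderiv_at_root:
  fixes P :: "complex poly"
  assumes "P \<noteq> 0" "poly P s = 0"
  shows "poly (pderiv P) s = 0 \<longleftrightarrow> order s P \<ge> 2"
proof -
  obtain Q where Q: "P = [:- s, 1:] ^ order s P * Q" "\<not> [:- s, 1:] dvd Q" using order_decomp[OF assms(1)] by blast
  have m: "order s P \<noteq> 0" using assms order_root by blast
  then obtain k where k: "order s P = Suc k" using not0_implies_Suc by blast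
  have "P = [:- s, 1:] * ([:- s, 1:] ^ k * Q)" using Q(1) unfolding k by (simp only: power_Suc mult.assoc)
  then have "pderiv P = pderiv ([:- s, 1:] * ([:- s, 1:] ^ k * Q))" by simp
  also have "poly \<dots> s = 0 ^ k * poly Q s" unfolding pderiv_mult by (simp add: pderiv_pCons poly_power)
  finally have "poly (pderiv P) s = 0 ^ k * poly Q s" .
  moreover have "poly Q s \<noteq> 0" using Q(2) by (simp add: poly_eq_0_iff_dvd)
  ultimately show ?thesis using k by (cases k) auto
qed

text \<open>A germ of the curve with base point on the line \<open>l\<close>, in coordinates adapted to the line: it is spanned
  by the first two basis vectors \<open>a\<close> and \<open>b\<close>, of which \<open>b\<close> is off the curve. Thus \<open>s \<mapsto> a + s *s b\<close>
  parametrises the part of the line that matters, and the polynomial \<open>P\<close> is the restricted equation.\<close>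

locale germ_and_line = curve_germ +
  fixes l :: "complex^3 \<Rightarrow> complex" and A B :: "complex^3^3" and P :: "complex poly"
  assumes l: "hform 1 l" and l0: "l (\<gamma> 0) = 0" and AB: "A ** B = mat 1" "B ** A = mat 1"
    and Bl: "\<And>v. (B *v v) $ 3 = l v" and fb: "f (A *v axis 2 1) \<noteq> 0"
    and P: "\<And>s. poly P s = f (A *v axis 1 1 + s *s (A *v axis 2 1))"
begin

definition "a = A *v axis 1 1"
definition "b = A *v axis 2 1"
definition "e = A *v axis 3 1"
definition "T v = (B *v v) $ 1"
definition "\<Sigma> v = (B *v v) $ 2"
definition "s0 = \<Sigma> (\<gamma> 0) / T (\<gamma> 0)"

lemma expand: "v = T v *s a + \<Sigma> v *s b + l v *s e"
proof -
  have "B *v v = T v *s axis 1 1 + \<Sigma> v *s axis 2 1 + l v *s axis 3 1"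
    by (simp add: vec_eq_iff forall_3 axis_def T_def \<Sigma>_def Bl)
  then have "A *v (B *v v) = T v *s a + \<Sigma> v *s b + l v *s e"
    by (simp add: a_def b_def e_def matrix_vector_right_distrib vector_scalar_commute)
  then show ?thesis using frame_inverse(1)[OF AB] by simp
qed

lemma coords: "T (x *s a + y *s b + z *s e) = x" "\<Sigma> (x *s a + y *s b + z *s e) = y" "l (x *s a + y *s b + z *s e) = z"
proof -
  have "B *v (x *s a + y *s b + z *s e) = x *s axis 1 1 + y *s axis 2 1 + z *s axis 3 1"
    by (simp add: a_def b_def e_def matrix_vector_right_distrib vector_scalar_commute frame_inverse(2)[OF AB])
  then show "T (x *s a + y *s b + z *s e) = x" "\<Sigma> (x *s a + y *s b + z *s e) = y" "l (x *s a + y *s b + z *s e) = z"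
    unfolding T_def \<Sigma>_def Bl[symmetric] by (simp_all add: axis_def)
qed

lemma hform_matrix_coord: "hform 1 (\<lambda>v. (B *v v) $ i)"
  unfolding hform_1_iff matrix_vector_mult_def by auto

lemma hform_T: "hform 1 T" and hform_\<Sigma>: "hform 1 \<Sigma>"
  unfolding T_def[abs_def] \<Sigma>_def[abs_def] by (rule hform_matrix_coord)+

text \<open>The base point is not the point at infinity \<open>b\<close> of the line, as that point is off the curve.\<close>

lemma T0: "T (\<gamma> 0) \<noteq> 0"
proof
  assume "T (\<gamma> 0) = 0"
  then have eq: "\<gamma> 0 = \<Sigma> (\<gamma> 0) *s b" using expand[of "\<gamma> 0"] l0 by simp
  have "f (\<Sigma> (\<gamma> 0) *s b) = \<Sigma> (\<gamma> 0) ^ d * f b" by (rule hform_scale[OF f(1)])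
  moreover have "f (\<gamma> 0) = 0" "\<gamma> 0 \<noteq> 0" using on_curve[OF zero_in] by auto
  ultimately have "\<Sigma> (\<gamma> 0) ^ d = 0" using fb eq unfolding b_def by simp
  then have "\<Sigma> (\<gamma> 0) = 0" by simp
  then show False using eq \<open>\<gamma> 0 \<noteq> 0\<close> by simp
qed

lemma gamma0: "\<gamma> 0 = T (\<gamma> 0) *s (a + s0 *s b)"
  using expand[of "\<gamma> 0"] l0 T0 by (simp add: s0_def vec_eq_iff algebra_simps)

lemma F_gamma0: "hform n F \<Longrightarrow> F (\<gamma> 0) = T (\<gamma> 0) ^ n * F (a + s0 *s b)"
  by (subst gamma0) (rule hform_scale)

lemma P_ab: "poly P s = f (a + s *s b)" unfolding a_def b_def by (rule P)

lemma P_nonzero: "P \<noteq> 0"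
proof
  assume "P = 0"
  obtain q where q: "coeff q d = f b" "\<And>s. poly q s = f (a + s *s b)" using hform_poly[OF f(1)] by metis
  have "poly q s = 0" for s using q(2) P_ab \<open>P = 0\<close> by (metis poly_0)
  then have "q = 0" using poly_all_0_iff_0 by blast
  then show False using q(1) fb unfolding b_def by simp
qed

lemma P_root: "poly P s0 = 0"
  using F_gamma0[OF f(1)] on_curve[OF zero_in] T0 unfolding P_ab by simp

lemma hderiv_b:
  assumes F: "hform n F" and p: "\<And>s. poly p s = F (a + s *s b)"
  shows "hderiv F (\<gamma> 0) b * T (\<gamma> 0) = T (\<gamma> 0) ^ n * poly (pderiv p) s0"
proof -
  let ?T = "T (\<gamma> 0)"
  have eq: "F (\<gamma> 0 + t *s b) = ?T ^ n * poly p (s0 + t / ?T)" for t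
  proof -
    have "\<gamma> 0 + t *s b = ?T *s (a + (s0 + t / ?T) *s b)"
      by (subst gamma0) (use T0 in \<open>simp add: vec_eq_iff field_simps\<close>)
    then show ?thesis unfolding p by (simp only: hform_scale[OF F])
  qed
  have "((\<lambda>t. s0 + t / ?T) has_field_derivative 1 / ?T) (at 0)"
    using T0 by (auto intro!: derivative_eq_intros)
  then have "((\<lambda>t. poly p (s0 + t / ?T)) has_field_derivative poly (pderiv p) (s0 + 0 / ?T) * (1 / ?T)) (at 0)"
    by (rule DERIV_chain2[OF poly_DERIV])
  from DERIV_cmult[OF this, of "?T ^ n"]
  have "((\<lambda>t. F (\<gamma> 0 + t *s b)) has_field_derivative ?T ^ n * (poly (pderiv p) s0 * (1 / ?T))) (at 0)"
    unfolding eq by simp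
  from DERIV_unique[OF has_field_derivative_direction[OF F] this]
  show ?thesis using T0 by simp
qed

lemma hderiv_expand:
  assumes F: "hform n F" and F0: "F (\<gamma> 0) = 0"
  shows "hderiv F (\<gamma> 0) v = (\<Sigma> v - s0 * T v) * hderiv F (\<gamma> 0) b + l v * hderiv F (\<gamma> 0) e"
proof -
  let ?T = "T (\<gamma> 0)"
  have "v = (T v / ?T) *s \<gamma> 0 + ((\<Sigma> v - s0 * T v) *s b + l v *s e)"
  proof -
    have "(T v / ?T) *s \<gamma> 0 = T v *s a + (s0 * T v) *s b"
      by (subst gamma0) (use T0 in \<open>simp add: vec_eq_iff field_simps\<close>)
    then show ?thesis by (subst (1) expand[of v]) (simp add: vec_eq_iff algebra_simps)
  qed
  then have "hderiv F (\<gamma> 0) v = hderiv F (\<gamma> 0) ((T v / ?T) *s \<gamma> 0 + ((\<Sigma> v - s0 * T v) *s b + l v *s e))" by simp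
  then show ?thesis
    by (simp only: hderiv_add[OF F] hderiv_scale[OF F] hderiv_euler[OF F] F0 mult_zero_right add_0)
qed

text \<open>Otherwise the tangent would be a multiple of the base point, so that the germ would not be immersive
  in the projective plane.\<close>

lemma tangent_transversal: "l tangent \<noteq> 0 \<or> \<Sigma> tangent - s0 * T tangent \<noteq> 0"
proof (rule ccontr)
  assume "\<not> ?thesis"
  then have "tangent = T tangent *s a + (s0 * T tangent) *s b" using expand[of tangent] by simp
  also have "\<dots> = (T tangent / T (\<gamma> 0)) *s \<gamma> 0"
    by (subst gamma0) (use T0 in \<open>simp add: vec_eq_iff field_simps\<close>)
  finally show False using immersive unfolding tangent_def by blast
qed

lemma hderiv_tangent:
  "(\<Sigma> tangent - s0 * T tangent) * hderiv f (\<gamma> 0) b + l tangent * hderiv f (\<gamma> 0) e = 0"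
  using hderiv_expand[OF f(1), of tangent] tangent_curve on_curve[OF zero_in] by simp

text \<open>At a multiple root the derivative of \<open>f\<close> along the line vanishes, so by smoothness the one across the
  line does not; the tangent of the curve is therefore that of the line.\<close>

lemma multiplicity_ge_2:
  assumes "order s0 P \<ge> 2"
  shows "l tangent = 0" "\<Sigma> tangent - s0 * T tangent \<noteq> 0" "hderiv f (\<gamma> 0) e \<noteq> 0"
proof -
  have "poly (pderiv P) s0 = 0" using pderiv_at_root[OF P_nonzero P_root] assms by blast
  then have b0: "hderiv f (\<gamma> 0) b = 0" using hderiv_b[OF f(1) P_ab] T0 by simp
  obtain k where "hderiv f (\<gamma> 0) (axis k 1) \<noteq> 0" using f(2) on_curve[OF zero_in] unfolding smooth_form_def by blast
  then show e: "hderiv f (\<gamma> 0) e \<noteq> 0"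
    using hderiv_expand[OF f(1), of "axis k 1"] on_curve[OF zero_in] b0 by auto
  show "l tangent = 0" using hderiv_tangent b0 e by simp
  then show "\<Sigma> tangent - s0 * T tangent \<noteq> 0" using tangent_transversal by blast
qed

lemma multiplicity_1: 
  assumes "order s0 P = 1" shows "l tangent \<noteq> 0"
proof
  assume 0: "l tangent = 0"
  have "poly (pderiv P) s0 \<noteq> 0" using pderiv_at_root[OF P_nonzero P_root] assms by simp
  then have "hderiv f (\<gamma> 0) b \<noteq> 0" using hderiv_b[OF f(1) P_ab] T0 by auto
  then show False using hderiv_tangent 0 tangent_transversal by simp
qed

text \<open>Since \<open>f\<close> vanishes along the germ, dividing it by \<open>l\<close> expresses \<open>l\<close> as minus the restricted equation
  over a unit \<open>G\<close>. The restricted equation is evaluated at the projection of the germ to the line,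
  which is a local coordinate because the germ is tangent to the line.\<close>

lemma order_along_line_ge_2:
  assumes m: "order s0 P \<ge> 2"
  obtains \<rho> g where "\<rho> > 0" "\<rho> \<le> r" "g holomorphic_on ball 0 \<rho>" "g 0 \<noteq> 0"
    "\<And>t. t \<in> ball 0 \<rho> \<Longrightarrow> l (\<gamma> t) = g t * t ^ order s0 P"
proof -
  obtain Q where Q: "P = [:- s0, 1:] ^ order s0 P * Q" "\<not> [:- s0, 1:] dvd Q" using order_decomp[OF P_nonzero] by blast
  have Qs0: "poly Q s0 \<noteq> 0" using Q(2) by (simp add: poly_eq_0_iff_dvd)
  have d: "d = Suc (d - 1)" using on_curve[OF zero_in] fb f(1) by (cases d) (auto simp: hform.simps)
  obtain G where G: "hform (d - 1) G" "\<And>v. f v = f (v - l v *s e) + l v * G v"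
    using hform_divide[OF l, of "d - 1" f e] f(1) d by auto
  have le: "l e = 1" using coords(3)[of 0 0 1] by simp
  have Ge: "G (\<gamma> 0) = hderiv f (\<gamma> 0) e"
  proof -
    have "f (\<gamma> 0 + t *s e) = t * G (\<gamma> 0 + t *s e)" for t
    proof -
      have "l (\<gamma> 0 + t *s e) = t" by (simp add: hform_1_linear[OF l] l0 le)
      then show ?thesis using G(2)[of "\<gamma> 0 + t *s e"] on_curve[OF zero_in] by simp
    qed
    then have "((\<lambda>t. f (\<gamma> 0 + t *s e)) has_field_derivative 1 * G (\<gamma> 0 + 0 *s e) + hderiv G (\<gamma> 0) e * 0) (at 0)"
      using DERIV_mult[OF DERIV_ident has_field_derivative_direction[OF G(1)], of "\<gamma> 0" e] by simp
    from DERIV_unique[OF has_field_derivative_direction[OF f(1)] this] show ?thesis by simp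
  qed
  define D where "D t = \<Sigma> (\<gamma> t) - s0 * T (\<gamma> t)" for t
  have hD: "D holomorphic_on ball 0 r" unfolding D_def
    by (intro holomorphic_intros germ_holomorphic[OF hform_T] germ_holomorphic[OF hform_\<Sigma>])
  have D0: "D 0 = 0" using T0 by (simp add: D_def s0_def)
  have D': "deriv D 0 \<noteq> 0"
  proof -
    have dl: "((\<lambda>t. k (\<gamma> t)) has_field_derivative k tangent) (at 0)" if k: "hform 1 k" for k
      using holomorphic_derivI[OF germ_holomorphic[OF k] open_ball zero_in] germ_deriv[OF k] hderiv_linear[OF k] by simp
    have "(D has_field_derivative \<Sigma> tangent - s0 * T tangent) (at 0)" unfolding D_def
      by (intro DERIV_diff DERIV_cmult dl hform_T hform_\<Sigma>)
    then show ?thesis using multiplicity_ge_2(2)[OF m] DERIV_imp_deriv by metis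
  qed
  define D1 where "D1 t = (if t = 0 then deriv D 0 else D t / t)" for t
  have hD1: "D1 holomorphic_on ball 0 r"
  proof -
    have "(\<lambda>z. if z = 0 then deriv D 0 else (D z - D 0) / (z - 0)) = D1" by (rule ext) (simp add: D1_def D0)
    then show ?thesis using pole_lemma[OF hD, of 0] r by simp
  qed
  have DD1: "D t = t * D1 t" for t using D0 by (simp add: D1_def)
  have "continuous_on (ball 0 r) (\<lambda>t. T (\<gamma> t) * G (\<gamma> t))"
    by (intro holomorphic_on_imp_continuous_on holomorphic_on_mult germ_holomorphic[OF hform_T] germ_holomorphic[OF G(1)])
  moreover have "T (\<gamma> 0) * G (\<gamma> 0) \<noteq> 0" using T0 Ge multiplicity_ge_2(3)[OF m] by simp
  ultimately obtain \<rho>0 where \<rho>0: "\<rho>0 > 0" "\<And>t. dist 0 t < \<rho>0 \<Longrightarrow> t \<in> ball 0 r \<Longrightarrow> T (\<gamma> t) * G (\<gamma> t) \<noteq> 0"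
    using continuous_on_avoid[of "ball 0 r" "\<lambda>t. T (\<gamma> t) * G (\<gamma> t)" 0 0] zero_in by (metis dist_commute)
  define \<rho> where "\<rho> = min r \<rho>0"
  have sub: "ball 0 \<rho> \<subseteq> ball (0::complex) r" by (auto simp: \<rho>_def)
  have nz: "T (\<gamma> t) \<noteq> 0" "G (\<gamma> t) \<noteq> 0" if "t \<in> ball 0 \<rho>" for t
    using \<rho>0(2)[of t] that by (auto simp: \<rho>_def)
  define g where "g t = - (T (\<gamma> t) ^ d * (D1 t / T (\<gamma> t)) ^ order s0 P * poly Q (\<Sigma> (\<gamma> t) / T (\<gamma> t))) / G (\<gamma> t)" for t
  show ?thesis
  proof (rule that[of \<rho> g])
    show "\<rho> > 0" "\<rho> \<le> r" using r \<rho>0 by (auto simp: \<rho>_def)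
    have h: "(\<lambda>t. F (\<gamma> t)) holomorphic_on ball 0 \<rho>" if "hform n F" for n F
      by (rule holomorphic_on_subset[OF germ_holomorphic[OF that] sub])
    have hQ: "(\<lambda>t. poly Q (u t)) holomorphic_on ball 0 \<rho>" if "u holomorphic_on ball 0 \<rho>" for u
    proof -
      have "poly Q holomorphic_on X" for X
        by (auto simp: holomorphic_on_def field_differentiable_def
            intro!: exI has_field_derivative_at_within[OF poly_DERIV])
      then show ?thesis using holomorphic_on_compose[OF that, of "poly Q"] by (simp add: o_def)
    qed
    show "g holomorphic_on ball 0 \<rho>" unfolding g_def
      by (intro holomorphic_on_divide holomorphic_on_minus holomorphic_on_mult holomorphic_on_power hQ
          h[OF hform_T] h[OF hform_\<Sigma>] h[OF G(1)] holomorphic_on_subset[OF hD1 sub] nz)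
    show "g 0 \<noteq> 0" using D' T0 Qs0 Ge multiplicity_ge_2(3)[OF m] unfolding g_def s0_def[symmetric] by (simp add: D1_def)
    show "l (\<gamma> t) = g t * t ^ order s0 P" if t: "t \<in> ball 0 \<rho>" for t
    proof -
      let ?v = "\<gamma> t"
      have "?v - l ?v *s e = T ?v *s a + \<Sigma> ?v *s b" by (subst (1) expand[of ?v]) simp
      also have "\<dots> = T ?v *s (a + (\<Sigma> ?v / T ?v) *s b)" using nz[OF t] by (simp add: vec_eq_iff field_simps)
      finally have "f (?v - l ?v *s e) = T ?v ^ d * poly P (\<Sigma> ?v / T ?v)"
        unfolding P_ab by (simp only: hform_scale[OF f(1)])
      moreover have "poly P (\<Sigma> ?v / T ?v) = (D t / T ?v) ^ order s0 P * poly Q (\<Sigma> ?v / T ?v)"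
      proof -
        have "poly P s = (s - s0) ^ order s0 P * poly Q s" for s
          by (subst Q(1)) (simp add: poly_power)
        moreover have "\<Sigma> ?v / T ?v - s0 = D t / T ?v" using nz[OF t] by (simp add: D_def field_simps)
        ultimately show ?thesis by simp
      qed
      moreover have "f ?v = 0" using on_curve sub t by blast
      ultimately have "l ?v * G ?v = - (T ?v ^ d * ((D t / T ?v) ^ order s0 P * poly Q (\<Sigma> ?v / T ?v)))"
        using G(2)[of ?v] by (simp add: eq_neg_iff_add_eq_0 add.commute)
      then have "l ?v = - (T ?v ^ d * ((D t / T ?v) ^ order s0 P * poly Q (\<Sigma> ?v / T ?v))) / G ?v"
        using nz(2)[OF t] by (metis nonzero_mult_div_cancel_right)
      then show ?thesis unfolding g_def DD1 by (simp add: power_mult_distrib power_divide)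
    qed
  qed
qed

text \<open>The intersection multiplicity of curve and line, computed on the curve, is the multiplicity of the
  root of the restricted equation, computed on the line. For a simple root the germ is transversal to
  the line; otherwise \<open>order_along_line_ge_2\<close> exhibits the order.\<close>

lemma order_along_line: "zorder (\<lambda>t. l (\<gamma> t)) 0 = int (order s0 P)"
proof (cases "order s0 P \<ge> 2")
  case True
  obtain \<rho> g where g: "\<rho> > 0" "\<rho> \<le> r" "g holomorphic_on ball 0 \<rho>" "g 0 \<noteq> 0"
    "\<And>t. t \<in> ball 0 \<rho> \<Longrightarrow> l (\<gamma> t) = g t * t ^ order s0 P" by (rule order_along_line_ge_2[OF True]) (rule that)
  show ?thesis by (rule zorder_eqI[OF open_ball _ g(3,4)]) (use g in auto)
next
  case False
  then have "order s0 P = 1" using P_root P_nonzero order_root[of P s0] by linarith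
  then show ?thesis using order_1[OF l l0] multiplicity_1 hderiv_linear[OF l] by simp
qed

lemma line_germ_nonzero: "\<exists>t\<in>ball 0 r. l (\<gamma> t) \<noteq> 0"
proof (rule ccontr)
  assume "\<not> ?thesis"
  then have 0: "l (\<gamma> t) = 0" if "t \<in> ball 0 r" for t using that by blast
  have "eventually (\<lambda>t. t \<in> ball 0 r) (nhds (0::complex))" using zero_in by (intro eventually_nhds_in_open) auto
  then have ev: "eventually (\<lambda>t. l (\<gamma> t) = 0) (nhds 0)" by eventually_elim (use 0 in auto)
  then have "deriv (\<lambda>t. l (\<gamma> t)) 0 = deriv (\<lambda>t. 0) 0" by (intro deriv_cong_ev) auto
  then have lt: "l tangent = 0" using germ_deriv[OF l] hderiv_linear[OF l] by simp
  show False
  proof (cases "order s0 P \<ge> 2")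
    case True
    obtain \<rho> g where g: "\<rho> > 0" "\<rho> \<le> r" "g holomorphic_on ball 0 \<rho>" "g 0 \<noteq> 0"
      "\<And>t. t \<in> ball 0 \<rho> \<Longrightarrow> l (\<gamma> t) = g t * t ^ order s0 P" by (rule order_along_line_ge_2[OF True]) (rule that)
    have "\<forall>\<^sub>F t in at 0. g t \<noteq> 0"
      using continuous_on_interior[OF holomorphic_on_imp_continuous_on[OF g(3)], of 0] g(1,4)
      by (intro tendsto_imp_eventually_ne[of g "g 0"]) (auto simp: isCont_def)
    moreover have "\<forall>\<^sub>F t in at 0. t \<in> ball 0 \<rho> \<and> t \<noteq> 0"
      using g(1) by (intro eventually_conj eventually_at_in_open' eventually_neq_at_within) auto
    ultimately have "\<forall>\<^sub>F t in at (0::complex). False"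
      by eventually_elim (use g 0 in auto)
    then show False by simp
  next
    case False
    then have "order s0 P = 1" using P_root P_nonzero order_root[of P s0] by linarith
    then show False using multiplicity_1 lt by blast
  qed
qed

end

section \<open>Conics that square to a quartic on lines\<close>

text \<open>Forms on the plane spanned by \<open>a\<close> and \<open>b\<close> are determined by their values on an affine line in it.\<close>

lemma plane_ext:
  assumes F: "hform n F" "hform n G" and eq: "\<And>s. F (a + s *s b) = G (a + s *s b)"
  shows "F (x *s a + y *s b) = G (x *s a + y *s b)"
proof (cases "x = 0")
  case True
  obtain p where p: "coeff p n = F b" "\<And>s. poly p s = F (a + s *s b)" using hform_poly[OF F(1)] by metis
  obtain q where q: "coeff q n = G b" "\<And>s. poly q s = G (a + s *s b)" using hform_poly[OF F(2)] by metis
  have "poly p = poly q" using p(2) q(2) eq by auto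
  then have "F b = G b" using p(1) q(1) by (simp add: poly_eq_poly_eq_iff)
  then show ?thesis using True hform_scale[OF F(1)] hform_scale[OF F(2)] by simp
next
  case False
  then have "x *s a + y *s b = x *s (a + (y / x) *s b)" by (simp add: vec_eq_iff field_simps)
  then show ?thesis by (simp only: hform_scale[OF F(1)] hform_scale[OF F(2)] eq)
qed

text \<open>Restricted to lines in the kernel of \<open>l2\<close>, this is cancellation of a nonzero polynomial.\<close>

lemma cancel_on_plane:
  assumes G: "hform n G" and l1: "hform 1 l1" and l2: "hform 1 l2" and u: "l2 u = 0" "l1 u \<noteq> 0"
    and 0: "\<And>v. l2 v = 0 \<Longrightarrow> l1 v * G v = 0" and v: "l2 v = 0"
  shows "G v = 0"
proof -
  obtain p where p: "\<And>s. poly p s = G (v + s *s u)" using hform_poly[OF G] by metis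
  have "poly ([:l1 v, l1 u:] * p) s = 0" for s
  proof -
    have "l2 (v + s *s u) = 0" by (simp add: hform_1_linear[OF l2] u v)
    moreover have "poly ([:l1 v, l1 u:] * p) s = l1 (v + s *s u) * G (v + s *s u)"
      by (simp add: p hform_1_linear[OF l1] algebra_simps)
    ultimately show ?thesis using 0 by simp
  qed
  then have "[:l1 v, l1 u:] * p = 0" using poly_all_0_iff_0 by blast
  then have "[:l1 v, l1 u:] = 0 \<or> p = 0" by (simp only: mult_eq_0_iff)
  then have "p = 0" using u(2) by auto
  then show ?thesis using p[of 0] by simp
qed

lemma divide_by_two_lines:
  assumes F: "hform (Suc (Suc n)) F" and l1: "hform 1 l1" and l2: "hform 1 l2" and u: "l2 u = 0" "l1 u \<noteq> 0" "l2 u' \<noteq> 0"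
    and 0: "\<And>v. l1 v = 0 \<Longrightarrow> F v = 0" "\<And>v. l2 v = 0 \<Longrightarrow> F v = 0"
  obtains N where "hform n N" "\<And>v. F v = l1 v * (l2 v * N v)"
proof -
  obtain G where G: "hform (Suc n) G" "\<And>v. F v = l1 v * G v" using hform_dvd_linear[OF l1 u(2) F 0(1)] by blast
  have "G v = 0" if "l2 v = 0" for v
    by (rule cancel_on_plane[OF G(1) l1 l2 u(1,2) _ that]) (use 0(2) G(2) in auto)
  then obtain N where "hform n N" "\<And>v. G v = l2 v * N v" using hform_dvd_linear[OF l2 u(3) G(1)] by blast
  with G(2) that show ?thesis by simp
qed

text \<open>The square roots \<open>g1\<close>, \<open>g2\<close> and \<open>g3\<close> of \<open>f\<close> on three lines glue to one conic if they agree in the points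
  of intersection. A conic through the first two roots exists by linear algebra and is unique up to
  multiples of \<open>l1 * l2\<close>. On the third line it agrees with \<open>g3\<close> in the points of intersection with
  the other two, so that the difference is such a multiple. This remains true if the three lines are
  concurrent: the two points then coincide, and what is needed is a double zero of the difference,
  which comes from the factorisation of the difference of the squares.\<close>

lemma conic_on_three_lines:
  assumes f: "hform 4 f"
    and l: "hform 1 l1" "hform 1 l2" "hform 1 l3"
    and ind: "l2 u12 = 0" "l1 u12 \<noteq> 0" "l1 u21 = 0" "l2 u21 \<noteq> 0" "l3 u13 = 0" "l1 u13 \<noteq> 0" "l3 u23 = 0" "l2 u23 \<noteq> 0" "l3 w3 \<noteq> 0"
    and fnz: "\<And>v. v \<noteq> 0 \<Longrightarrow> l1 v = 0 \<Longrightarrow> l3 v = 0 \<Longrightarrow> f v \<noteq> 0" "\<And>v. v \<noteq> 0 \<Longrightarrow> l2 v = 0 \<Longrightarrow> l3 v = 0 \<Longrightarrow> f v \<noteq> 0"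
    and g: "hform 2 g1" "hform 2 g2" "hform 2 g3"
    and sq: "\<And>v. l1 v = 0 \<Longrightarrow> g1 v * g1 v = f v" "\<And>v. l2 v = 0 \<Longrightarrow> g2 v * g2 v = f v" "\<And>v. l3 v = 0 \<Longrightarrow> g3 v * g3 v = f v"
    and agree: "\<And>v. l1 v = 0 \<Longrightarrow> l2 v = 0 \<Longrightarrow> g1 v = g2 v" "\<And>v. l1 v = 0 \<Longrightarrow> l3 v = 0 \<Longrightarrow> g1 v = g3 v"
      "\<And>v. l2 v = 0 \<Longrightarrow> l3 v = 0 \<Longrightarrow> g2 v = g3 v"
  obtains C where "hform 2 C" "\<And>v. l1 v = 0 \<or> l2 v = 0 \<or> l3 v = 0 \<Longrightarrow> C v * C v = f v"
proof -
  \<comment> \<open>a conic \<open>C0\<close> that restricts to \<open>g1\<close> and \<open>g2\<close> on the first two lines: \<open>g1 - g2\<close> is written as \<open>l1 * A + l2 * B\<close>\<close>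
  define e where "e = inverse (l1 u12) *s u12"
  have e: "l1 e = 1" "l2 e = 0" using ind by (simp_all add: e_def hform_1_linear[OF l(1)] hform_1_linear[OF l(2)])
  define H where "H v = g1 v - g2 v" for v
  have H: "hform 2 H" unfolding H_def by (intro hform_diff g)
  obtain A where A: "hform 1 A" "\<And>v. H v = H (v - l1 v *s e) + l1 v * A v"
    using hform_divide[OF l(1), of 1 H e] H by (auto simp: numeral_2_eq_2)
  have "hform 1 (\<lambda>v. (v - l1 v *s e) $ i)" for i
  proof -
    have "(\<lambda>v. (v - l1 v *s e) $ i) = (\<lambda>v. v $ i - e $ i * l1 v)" by (auto simp: mult.commute)
    then show ?thesis using hform_diff[OF hform_coord[of i] hform_cmult[OF l(1), of "e $ i"]] by (simp only:)
  qed
  from hform_subst[OF this H] have H1: "hform (Suc 1) (\<lambda>v. H (v - l1 v *s e))" by (simp add: numeral_2_eq_2)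
  have "H (v - l1 v *s e) = 0" if "l2 v = 0" for v
    unfolding H_def using agree(1)[of "v - l1 v *s e"] that e
    by (simp add: hform_1_linear[OF l(1)] hform_1_linear[OF l(2)])
  then obtain B where B: "hform 1 B" "\<And>v. H (v - l1 v *s e) = l2 v * B v"
    using hform_dvd_linear[OF l(2) ind(4) H1] by blast
  define C0 where "C0 v = g1 v - l1 v * A v" for v
  have C0: "hform 2 C0" unfolding C0_def using hform_mult[OF l(1) A(1)] by (intro hform_diff g) (simp add: numeral_2_eq_2)
  have C01: "C0 v = g1 v" if "l1 v = 0" for v using that by (simp add: C0_def)
  have C02: "C0 v = g2 v" if "l2 v = 0" for v
    using A(2)[of v] B(2)[of v] that by (simp add: C0_def H_def algebra_simps)
  \<comment> \<open>\<open>q * h\<close> is divisible by \<open>l1 * l2\<close> on the third line, and \<open>h\<close> does not vanish where \<open>l1\<close> or \<open>l2\<close> does\<close>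
  define q where "q v = g3 v - C0 v" for v
  define h where "h v = g3 v + C0 v" for v
  have q: "hform 2 q" and h: "hform 2 h" unfolding q_def h_def by (intro hform_diff hform_add g C0)+
  have F: "hform (Suc (Suc 2)) (\<lambda>v. f v - C0 v * C0 v)"
    using hform_diff[OF f, of "\<lambda>v. C0 v * C0 v"] hform_mult[OF C0 C0] by (simp add: eval_nat_numeral)
  obtain N where N: "hform 2 N" "\<And>v. f v - C0 v * C0 v = l1 v * (l2 v * N v)"
    by (rule divide_by_two_lines[OF F l(1,2) ind(1,2,4)]) (use sq C01 C02 in auto)
  have qh: "q v * h v = l1 v * (l2 v * N v)" if "l3 v = 0" for v
    using N(2)[of v] sq(3)[OF that] by (simp add: q_def h_def algebra_simps)
  \<comment> \<open>a point of the third line off the other two, taken as the point at infinity\<close>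
  obtain b0 where b0: "l3 b0 = 0" "l1 b0 \<noteq> 0" "l2 b0 \<noteq> 0"
  proof (cases "l2 u13 = 0 \<and> l1 u23 = 0")
    case True
    then have "l3 (u13 + u23) = 0 \<and> l1 (u13 + u23) \<noteq> 0 \<and> l2 (u13 + u23) \<noteq> 0"
      using ind by (simp add: hform_1_linear[OF l(1)] hform_1_linear[OF l(2)] hform_1_linear[OF l(3)])
    then show ?thesis using that by blast
  next
    case False
    then show ?thesis using that ind by blast
  qed
  have "b0 \<noteq> 0" using b0(2) hform_1_linear(4)[OF l(1)] by auto
  obtain A' B' :: "complex^3^3" where AB: "A' ** B' = mat 1" "B' ** A' = mat 1" "\<And>v. (B' *v v) $ 3 = l3 v" "A' *v axis 2 1 = b0"
    by (rule line_frame[OF l(3) ind(9) b0(1) \<open>b0 \<noteq> 0\<close>]) (rule that)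
  define a where "a = A' *v axis 1 1"
  have la: "l3 a = 0" unfolding a_def AB(3)[symmetric] frame_inverse(2)[OF AB(1,2)] by (simp add: axis_def)
  have l3ab: "l3 (a + s *s b0) = 0" for s by (simp add: hform_1_linear[OF l(3)] la b0)
  have ab0: "a + s *s b0 \<noteq> 0" for s
  proof
    assume "a + s *s b0 = 0"
    then have "A' *v (axis 1 1 + s *s axis 2 1) = 0"
      by (simp add: a_def AB(4)[symmetric] matrix_vector_right_distrib vector_scalar_commute)
    then have "axis 1 1 + s *s axis 2 1 = (0 :: complex^3)" using frame_eq_0_iff[OF AB(1,2)] by blast
    from arg_cong[OF this, of "\<lambda>v. v $ 1"] show False by (simp add: axis_def)
  qed
  have plane: "\<exists>x y. v = x *s a + y *s b0" if "l3 v = 0" for v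
    unfolding a_def AB(4)[symmetric] by (rule frame_kernel[OF AB(1,2)]) (simp add: AB(3) that)
  obtain qp where qp: "degree qp \<le> 2" "\<And>s. poly qp s = q (a + s *s b0)" using hform_poly[OF q] by metis
  obtain hp where hp: "\<And>s. poly hp s = h (a + s *s b0)" using hform_poly[OF h] by metis
  obtain np where np: "\<And>s. poly np s = N (a + s *s b0)" using hform_poly[OF N(1)] by metis
  define z1 z2 where "z1 = - l1 a / l1 b0" and "z2 = - l2 a / l2 b0"
  have l1p: "l1 (a + s *s b0) = l1 b0 * (s - z1)" and l2p: "l2 (a + s *s b0) = l2 b0 * (s - z2)" for s
    using b0 by (simp_all add: hform_1_linear[OF l(1)] hform_1_linear[OF l(2)] z1_def z2_def field_simps)
  have "poly (qp * hp) = poly ([:- z1, 1:] * (smult (l1 b0 * l2 b0) [:- z2, 1:] * np))"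
  proof
    fix s show "poly (qp * hp) s = poly ([:- z1, 1:] * (smult (l1 b0 * l2 b0) [:- z2, 1:] * np)) s"
      using qh[OF l3ab[of s]] unfolding l1p l2p by (simp add: qp(2) hp np algebra_simps)
  qed
  then have e1: "qp * hp = [:- z1, 1:] * (smult (l1 b0 * l2 b0) [:- z2, 1:] * np)" by (simp add: poly_eq_poly_eq_iff)
  have g3nz: "g3 v \<noteq> 0" if "f v \<noteq> 0" "l3 v = 0" for v using sq(3)[OF that(2)] that(1) by auto
  have h1: "poly hp z1 \<noteq> 0"
  proof -
    have "l1 (a + z1 *s b0) = 0" using l1p by simp
    then have "h (a + z1 *s b0) = 2 * g3 (a + z1 *s b0)"
      unfolding h_def using C01 agree(2)[OF _ l3ab] by simp
    then show ?thesis unfolding hp using g3nz[OF fnz(1)[OF ab0 \<open>l1 (a + z1 *s b0) = 0\<close> l3ab] l3ab] by simp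
  qed
  have h2: "poly hp z2 \<noteq> 0"
  proof -
    have "l2 (a + z2 *s b0) = 0" using l2p by simp
    then have "h (a + z2 *s b0) = 2 * g3 (a + z2 *s b0)"
      unfolding h_def using C02 agree(3)[OF _ l3ab] by simp
    then show ?thesis unfolding hp using g3nz[OF fnz(2)[OF ab0 \<open>l2 (a + z2 *s b0) = 0\<close> l3ab] l3ab] by simp
  qed
  have "poly (qp * hp) z1 = 0" unfolding e1 by simp
  then have "poly qp z1 = 0" using h1 by simp
  then obtain q1 where q1: "qp = [:- z1, 1:] * q1" unfolding poly_eq_0_iff_dvd by (elim dvdE)
  have "[:- z1, 1:] * (q1 * hp) = [:- z1, 1:] * (smult (l1 b0 * l2 b0) [:- z2, 1:] * np)"
    using e1 unfolding q1 by (simp only: mult.assoc)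
  then have e2: "q1 * hp = smult (l1 b0 * l2 b0) [:- z2, 1:] * np" by (subst (asm) mult_cancel_left) auto
  have "poly (q1 * hp) z2 = 0" unfolding e2 by simp
  then have "poly q1 z2 = 0" using h2 by simp
  then obtain q2 where q2: "q1 = [:- z2, 1:] * q2" unfolding poly_eq_0_iff_dvd by (elim dvdE)
  have "degree q2 = 0"
  proof (cases "q2 = 0")
    case False
    then have "degree q1 = 1 + degree q2" "q1 \<noteq> 0"
      unfolding q2 using degree_mult_eq[of "[:- z2, 1:]" q2] by (simp_all del: mult_pCons_left)
    then have "degree qp = 1 + (1 + degree q2)"
      unfolding q1 using degree_mult_eq[of "[:- z1, 1:]" q1] by (simp del: mult_pCons_left)
    then show ?thesis using qp(1) by simp
  qed simp
  then obtain k where k: "q2 = [:k:]" by (metis degree_eq_zeroE)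
  define k' where "k' = k / (l1 b0 * l2 b0)"
  have kk: "hform 2 (\<lambda>v. k' * (l1 v * l2 v))" using hform_cmult[OF hform_mult[OF l(1,2)]] by (simp add: numeral_2_eq_2)
  have "q (a + s *s b0) = k' * (l1 (a + s *s b0) * l2 (a + s *s b0))" for s
    unfolding l1p l2p qp(2)[symmetric] q1 q2 k k'_def using b0 by (simp add: algebra_simps)
  from plane_ext[OF q kk this] have qk: "q v = k' * (l1 v * l2 v)" if "l3 v = 0" for v
    using plane[OF that] by metis
  show ?thesis
  proof (rule that)
    show "hform 2 (\<lambda>v. C0 v + k' * (l1 v * l2 v))" by (intro hform_add C0 kk)
    fix v assume "l1 v = 0 \<or> l2 v = 0 \<or> l3 v = 0"
    moreover have "C0 v + k' * (l1 v * l2 v) = g3 v" if "l3 v = 0"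
      using qk[OF that] unfolding q_def by (simp only: diff_eq_eq add.commute)
    ultimately show "(C0 v + k' * (l1 v * l2 v)) * (C0 v + k' * (l1 v * l2 v)) = f v"
      using C01 C02 sq by (elim disjE) simp_all
  qed
qed

lemma outer_scale: "c \<noteq> 0 \<Longrightarrow> outer (c *s v) (c\<^sup>2 * s) = outer v s"
  by (simp add: outer_def vec_eq_iff power2_eq_square)

text \<open>Where \<open>f\<close> is the square of the conic, the tensors \<open>v \<otimes> v / C v\<close> form a continuous section; both
  numerator and denominator have degree 2.\<close>

lemma sec_of_conic:
  assumes f: "hform 4 f" and C: "hform 2 C" and A: "A \<inter> zeros f = {}"
    and sq: "\<And>v. v \<noteq> 0 \<Longrightarrow> proj v \<in> A \<Longrightarrow> C v * C v = f v"
  obtains \<phi> where "sec (qroot f) A \<phi>"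
    "\<And>v. v \<noteq> 0 \<Longrightarrow> proj v \<in> A \<Longrightarrow> \<phi> (proj v) *\<^sub>R qroot f (proj v) = outer v (C v)"
proof -
  have nz: "C v \<noteq> 0" if "v \<noteq> 0" "proj v \<in> A" for v
    using sq[OF that] proj_in_zeros[OF f that(1)] A that(2) by auto
  define s where "s p = outer (rep p) (C (rep p))" for p
  have s: "s (proj v) = outer v (C v)" if v: "v \<noteq> 0" for v
  proof -
    obtain c where c: "c \<noteq> 0" "rep (proj v) = c *s v" using proj_eqE[of v "rep (proj v)"] rep v by metis
    then show ?thesis unfolding s_def c(2) hform_scale[OF C] by (simp add: outer_scale)
  qed
  have "\<exists>c::real. (c = 1 \<or> c = -1) \<and> c *\<^sub>R qroot f p = s p" if p: "p \<in> A" for p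
  proof -
    let ?v = "rep p"
    have v: "?v \<noteq> 0" "proj ?v \<in> A" "f ?v \<noteq> 0"
      using rep[of p] p A proj_in_zeros[OF f rep(1)[of p]] by auto
    obtain t where t: "t\<^sup>2 = f ?v" "qroot f (proj ?v) = outer ?v t" using qroot_outer[OF f v(1,3)] by metis
    have "(C ?v)\<^sup>2 = t\<^sup>2" using sq[OF v(1,2)] t(1) by (simp add: power2_eq_square)
    then have "C ?v = t \<or> C ?v = - t" by (simp add: power2_eq_iff)
    then show ?thesis using t(2) outer_minus[of ?v t] rep(2)[of p] unfolding s_def
      by (elim disjE) (auto intro: exI[of _ "1::real"] exI[of _ "-1::real"])
  qed
  then obtain \<phi> :: "cp2 \<Rightarrow> real" where \<phi>: "\<And>p. p \<in> A \<Longrightarrow> (\<phi> p = 1 \<or> \<phi> p = -1) \<and> \<phi> p *\<^sub>R qroot f p = s p" by metis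
  have "continuous_on A s"
  proof (rule continuous_on_cp2)
    have "continuous_on {v. v \<noteq> 0 \<and> proj v \<in> A} (\<lambda>v. outer v (C v))"
      by (rule continuous_on_outer) (use nz hform_continuous[OF C] in auto)
    then show "continuous_on {v. v \<noteq> 0 \<and> proj v \<in> A} (\<lambda>v. s (proj v))"
      by (rule continuous_on_eq) (use s in auto)
  qed
  then have "continuous_on A (\<lambda>p. \<phi> p *\<^sub>R qroot f p)" by (rule continuous_on_eq) (use \<phi> in auto)
  then have "sec (qroot f) A \<phi>" unfolding sec_def using \<phi> by blast
  moreover have "\<phi> (proj v) *\<^sub>R qroot f (proj v) = outer v (C v)" if "v \<noteq> 0" "proj v \<in> A" for v
    using \<phi>[OF that(2)] s[OF that(1)] by simp
  ultimately show ?thesis using that by blast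
qed

lemma outer_inject:
  assumes "v \<noteq> 0" "s \<noteq> 0" "t \<noteq> 0" "outer v s = outer v t" shows "s = t"
proof -
  obtain i where i: "v $ i \<noteq> 0" using assms(1) by (auto simp: vec_eq_iff)
  have "outer v s $ (i, i) = outer v t $ (i, i)" using assms(4) by simp
  then show ?thesis using i assms(2,3) by (simp add: outer_def frac_eq_eq)
qed

text \<open>The given root \<open>g\<close> of \<open>f\<close> on the line defines a section there, and since the line without the quartic is
  connected, \<open>\<phi>\<close> agrees with it up to a sign, which is moved into the root.\<close>

lemma root_of_sec:
  assumes f: "hform 4 f" "contains_no_line f" and l: "hform 1 l" "l w \<noteq> 0"
    and g: "hform 2 g" "\<And>v. l v = 0 \<Longrightarrow> g v * g v = f v"
    and \<phi>: "sec (qroot f) (zeros l - zeros f) \<phi>"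
  obtains g' where "hform 2 g'" "\<And>v. l v = 0 \<Longrightarrow> g' v * g' v = f v"
    "\<And>v. v \<noteq> 0 \<Longrightarrow> l v = 0 \<Longrightarrow> f v \<noteq> 0 \<Longrightarrow> \<phi> (proj v) *\<^sub>R qroot f (proj v) = outer v (g' v)"
proof -
  have pl: "proj v \<in> zeros l - zeros f \<longleftrightarrow> l v = 0 \<and> f v \<noteq> 0" if "v \<noteq> 0" for v
    using proj_in_zeros[OF l(1) that] proj_in_zeros[OF f(1) that] by blast
  obtain \<psi> where \<psi>: "sec (qroot f) (zeros l - zeros f) \<psi>"
    "\<And>v. v \<noteq> 0 \<Longrightarrow> proj v \<in> zeros l - zeros f \<Longrightarrow> \<psi> (proj v) *\<^sub>R qroot f (proj v) = outer v (g v)"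
    by (rule sec_of_conic[OF f(1) g(1), of "zeros l - zeros f"]) (use g(2) pl in auto)
  obtain v0 where "l v0 = 0" "f v0 \<noteq> 0" using f(2) l unfolding contains_no_line_def by blast
  from zeros_on_line[OF l f(1) this] have "finite (zeros l \<inter> zeros f)" .
  moreover have "zeros l - zeros f = zeros l - zeros l \<inter> zeros f" by blast
  ultimately have conn: "connected (zeros l - zeros f)" using line_minus_finite_connected[OF l] by simp
  obtain c :: real where c: "c = 1 \<or> c = -1" "\<And>p. p \<in> zeros l - zeros f \<Longrightarrow> \<phi> p = c * \<psi> p"
    by (rule sec_unique[OF conn \<phi> \<psi>(1)]) (use qroot_nonzero[OF f(1)] in auto)
  define g' where "g' v = of_real c * g v" for v
  show ?thesis
  proof (rule that[of g'])
    show "hform 2 g'" unfolding g'_def by (rule hform_cmult[OF g(1)])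
    show "g' v * g' v = f v" if "l v = 0" for v using c(1) g(2)[OF that] by (auto simp: g'_def)
    fix v assume v: "v \<noteq> 0" "l v = 0" "f v \<noteq> 0"
    then have p: "proj v \<in> zeros l - zeros f" using pl by blast
    have "\<phi> (proj v) *\<^sub>R qroot f (proj v) = c *\<^sub>R outer v (g v)"
      unfolding c(2)[OF p] \<psi>(2)[OF v(1) p, symmetric] by simp
    also have "\<dots> = outer v (g' v)" using c(1) outer_minus[of v "g v"] by (auto simp: g'_def)
    finally show "\<phi> (proj v) *\<^sub>R qroot f (proj v) = outer v (g' v)" .
  qed
qed

section \<open>Bitangents\<close>

lemma curve_zeros: "curve F = zeros (peval F)"
  by (simp add: curve_def zeros_def)

lemma smooth_quartic_form:
  assumes "smooth_quartic Q"
  shows "hform 4 (peval Q)" "smooth_form (peval Q)" "contains_no_line (peval Q)"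
proof -
  show f: "hform 4 (peval Q)" using assms by (auto simp: smooth_quartic_def intro: form_hform)
  then show "smooth_form (peval Q)"
    using assms unfolding smooth_quartic_def smooth_curve_def smooth_form_def partial_deriv_eq[OF f] by blast
  then show "contains_no_line (peval Q)" using smooth_no_line[of 2 "peval Q"] f by (simp add: eval_nat_numeral)
qed

lemma local_param_germ:
  assumes "smooth_quartic Q" "local_param Q p \<gamma>"
  obtains r where "curve_germ (peval Q) 4 \<gamma> r" "proj (\<gamma> 0) = p"
proof -
  obtain r where "r > 0" "\<forall>i. (\<lambda>t. \<gamma> t $ i) holomorphic_on ball 0 r" "\<forall>t\<in>ball 0 r. \<gamma> t \<noteq> 0 \<and> peval Q (\<gamma> t) = 0"
    "proj (\<gamma> 0) = p" "\<forall>c. (\<chi> i. deriv (\<lambda>t. \<gamma> t $ i) 0) \<noteq> c *s \<gamma> 0"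
    using assms(2) unfolding local_param_def by blast
  then have "curve_germ (peval Q) 4 \<gamma> r"
    using smooth_quartic_form[OF assms(1)] by unfold_locales auto
  with \<open>proj (\<gamma> 0) = p\<close> that show ?thesis by blast
qed

lemma local_param_exists:
  assumes Q: "smooth_quartic Q" and p: "p \<in> curve Q"
  shows "\<exists>\<gamma>. local_param Q p \<gamma>"
proof -
  note f = smooth_quartic_form[OF Q]
  have p': "p \<in> zeros (peval Q)" using p by (simp add: curve_zeros)
  obtain N e \<gamma> where N: "open N" "p \<in> N" "N \<subseteq> UNIV" "e > 0" "\<gamma> 0 = rep p"
    "\<And>i. (\<lambda>x. \<gamma> x $ i) holomorphic_on ball 0 e" "\<And>x. x \<in> ball 0 e \<Longrightarrow> \<gamma> x \<noteq> 0"
    "inj_on (\<lambda>x. proj (\<gamma> x)) (ball 0 e)" "N \<inter> zeros (peval Q) = (\<lambda>x. proj (\<gamma> x)) ` ball 0 e"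
    "\<And>c. (\<chi> i. deriv (\<lambda>x. \<gamma> x $ i) 0) \<noteq> c *s rep p"
    by (rule smooth_point_disc[OF f(1,2) p' open_UNIV UNIV_I]) (rule that)
  have "peval Q (\<gamma> x) = 0" if "x \<in> ball 0 e" for x
    using N(9) that proj_in_zeros[OF f(1) N(7)[OF that]] by blast
  then show ?thesis unfolding local_param_def using N(4,5,6,7,10) rep(2) by metis
qed

text \<open>The parametrisation selected in the definition of the multiplicities is the same for all forms, so
  that their orders can be compared.\<close>

lemma int_mult_germ:
  assumes Q: "smooth_quartic Q" and p: "p \<in> curve Q"
  obtains \<gamma> r where "curve_germ (peval Q) 4 \<gamma> r" "proj (\<gamma> 0) = p"
    "\<And>F. int_mult Q F p = nat (zorder (\<lambda>t. peval F (\<gamma> t)) 0)"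
proof -
  define \<gamma> where "\<gamma> = (SOME \<gamma>. local_param Q p \<gamma>)"
  have "local_param Q p \<gamma>" unfolding \<gamma>_def by (rule someI_ex[OF local_param_exists[OF Q p]])
  then obtain r where "curve_germ (peval Q) 4 \<gamma> r" "proj (\<gamma> 0) = p" by (rule local_param_germ[OF Q])
  moreover have "int_mult Q F p = nat (zorder (\<lambda>t. peval F (\<gamma> t)) 0)" for F
    unfolding int_mult_def \<gamma>_def using p by simp
  ultimately show ?thesis using that by blast
qed

text \<open>A bitangent with its tangency divisor \<open>D\<close>, in coordinates adapted to the line whose second basis
  vector is off the quartic. The line is spanned by \<open>a\<close> and \<open>b\<close>, and \<open>P\<close> is the equation of the quartic
  restricted to it.\<close>

locale bitangent_line =
  fixes Q lf :: ternary_poly and D :: "cp2 multiset" and A B :: "complex^3^3"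
  assumes Q: "smooth_quartic Q" and form: "is_form 1 lf"
    and div: "\<And>p. int_mult Q lf p = 2 * count D p" and size: "size D = 2"
    and AB: "A ** B = mat 1" "B ** A = mat 1" and Bl: "\<And>v. (B *v v) $ 3 = peval lf v"
    and fb: "peval Q (A *v axis 2 1) \<noteq> 0"
begin

abbreviation "f \<equiv> peval Q"
abbreviation "l \<equiv> peval lf"

lemmas f = smooth_quartic_form[OF Q]

lemma l: "hform 1 l" using form by (rule form_hform)

definition a where "a = A *v axis 1 1"
definition b where "b = A *v axis 2 1"
definition P where "P = (SOME p. degree p \<le> 4 \<and> coeff p 4 = f b \<and> (\<forall>s. poly p s = f (a + s *s b)))"

lemma P: "degree P \<le> 4" "coeff P 4 = f b" "poly P s = f (a + s *s b)"
  using someI_ex[OF hform_poly[OF f(1), of b a]] unfolding P_def by blast+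

lemma lab: "l a = 0" "l b = 0"
  unfolding a_def b_def Bl[symmetric] frame_inverse(2)[OF AB] by (simp_all add: axis_def)

lemma lplane: "l (x *s a + y *s b) = 0"
  by (simp add: hform_1_linear(1,3)[OF l] lab)

lemma lpoint: "l (a + s *s b) = 0"
  using lplane[of 1 s] by simp

lemma plane: "l v = 0 \<Longrightarrow> \<exists>x y. v = x *s a + y *s b"
  unfolding a_def b_def by (rule frame_kernel[OF AB]) (simp add: Bl)

lemma Bab: "B *v (x *s a + y *s b) = x *s axis 1 1 + y *s axis 2 1"
  by (simp add: a_def b_def matrix_vector_right_distrib vector_scalar_commute frame_inverse(2)[OF AB])

lemma point_nz: "a + s *s b \<noteq> 0"
proof
  assume "a + s *s b = 0"
  then have "B *v (1 *s a + s *s b) = 0" by simp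
  from arg_cong[OF this, of "\<lambda>v. v $ 1"] show False unfolding Bab by (simp add: axis_def)
qed

lemma on_plane: "hform n F \<Longrightarrow> hform n G \<Longrightarrow> (\<And>s. F (a + s *s b) = G (a + s *s b)) \<Longrightarrow> l v = 0 \<Longrightarrow> F v = G v"
  using plane plane_ext by metis

lemma germ:
  assumes g: "curve_germ f 4 \<gamma> r" and 0: "l (\<gamma> 0) = 0"
  shows "germ_and_line f 4 \<gamma> r l A B P"
  using g l 0 AB Bl fb P(3) unfolding a_def b_def
  by (intro germ_and_line.intro germ_and_line_axioms.intro) auto

lemma germ_point:
  assumes g: "germ_and_line f 4 \<gamma> r l A B P" and p: "proj (\<gamma> 0) = proj (a + s *s b)"
  shows "germ_and_line.s0 \<gamma> B = s"
proof -
  interpret G: germ_and_line f 4 \<gamma> r l A B P by (rule g)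
  have "\<gamma> 0 \<noteq> 0" using G.on_curve[OF G.zero_in] by blast
  then obtain c where c: "c \<noteq> 0" "\<gamma> 0 = c *s (a + s *s b)" using proj_eqE[OF p[symmetric] point_nz] by metis
  have "B *v \<gamma> 0 = c *s (B *v (a + s *s b))" unfolding c(2) by (rule vector_scalar_commute)
  also have "a + s *s b = 1 *s a + s *s b" by simp
  finally show ?thesis unfolding G.s0_def G.T_def G.\<Sigma>_def Bab using c(1) by (simp add: axis_def)
qed

lemma P_nz: "P \<noteq> 0" using P(2) fb unfolding b_def by auto

text \<open>At each root of the restricted equation there is the parametrisation that computes the
  multiplicities, based at the point of the line with this parameter.\<close>

lemma root_germ:
  assumes "poly P s = 0"
  obtains \<gamma> r where "germ_and_line f 4 \<gamma> r l A B P" "proj (\<gamma> 0) = proj (a + s *s b)"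
    "germ_and_line.s0 \<gamma> B = s"
    "\<And>F. int_mult Q F (proj (a + s *s b)) = nat (zorder (\<lambda>t. peval F (\<gamma> t)) 0)"
proof -
  have p: "proj (a + s *s b) \<in> curve Q"
    using assms unfolding curve_zeros proj_in_zeros[OF f(1) point_nz] P(3) .
  obtain \<gamma> r where g: "curve_germ f 4 \<gamma> r" "proj (\<gamma> 0) = proj (a + s *s b)"
    "\<And>F. int_mult Q F (proj (a + s *s b)) = nat (zorder (\<lambda>t. peval F (\<gamma> t)) 0)"
    by (rule int_mult_germ[OF Q p]) (rule that)
  have "\<gamma> 0 \<noteq> 0" using curve_germ.on_curve[OF g(1) curve_germ.zero_in[OF g(1)]] by blast
  then obtain c where "\<gamma> 0 = c *s (a + s *s b)" using proj_eqE[OF g(2)[symmetric] point_nz] by metis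
  then have "l (\<gamma> 0) = 0" by (simp only: hform_1_linear(3)[OF l] lpoint mult_zero_right)
  from germ[OF g(1) this] have "germ_and_line f 4 \<gamma> r l A B P" .
  with g(2,3) germ_point that show ?thesis by blast
qed

lemma order_root:
  assumes "poly P s = 0" shows "order s P = 2 * count D (proj (a + s *s b))"
proof -
  obtain \<gamma> r where g: "germ_and_line f 4 \<gamma> r l A B P" "germ_and_line.s0 \<gamma> B = s"
    "\<And>F. int_mult Q F (proj (a + s *s b)) = nat (zorder (\<lambda>t. peval F (\<gamma> t)) 0)"
    by (rule root_germ[OF assms]) (rule that)
  show ?thesis using germ_and_line.order_along_line[OF g(1)] g(2) g(3)[of lf] div by simp
qed

text \<open>All roots of \<open>P\<close> have even order, twice their multiplicity in the divisor, so \<open>P\<close> is a square.\<close>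

lemma square_root_poly: "\<exists>R. P = R * R \<and> degree R = 2 \<and> (\<forall>s. poly P s = 0 \<longrightarrow> order s R = count D (proj (a + s *s b)))"
proof -
  let ?Z = "{z. poly P z = 0}"
  define R where "R = smult (csqrt (lead_coeff P)) (\<Prod>z\<in>?Z. [:- z, 1:] ^ count D (proj (a + z *s b)))"
  have "R * R = smult (lead_coeff P) (\<Prod>z\<in>?Z. [:- z, 1:] ^ count D (proj (a + z *s b)) * [:- z, 1:] ^ count D (proj (a + z *s b)))"
  proof -
    have "csqrt (lead_coeff P) * csqrt (lead_coeff P) = lead_coeff P" by (simp flip: power2_eq_square)
    then show ?thesis by (simp add: R_def prod.distrib)
  qed
  also have "\<dots> = smult (lead_coeff P) (\<Prod>z\<in>?Z. [:- z, 1:] ^ order z P)"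
    by (intro arg_cong2[of _ _ _ _ smult] refl prod.cong) (simp add: order_root power_add mult_2)
  also have "\<dots> = P" by (rule complex_poly_decompose)
  finally have RR: "P = R * R" by simp
  then have Rnz: "R \<noteq> 0" using P_nz by auto
  have "degree P = 4"
    using P(1,2) fb le_degree[of P 4] unfolding b_def by simp
  then have "degree R = 2" using RR Rnz by (simp add: degree_mult_eq)
  moreover have "order s R = count D (proj (a + s *s b))" if "poly P s = 0" for s
    using order_root[OF that] order_mult[of R R s] P_nz RR by simp
  ultimately show ?thesis using RR by blast
qed

definition R where "R = (SOME R. P = R * R \<and> degree R = 2 \<and> (\<forall>s. poly P s = 0 \<longrightarrow> order s R = count D (proj (a + s *s b))))"

lemma R: "P = R * R" "degree R = 2" "poly P s = 0 \<Longrightarrow> order s R = count D (proj (a + s *s b))"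
  using someI_ex[OF square_root_poly] unfolding R_def[symmetric] by blast+

text \<open>The binary form of degree 2 with dehomogenisation \<open>R\<close>, extended to the plane by the coordinates \<open>B\<close>.\<close>

definition g where
  "g v = coeff R 0 * ((B *v v) $ 1 * (B *v v) $ 1) + coeff R 1 * ((B *v v) $ 1 * (B *v v) $ 2)
     + coeff R 2 * ((B *v v) $ 2 * (B *v v) $ 2)"

lemma g_form: "hform 2 g"
proof -
  have c: "hform 1 (\<lambda>v. (B *v v) $ i)" for i
    unfolding hform_1_iff matrix_vector_mult_def by auto
  have "hform 2 (\<lambda>v. (B *v v) $ i * (B *v v) $ j)" for i j
    using hform_mult[OF c[of i] c[of j]] by (simp add: numeral_2_eq_2)
  then show ?thesis unfolding g_def by (intro hform_add hform_cmult)
qed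

lemma g_point: "g (a + s *s b) = poly R s"
proof -
  have "a + s *s b = 1 *s a + s *s b" by simp
  then have "g (a + s *s b) = coeff R 0 + coeff R 1 * s + coeff R 2 * (s * s)"
    unfolding g_def using Bab[of 1 s] by (simp add: axis_def)
  also have "\<dots> = poly R s"
    unfolding poly_altdef R(2) by (simp add: eval_nat_numeral algebra_simps)
  finally show ?thesis .
qed

lemma g_square: "l v = 0 \<Longrightarrow> g v * g v = f v"
proof -
  assume v: "l v = 0"
  have "hform 4 (\<lambda>v. g v * g v)" using hform_mult[OF g_form g_form] by simp
  moreover have "g (a + s *s b) * g (a + s *s b) = f (a + s *s b)" for s
  proof -
    have "f (a + s *s b) = poly P s" using P(3) by simp
    also have "\<dots> = poly R s * poly R s" by (subst R(1)) simp
    finally show ?thesis unfolding g_point by simp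
  qed
  ultimately show ?thesis using on_plane[OF _ f(1) _ v, of "\<lambda>v. g v * g v"] by simp
qed

text \<open>The multiplicities of a conic along the quartic are compared with the orders of its restriction
  \<open>c\<close> to the line: order at least 1 is vanishing, and order at least 2 is vanishing of the derivative
  along the common tangent. So \<open>R\<close> divides \<open>c\<close>, and both have degree at most 2.\<close>

lemma conic_restrict:
  assumes C: "hform 2 (peval C)" and ge: "\<And>p. count D p \<le> int_mult Q C p"
  obtains k where "\<And>v. l v = 0 \<Longrightarrow> peval C v = k * g v"
proof -
  obtain c where c: "degree c \<le> 2" "\<And>s. poly c s = peval C (a + s *s b)" using hform_poly[OF C] by metis
  have Rnz: "R \<noteq> 0" using R(2) by auto
  have "\<exists>k. c = smult k R"
  proof (cases "c = 0")
    case False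
    have ord: "order z R \<le> order z c" if z: "poly R z = 0" for z
    proof -
      have Pz: "poly P z = 0" using R(1) z by simp
      let ?p = "proj (a + z *s b)"
      have oR: "order z R = count D ?p" using R(3)[OF Pz] .
      have "order z R \<noteq> 0" using z Rnz Polynomial.order_root by blast
      moreover have "count D ?p \<le> 2" using size count_le_size[of D ?p] by simp
      ultimately consider "count D ?p = 1" | "count D ?p = 2" using oR by linarith
      then show ?thesis
      proof cases
        case 1
        obtain \<gamma> r where g: "germ_and_line f 4 \<gamma> r l A B P" "germ_and_line.s0 \<gamma> B = z"
          "\<And>F. int_mult Q F ?p = nat (zorder (\<lambda>t. peval F (\<gamma> t)) 0)" by (rule root_germ[OF Pz]) (rule that)
        interpret G: germ_and_line f 4 \<gamma> r l A B P by (rule g(1))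
        have ab: "G.a = a" "G.b = b" unfolding G.a_def G.b_def a_def b_def by (rule refl)+
        have "zorder (\<lambda>t. peval C (\<gamma> t)) 0 \<ge> 1" using ge[of ?p] 1 g(3)[of C] by simp
        from G.order_ge_1[OF C this] have "peval C (G.a + G.s0 *s G.b) = 0"
          using G.F_gamma0[OF C] G.T0 by simp
        then have "poly c z = 0" unfolding c(2) ab g(2) .
        then have "order z c \<noteq> 0" using False Polynomial.order_root by blast
        then show ?thesis using oR 1 by simp
      next
        case 2
        obtain \<gamma> r where g: "germ_and_line f 4 \<gamma> r l A B P" "germ_and_line.s0 \<gamma> B = z"
          "\<And>F. int_mult Q F ?p = nat (zorder (\<lambda>t. peval F (\<gamma> t)) 0)" by (rule root_germ[OF Pz]) (rule that)
        interpret G: germ_and_line f 4 \<gamma> r l A B P by (rule g(1))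
        have ab: "G.a = a" "G.b = b" unfolding G.a_def G.b_def a_def b_def by (rule refl)+
        have cp: "poly c s = peval C (G.a + s *s G.b)" for s unfolding c(2) ab ..
        have "zorder (\<lambda>t. peval C (\<gamma> t)) 0 \<ge> 2" using ge[of ?p] 2 g(3)[of C] by simp
        note C0 = G.order_ge_2[OF C this]
        have "poly c z = 0" unfolding cp g(2)[symmetric] using G.F_gamma0[OF C] G.T0 C0(1) by simp
        have "order G.s0 P \<ge> 2" using order_root[OF Pz] 2 g(2) by simp
        note m = G.multiplicity_ge_2[OF this]
        have "hderiv (peval C) (\<gamma> 0) G.b = 0"
          using G.hderiv_expand[OF C C0(1), of G.tangent] C0(2) m(1,2) by simp
        then have "poly (pderiv c) z = 0" using G.hderiv_b[OF C cp] G.T0 g(2) by simp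
        then show ?thesis using pderiv_at_root[OF False \<open>poly c z = 0\<close>] oR 2 by simp
      qed
    qed
    have "R dvd c"
    proof -
      let ?ZR = "{z. poly R z = 0}" and ?Zc = "{z. poly c z = 0}"
      have sub: "?ZR \<subseteq> ?Zc"
      proof
        fix z assume "z \<in> ?ZR"
        then have "poly R z = 0" by simp
        then have "order z c \<noteq> 0" using ord[of z] Polynomial.order_root[of R z] Rnz by simp
        then show "z \<in> ?Zc" using Polynomial.order_root[of c z] by simp
      qed
      have "(\<Prod>z\<in>?ZR. [:- z, 1:] ^ order z R) dvd (\<Prod>z\<in>?Zc. [:- z, 1:] ^ order z c)"
        by (rule prod_dvd_prod_subset2[OF poly_roots_finite[OF False] sub])
          (use ord in \<open>auto intro: le_imp_power_dvd\<close>)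
      then have "smult (lead_coeff R) (\<Prod>z\<in>?ZR. [:- z, 1:] ^ order z R) dvd smult (lead_coeff c) (\<Prod>z\<in>?Zc. [:- z, 1:] ^ order z c)"
        using Rnz by (simp add: smult_dvd_iff dvd_smult)
      then show ?thesis unfolding complex_poly_decompose .
    qed
    then obtain k where k: "c = R * k" by (elim dvdE)
    then have "degree c = 2 + degree k" using False Rnz R(2) by (simp add: degree_mult_eq)
    then have "degree k = 0" using c(1) by simp
    then obtain k0 where "k = [:k0:]" by (metis degree_eq_zeroE)
    then show ?thesis using k by auto
  qed (auto intro: exI[of _ 0])
  then obtain k where k: "c = smult k R" by blast
  have "peval C (a + s *s b) = k * g (a + s *s b)" for s
    unfolding c(2)[symmetric] g_point k by simp
  from on_plane[OF C hform_cmult[OF g_form] this] that show ?thesis by blast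
qed

text \<open>The converse comparison. If \<open>f\<close> is the square of the conic on the line, the restriction \<open>c\<close> of the
  conic has the multiplicities of the divisor as orders of its roots, and for order 2 the quartic
  and the line have the same tangent.\<close>

lemma conic_contact:
  assumes C: "hform 2 (peval C)" and sq: "\<And>v. l v = 0 \<Longrightarrow> peval C v * peval C v = f v"
    and nz: "\<And>\<gamma> r. curve_germ f 4 \<gamma> r \<Longrightarrow> \<exists>t\<in>ball 0 r. peval C (\<gamma> t) \<noteq> 0"
  shows "count D p \<le> int_mult Q C p"
proof (cases "count D p = 0")
  case False
  have "int_mult Q lf p \<noteq> 0" using div[of p] False by simp
  then have "p \<in> curve Q" unfolding int_mult_def by (auto split: if_splits)
  obtain \<gamma> r where g: "curve_germ f 4 \<gamma> r" "proj (\<gamma> 0) = p"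
    "\<And>F. int_mult Q F p = nat (zorder (\<lambda>t. peval F (\<gamma> t)) 0)"
    by (rule int_mult_germ[OF Q \<open>p \<in> curve Q\<close>]) (rule that)
  have l0: "l (\<gamma> 0) = 0"
    by (rule curve_germ.order_ge_1[OF g(1) l]) (use \<open>int_mult Q lf p \<noteq> 0\<close> g(3)[of lf] in simp)
  interpret G: germ_and_line f 4 \<gamma> r l A B P by (rule germ[OF g(1) l0])
  have ab: "G.a = a" "G.b = b" unfolding G.a_def G.b_def a_def b_def by (rule refl)+
  obtain c where c: "\<And>s. poly c s = peval C (a + s *s b)" using hform_poly[OF C] by metis
  have "poly P s = poly (c * c) s" for s
    unfolding P(3) poly_mult c using sq[OF lpoint[of s]] by simp
  then have cc: "P = c * c" by (simp add: poly_eq_poly_eq_iff[symmetric] fun_eq_iff)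
  then have cnz: "c \<noteq> 0" using P_nz by auto
  have "2 * order G.s0 c = order G.s0 P" using order_mult[of c c G.s0] cc P_nz by (metis mult_2)
  moreover have "order G.s0 P = 2 * count D p" using G.order_along_line g(3)[of lf] div[of p] by simp
  ultimately have oc: "order G.s0 c = count D p" by simp
  have c0: "poly c G.s0 = 0" using oc False Polynomial.order_root by metis
  then have C0: "peval C (\<gamma> 0) = 0" unfolding c using G.F_gamma0[OF C] by (simp add: ab)
  obtain t0 where t0: "t0 \<in> ball 0 r" "peval C (\<gamma> t0) \<noteq> 0" using nz[OF g(1)] by blast
  note low = G.order_lower[OF C t0 C0]
  have "count D p \<le> 2" using size count_le_size[of D p] by simp
  then consider "count D p = 1" | "count D p = 2" using False by linarith
  then show ?thesis
  proof cases
    case 1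
    then show ?thesis using low(1) g(3)[of C] by simp
  next
    case 2
    then have "poly (pderiv c) G.s0 = 0" using pderiv_at_root[OF cnz c0] oc by simp
    then have "hderiv (peval C) (\<gamma> 0) G.b = 0" using G.hderiv_b[OF C, of c] c G.T0 unfolding ab by simp
    moreover have "l G.tangent = 0" using G.multiplicity_ge_2(1) \<open>order G.s0 P = 2 * count D p\<close> 2 by simp
    ultimately have "hderiv (peval C) (\<gamma> 0) G.tangent = 0" using G.hderiv_expand[OF C C0, of G.tangent] by simp
    from low(2)[OF this] show ?thesis using 2 g(3)[of C] by simp
  qed
qed simp

end

context bitangent_line
begin

lemma l_nonzero: "l (A *v axis 3 1) \<noteq> 0"
  unfolding Bl[symmetric] frame_inverse(2)[OF AB] by (simp add: axis_def)

lemma b_nonzero: "b \<noteq> 0"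
proof
  assume "b = 0"
  then have "f b = 0" using hform_scale[OF f(1), of 0 0] by simp
  then show False using fb unfolding b_def by simp
qed

text \<open>The order of contact is even and positive.\<close>

lemma tangent_to_line:
  assumes g: "curve_germ f 4 \<gamma> r" and 0: "l (\<gamma> 0) = 0"
    and m: "\<And>F. int_mult Q F p = nat (zorder (\<lambda>t. peval F (\<gamma> t)) 0)"
  shows "l (curve_germ.tangent \<gamma>) = 0"
proof -
  interpret G: germ_and_line f 4 \<gamma> r l A B P by (rule germ[OF g 0])
  have "order G.s0 P = 2 * count D p" using G.order_along_line m[of lf] div[of p] by simp
  moreover have "order G.s0 P \<noteq> 0" using G.P_root P_nz Polynomial.order_root by metis
  ultimately show ?thesis by (intro G.multiplicity_ge_2(1)) arith
qed

lemma support: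
  assumes "count D p \<noteq> 0"
  shows "f (rep p) = 0" "l (rep p) = 0"
proof -
  have i: "int_mult Q lf p \<noteq> 0" using div[of p] assms by simp
  then have p: "p \<in> curve Q" unfolding int_mult_def by (auto split: if_splits)
  then have "proj (rep p) \<in> zeros f" using rep(2) by (simp add: curve_zeros)
  then show "f (rep p) = 0" using proj_in_zeros[OF f(1) rep(1)] by simp
  obtain \<gamma> r where g: "curve_germ f 4 \<gamma> r" "proj (\<gamma> 0) = p"
    "\<And>F. int_mult Q F p = nat (zorder (\<lambda>t. peval F (\<gamma> t)) 0)"
    by (rule int_mult_germ[OF Q p]) (rule that)
  have l0: "l (\<gamma> 0) = 0"
    by (rule curve_germ.order_ge_1[OF g(1) l]) (use i g(3)[of lf] in simp)
  have "\<gamma> 0 \<noteq> 0" using curve_germ.on_curve[OF g(1) curve_germ.zero_in[OF g(1)]] by blast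
  then have "p \<in> zeros l" using proj_in_zeros[OF l, of "\<gamma> 0"] g(2) l0 by simp
  then show "l (rep p) = 0" using proj_in_zeros[OF l rep(1)[of p]] rep(2)[of p] by simp
qed

end

text \<open>The second basis vector is a point of the line off the quartic, which contains no line.\<close>

lemma bitangent_line_exists:
  assumes Q: "smooth_quartic Q" and D: "tangency_divisor Q M D"
  obtains lf A B where "bitangent_line Q lf D A B" "M = zeros (peval lf)"
proof -
  note f = smooth_quartic_form[OF Q]
  obtain lf where lf: "is_form 1 lf" "M = curve lf" "size D = 2" "\<And>p. int_mult Q lf p = 2 * count D p"
    using D unfolding tangency_divisor_def by blast
  have l: "hform 1 (peval lf)" using lf(1) by (rule form_hform)
  obtain w where w: "peval lf w \<noteq> 0" by (rule form_nonzero[OF lf(1)]) auto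
  obtain b0 where b0: "peval lf b0 = 0" "peval Q b0 \<noteq> 0" using f(3) l w unfolding contains_no_line_def by blast
  have "b0 \<noteq> 0"
  proof
    assume "b0 = 0"
    then show False using b0(2) hform_scale[OF f(1), of 0 0] by simp
  qed
  obtain A B :: "complex^3^3" where AB: "A ** B = mat 1" "B ** A = mat 1" "\<And>v. (B *v v) $ 3 = peval lf v" "A *v axis 2 1 = b0"
    by (rule line_frame[OF l w b0(1) \<open>b0 \<noteq> 0\<close>]) (rule that)
  have "bitangent_line Q lf D A B"
    by unfold_locales (use Q lf AB b0 in auto)
  with that lf(2) show ?thesis by (simp add: curve_zeros)
qed

text \<open>The vectors \<open>u\<close> and \<open>t\<close> span the kernel of \<open>l\<close>.\<close>

lemma linear_forms_vanish:
  assumes l: "hform 1 l" "l w \<noteq> 0" and l': "hform 1 l'" and u: "u \<noteq> 0" and t: "\<And>c. t \<noteq> c *s u"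
    and 0: "l u = 0" "l t = 0" "l' u = 0" "l' t = 0" and v: "l v = 0"
  shows "l' v = 0"
proof -
  obtain A B :: "complex^3^3" where AB: "A ** B = mat 1" "B ** A = mat 1" "\<And>v. (B *v v) $ 3 = l v" "A *v axis 2 1 = u"
    by (rule line_frame[OF l 0(1) u]) (rule that)
  define a where "a = A *v axis 1 1"
  have plane: "\<exists>x y. v = x *s a + y *s u" if "l v = 0" for v
    unfolding a_def AB(4)[symmetric] by (rule frame_kernel[OF AB(1,2)]) (simp add: AB(3) that)
  obtain x y where xy: "t = x *s a + y *s u" using plane[OF 0(2)] by blast
  have "x \<noteq> 0" using t[of y] xy by auto
  moreover have "x * l' a = 0" using 0(3,4) unfolding xy by (simp add: hform_1_linear[OF l'])
  ultimately have "l' a = 0" by simp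
  obtain x' y' where "v = x' *s a + y' *s u" using plane[OF v] by blast
  then show ?thesis using \<open>l' a = 0\<close> 0(3) by (simp add: hform_1_linear[OF l'])
qed

text \<open>In a common point on the quartic, both bitangents would be the tangent line of the quartic.\<close>

lemma bitangents_meet_off_quartic:
  assumes b1: "bitangent_line Q l1 D1 A1 B1" and b2: "bitangent_line Q l2 D2 A2 B2"
    and ne: "zeros (peval l1) \<noteq> zeros (peval l2)"
    and v: "v \<noteq> 0" "peval l1 v = 0" "peval l2 v = 0"
  shows "peval Q v \<noteq> 0"
proof
  assume fv: "peval Q v = 0"
  interpret b1: bitangent_line Q l1 D1 A1 B1 by (rule b1)
  interpret b2: bitangent_line Q l2 D2 A2 B2 by (rule b2)
  have p: "proj v \<in> curve Q" using proj_in_zeros[OF b1.f(1) v(1)] fv by (simp add: curve_zeros)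
  obtain \<gamma> r where g: "curve_germ (peval Q) 4 \<gamma> r" "proj (\<gamma> 0) = proj v"
    "\<And>F. int_mult Q F (proj v) = nat (zorder (\<lambda>t. peval F (\<gamma> t)) 0)"
    by (rule int_mult_germ[OF b1.Q p]) (rule that)
  interpret curve_germ "peval Q" 4 \<gamma> r by (rule g(1))
  have nz: "\<gamma> 0 \<noteq> 0" using on_curve[OF zero_in] by blast
  then obtain c where "\<gamma> 0 = c *s v" using proj_eqE[OF g(2)[symmetric] v(1)] by metis
  then have 0: "peval l1 (\<gamma> 0) = 0" "peval l2 (\<gamma> 0) = 0"
    using v by (simp_all add: hform_1_linear(3)[OF b1.l] hform_1_linear(3)[OF b2.l])
  have t: "peval l1 tangent = 0" "peval l2 tangent = 0"
    by (rule b1.tangent_to_line[OF g(1) 0(1) g(3)], rule b2.tangent_to_line[OF g(1) 0(2) g(3)])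
  have imm: "tangent \<noteq> c *s \<gamma> 0" for c using immersive unfolding tangent_def by blast
  have "peval l1 v = 0 \<longleftrightarrow> peval l2 v = 0" for v
    using linear_forms_vanish[OF b1.l b1.l_nonzero b2.l nz imm 0(1) t(1) 0(2) t(2)]
      linear_forms_vanish[OF b2.l b2.l_nonzero b1.l nz imm 0(2) t(2) 0(1) t(1)] by blast
  then show False using ne unfolding zeros_def by simp
qed

context curve_germ
begin

text \<open>Where the first factor does not vanish the second one would have to; by analytic continuation it
  would then vanish everywhere.\<close>

lemma product_nonzero:
  assumes F: "hform m F" "\<exists>t\<in>ball 0 r. F (\<gamma> t) \<noteq> 0" and G: "hform n G" "\<exists>t\<in>ball 0 r. G (\<gamma> t) \<noteq> 0"
  shows "\<exists>t\<in>ball 0 r. F (\<gamma> t) * G (\<gamma> t) \<noteq> 0"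
proof (rule ccontr)
  assume no: "\<not> ?thesis"
  obtain t0 where t0: "t0 \<in> ball 0 r" "F (\<gamma> t0) \<noteq> 0" using F(2) by blast
  let ?U = "ball 0 r \<inter> (\<lambda>t. F (\<gamma> t)) -` (- {0})"
  have op: "open ?U"
    by (intro continuous_open_preimage holomorphic_on_imp_continuous_on germ_holomorphic[OF F(1)]) auto
  have "t0 \<in> interior ?U" unfolding interior_open[OF op] using t0 by simp
  then have "t0 islimpt ?U" by (rule interior_limit_point)
  then have G0: "G (\<gamma> t) = 0" if "t \<in> ball 0 r" for t
    by (intro analytic_continuation[OF germ_holomorphic[OF G(1)] open_ball connected_ball _ t0(1) _ _ that, of ?U])
       (use no in auto)
  then show False using G(2) G0 by blast
qed

text \<open>A line through the base point has finite contact with the curve, which does not contain it.\<close>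

lemma line_nonzero:
  assumes cnl: "contains_no_line f" and l: "hform 1 l" "l w \<noteq> 0"
  shows "\<exists>t\<in>ball 0 r. l (\<gamma> t) \<noteq> 0"
proof (cases "l (\<gamma> 0) = 0")
  case True
  obtain b0 where b0: "l b0 = 0" "f b0 \<noteq> 0" using cnl l unfolding contains_no_line_def by blast
  have "f (\<gamma> 0) = 0" using on_curve[OF zero_in] by blast
  have "b0 \<noteq> 0"
  proof
    assume "b0 = 0"
    have "f (0 *s \<gamma> 0) = 0 ^ d * f (\<gamma> 0)" by (rule hform_scale[OF f(1)])
    then show False using b0(2) \<open>f (\<gamma> 0) = 0\<close> \<open>b0 = 0\<close> by simp
  qed
  obtain A B :: "complex^3^3" where AB: "A ** B = mat 1" "B ** A = mat 1" "\<And>v. (B *v v) $ 3 = l v" "A *v axis 2 1 = b0"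
    by (rule line_frame[OF l b0(1) \<open>b0 \<noteq> 0\<close>]) (rule that)
  obtain P where P: "\<And>s. poly P s = f (A *v axis 1 1 + s *s (A *v axis 2 1))" using hform_poly[OF f(1)] by metis
  interpret germ_and_line f d \<gamma> r l A B P
    by unfold_locales (use l True AB b0 P in auto)
  show ?thesis by (rule line_germ_nonzero)
next
  case False
  then show ?thesis using zero_in by blast
qed

end

section \<open>Three bitangents\<close>

locale three_bitangents =
  b1: bitangent_line Q lf1 D1 A1 B1 + b2: bitangent_line Q lf2 D2 A2 B2 + b3: bitangent_line Q lf3 D3 A3 B3
  for Q lf1 D1 A1 B1 lf2 D2 A2 B2 lf3 D3 A3 B3 +
  assumes ne: "zeros (peval lf1) \<noteq> zeros (peval lf2)" "zeros (peval lf1) \<noteq> zeros (peval lf3)"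
    "zeros (peval lf2) \<noteq> zeros (peval lf3)"
begin

abbreviation "f \<equiv> peval Q"
abbreviation "l1 \<equiv> peval lf1"
abbreviation "l2 \<equiv> peval lf2"
abbreviation "l3 \<equiv> peval lf3"

lemmas f = smooth_quartic_form[OF b1.Q]

lemma off:
  "v \<noteq> 0 \<Longrightarrow> l1 v = 0 \<Longrightarrow> l2 v = 0 \<Longrightarrow> f v \<noteq> 0"
  "v \<noteq> 0 \<Longrightarrow> l1 v = 0 \<Longrightarrow> l3 v = 0 \<Longrightarrow> f v \<noteq> 0"
  "v \<noteq> 0 \<Longrightarrow> l2 v = 0 \<Longrightarrow> l3 v = 0 \<Longrightarrow> f v \<noteq> 0"
  using bitangents_meet_off_quartic[OF b1.bitangent_line_axioms b2.bitangent_line_axioms ne(1)]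
    bitangents_meet_off_quartic[OF b1.bitangent_line_axioms b3.bitangent_line_axioms ne(2)]
    bitangents_meet_off_quartic[OF b2.bitangent_line_axioms b3.bitangent_line_axioms ne(3)] by blast+

lemma meet:
  obtains u v where "f u \<noteq> 0" "l1 u = 0" "l2 u = 0" "f v \<noteq> 0" "l1 v = 0" "l3 v = 0"
proof -
  have *: "\<exists>u. u \<noteq> 0 \<and> l u = 0 \<and> l' u = 0" if l: "hform 1 l" "l w \<noteq> 0" and l': "hform 1 l'" for l l' w
  proof -
    obtain p where p: "p \<in> zeros l" "p \<in> zeros l'" using lines_meet[OF l l'] by blast
    have "l (rep p) = 0" "l' (rep p) = 0"
      using p proj_in_zeros[OF l(1) rep(1)[of p]] proj_in_zeros[OF l' rep(1)[of p]] rep(2)[of p] by auto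
    then show ?thesis using rep(1) by blast
  qed
  obtain u where "u \<noteq> 0" "l1 u = 0" "l2 u = 0" using *[OF b1.l b1.l_nonzero b2.l] by blast
  moreover obtain v where "v \<noteq> 0" "l1 v = 0" "l3 v = 0" using *[OF b1.l b1.l_nonzero b3.l] by blast
  ultimately show ?thesis using that off by blast
qed

lemma points:
  obtains u12 u21 u13 u23 where "l2 u12 = 0" "l1 u12 \<noteq> 0" "l1 u21 = 0" "l2 u21 \<noteq> 0" "l3 u13 = 0" "l1 u13 \<noteq> 0"
    "l3 u23 = 0" "l2 u23 \<noteq> 0"
proof -
  obtain u12 where "l2 u12 = 0" "l1 u12 \<noteq> 0" using distinct_lines[OF b2.l b2.l_nonzero b1.l b1.l_nonzero] ne by metis
  moreover obtain u21 where "l1 u21 = 0" "l2 u21 \<noteq> 0" using distinct_lines[OF b1.l b1.l_nonzero b2.l b2.l_nonzero] ne by metis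
  moreover obtain u13 where "l3 u13 = 0" "l1 u13 \<noteq> 0" using distinct_lines[OF b3.l b3.l_nonzero b1.l b1.l_nonzero] ne by metis
  moreover obtain u23 where "l3 u23 = 0" "l2 u23 \<noteq> 0" using distinct_lines[OF b3.l b3.l_nonzero b2.l b2.l_nonzero] ne by metis
  ultimately show ?thesis using that by blast
qed

lemma divide_by_three_lines:
  assumes F: "hform (Suc (Suc n)) F" and 0: "\<And>v. l1 v = 0 \<or> l2 v = 0 \<or> l3 v = 0 \<Longrightarrow> F v = 0"
  obtains N where "hform n N" "\<And>v. F v = l1 v * (l2 v * N v)" "\<And>v. l3 v = 0 \<Longrightarrow> N v = 0"
proof -
  obtain u12 u21 u13 u23 where u: "l2 u12 = 0" "l1 u12 \<noteq> 0" "l1 u21 = 0" "l2 u21 \<noteq> 0" "l3 u13 = 0" "l1 u13 \<noteq> 0"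
    "l3 u23 = 0" "l2 u23 \<noteq> 0" by (rule points) (rule that)
  obtain N where N: "hform n N" "\<And>v. F v = l1 v * (l2 v * N v)"
    by (rule divide_by_two_lines[OF F b1.l b2.l u(1,2,4)]) (use 0 in auto)
  have lN: "hform (Suc n) (\<lambda>v. l2 v * N v)" using hform_mult[OF b2.l N(1)] by simp
  have "l2 v * N v = 0" if "l3 v = 0" for v
    by (rule cancel_on_plane[OF lN b1.l b3.l u(5,6) _ that]) (use 0 N(2) in metis)
  then have "N v = 0" if "l3 v = 0" for v
    by (intro cancel_on_plane[OF N(1) b2.l b3.l u(7,8) _ that])
  with N that show ?thesis by blast
qed

text \<open>A conic through the tangent points is \<open>k1\<close>, \<open>k2\<close> and \<open>k3\<close> times the square root of \<open>f\<close> on the three lines,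
  and in the points of intersection, where \<open>f\<close> does not vanish, its square shows that the \<open>k\<close> agree up
  to sign. They are nonzero, since a conic that contains three lines vanishes identically; after
  division by \<open>k1\<close> the conic squares to \<open>f\<close> on the lines.\<close>

lemma square_of_conic:
  assumes C: "is_form 2 C" and c: "\<And>p. count (D1 + D2 + D3) p \<le> int_mult Q C p"
  obtains C0 where "hform 2 C0" "\<And>v. l1 v = 0 \<or> l2 v = 0 \<or> l3 v = 0 \<Longrightarrow> C0 v * C0 v = f v"
proof -
  have hC: "hform 2 (peval C)" using C by (rule form_hform)
  have cD: "count D1 p \<le> int_mult Q C p" "count D2 p \<le> int_mult Q C p" "count D3 p \<le> int_mult Q C p" for p
    using c[of p] by auto
  obtain k1 where k1: "\<And>v. l1 v = 0 \<Longrightarrow> peval C v = k1 * b1.g v" by (rule b1.conic_restrict[OF hC cD(1)]) (rule that)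
  obtain k2 where k2: "\<And>v. l2 v = 0 \<Longrightarrow> peval C v = k2 * b2.g v" by (rule b2.conic_restrict[OF hC cD(2)]) (rule that)
  obtain k3 where k3: "\<And>v. l3 v = 0 \<Longrightarrow> peval C v = k3 * b3.g v" by (rule b3.conic_restrict[OF hC cD(3)]) (rule that)
  have sq1: "peval C v * peval C v = (k1 * k1) * f v" if "l1 v = 0" for v
    using k1[OF that] b1.g_square[OF that] by (simp add: algebra_simps flip: b1.g_square[OF that])
  have sq2: "peval C v * peval C v = (k2 * k2) * f v" if "l2 v = 0" for v
    using k2[OF that] by (simp add: algebra_simps flip: b2.g_square[OF that])
  have sq3: "peval C v * peval C v = (k3 * k3) * f v" if "l3 v = 0" for v
    using k3[OF that] by (simp add: algebra_simps flip: b3.g_square[OF that])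
  obtain u v where uv: "f u \<noteq> 0" "l1 u = 0" "l2 u = 0" "f v \<noteq> 0" "l1 v = 0" "l3 v = 0" by (rule meet) (rule that)
  have k: "k2 * k2 = k1 * k1" "k3 * k3 = k1 * k1"
    using sq1[OF uv(2)] sq2[OF uv(3)] sq1[OF uv(5)] sq3[OF uv(6)] uv(1,4) by (metis mult_cancel_right)+
  have sq: "peval C v * peval C v = (k1 * k1) * f v" if "l1 v = 0 \<or> l2 v = 0 \<or> l3 v = 0" for v
    using that sq1[of v] sq2[of v] sq3[of v] k by auto
  have "k1 \<noteq> 0"
  proof
    assume "k1 = 0"
    then have 0: "peval C v = 0" if "l1 v = 0 \<or> l2 v = 0 \<or> l3 v = 0" for v using sq[OF that] by simp
    have hC': "hform (Suc (Suc 0)) (peval C)" using hC by (simp add: numeral_2_eq_2)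
    obtain N where N: "hform 0 N" "\<And>v. peval C v = l1 v * (l2 v * N v)" "\<And>v. l3 v = 0 \<Longrightarrow> N v = 0"
      by (rule divide_by_three_lines[OF hC' 0]) (use that in auto)
    obtain c where "N = (\<lambda>_. c)" using N(1) by (auto simp: hform.simps)
    then have "N = (\<lambda>_. 0)" using N(3)[of 0] hform_1_linear(4)[OF b3.l] by simp
    then have "peval C v = 0" for v using N(2) by simp
    moreover obtain v where "peval C v \<noteq> 0" by (rule form_nonzero[OF C]) auto
    ultimately show False by blast
  qed
  show ?thesis
  proof (rule that)
    show "hform 2 (\<lambda>v. inverse k1 * peval C v)" by (rule hform_cmult[OF hC])
    show "inverse k1 * peval C v * (inverse k1 * peval C v) = f v" if "l1 v = 0 \<or> l2 v = 0 \<or> l3 v = 0" for v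
      using sq[OF that] \<open>k1 \<noteq> 0\<close> by (simp add: field_simps)
  qed
qed

text \<open>The contact along each line is that of \<open>conic_contact\<close>, and the tangent points of different
  bitangents are different, so that the three divisors have disjoint supports. It has to be shown
  that the conic does not contain a piece of the quartic: the difference of \<open>f\<close> and the square of the
  conic is a product of four linear forms, the three lines and a nonzero form \<open>m\<close>, and none of these
  vanishes along the quartic.\<close>

lemma conic_of_square:
  assumes C0: "hform 2 C0" and sq: "\<And>v. l1 v = 0 \<or> l2 v = 0 \<or> l3 v = 0 \<Longrightarrow> C0 v * C0 v = f v"
  obtains C where "is_form 2 C" "\<And>p. count (D1 + D2 + D3) p \<le> int_mult Q C p"
proof -
  have fb: "f b1.b \<noteq> 0" using b1.fb unfolding b1.b_def .
  then have "C0 b1.b \<noteq> 0" using sq[of b1.b] b1.lab by auto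
  then obtain C where C: "is_form 2 C" "peval C = C0" using hform_2_ex_form[OF C0] by metis
  have hC: "hform 2 (peval C)" using C0 C(2) by simp
  have F: "hform (Suc (Suc 2)) (\<lambda>v. f v - C0 v * C0 v)"
    using hform_diff[OF f(1), of "\<lambda>v. C0 v * C0 v"] hform_mult[OF C0 C0] by (simp add: eval_nat_numeral)
  obtain N where N: "hform 2 N" "\<And>v. f v - C0 v * C0 v = l1 v * (l2 v * N v)" "\<And>v. l3 v = 0 \<Longrightarrow> N v = 0"
    by (rule divide_by_three_lines[OF F]) (use sq that in auto)
  have N': "hform (Suc 1) N" using N(1) by (simp add: numeral_2_eq_2)
  obtain m where m: "hform 1 m" "\<And>v. N v = l3 v * m v" using hform_dvd_linear[OF b3.l b3.l_nonzero N' N(3)] by blast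
  have F4: "f v = C0 v * C0 v + l1 v * (l2 v * (l3 v * m v))" for v using N(2)[of v] m(2)[of v] by (simp add: diff_eq_eq)
  \<comment> \<open>a smooth quartic is not the square of a conic\<close>
  have "\<exists>w. m w \<noteq> 0"
  proof (rule ccontr)
    assume "\<not> ?thesis"
    then have fC: "f v = C0 v * C0 v" for v using F4 by simp
    have C0': "hform (Suc 1) C0" using C0 by (simp add: numeral_2_eq_2)
    obtain v where "v \<noteq> 0" "C0 v = 0" using hform_zero_on_line[OF C0' b1.point_nz b1.b_nonzero] b1.point_nz b1.b_nonzero by blast
    then show False using smooth_product[OF f(1,2) C0 C0 fC] by blast
  qed
  then obtain w where w: "m w \<noteq> 0" by blast
  have nz: "\<exists>t\<in>ball 0 r. peval C (\<gamma> t) \<noteq> 0" if g: "curve_germ f 4 \<gamma> r" for \<gamma> r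
  proof -
    interpret G: curve_germ f 4 \<gamma> r by (rule g)
    note ln = G.line_nonzero[OF f(3)]
    have "\<exists>t\<in>ball 0 r. l3 (\<gamma> t) * m (\<gamma> t) \<noteq> 0"
      by (rule G.product_nonzero[OF b3.l ln[OF b3.l b3.l_nonzero] m(1) ln[OF m(1) w]])
    from G.product_nonzero[OF b2.l ln[OF b2.l b2.l_nonzero] hform_mult[OF b3.l m(1)] this]
    have "\<exists>t\<in>ball 0 r. l2 (\<gamma> t) * (l3 (\<gamma> t) * m (\<gamma> t)) \<noteq> 0" .
    from G.product_nonzero[OF b1.l ln[OF b1.l b1.l_nonzero] hform_mult[OF b2.l hform_mult[OF b3.l m(1)]] this]
    obtain t where t: "t \<in> ball 0 r" "l1 (\<gamma> t) * (l2 (\<gamma> t) * (l3 (\<gamma> t) * m (\<gamma> t))) \<noteq> 0" by blast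
    moreover have "f (\<gamma> t) = 0" using G.on_curve[OF t(1)] by blast
    ultimately have "C0 (\<gamma> t) \<noteq> 0" using F4[of "\<gamma> t"] by auto
    then show ?thesis using t(1) C(2) by blast
  qed
  have cc: "count D1 p \<le> int_mult Q C p" "count D2 p \<le> int_mult Q C p" "count D3 p \<le> int_mult Q C p" for p
    by (rule b1.conic_contact[OF hC _ nz] b2.conic_contact[OF hC _ nz] b3.conic_contact[OF hC _ nz];
        use sq C(2) in auto)+
  have "count (D1 + D2 + D3) p \<le> int_mult Q C p" for p
  proof -
    have "count D1 p = 0 \<or> count D2 p = 0" "count D1 p = 0 \<or> count D3 p = 0" "count D2 p = 0 \<or> count D3 p = 0"
      using b1.support[of p] b2.support[of p] b3.support[of p] off[OF rep(1)[of p]] by blast+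
    then show ?thesis using cc[of p] by auto
  qed
  with C(1) that show ?thesis by blast
qed

lemma section_of_square:
  assumes C0: "hform 2 C0" and sq: "\<And>v. l1 v = 0 \<or> l2 v = 0 \<or> l3 v = 0 \<Longrightarrow> C0 v * C0 v = f v"
  shows "\<exists>\<phi>. sec (qroot f) (zeros l1 \<union> zeros l2 \<union> zeros l3 - zeros f) \<phi>"
proof -
  let ?A = "zeros l1 \<union> zeros l2 \<union> zeros l3 - zeros f"
  have "C0 v * C0 v = f v" if "v \<noteq> 0" "proj v \<in> ?A" for v
    using that sq[of v] proj_in_zeros[OF b1.l that(1)] proj_in_zeros[OF b2.l that(1)] proj_in_zeros[OF b3.l that(1)] by blast
  then show ?thesis using sec_of_conic[OF f(1) C0, of ?A] by blast
qed

text \<open>On each line the section selects a square root of \<open>f\<close>; these agree in the points of intersection,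
  which are off the quartic, and so they come from one conic.\<close>

lemma square_of_section:
  assumes \<phi>: "sec (qroot f) (zeros l1 \<union> zeros l2 \<union> zeros l3 - zeros f) \<phi>"
  obtains C0 where "hform 2 C0" "\<And>v. l1 v = 0 \<or> l2 v = 0 \<or> l3 v = 0 \<Longrightarrow> C0 v * C0 v = f v"
proof -
  have \<phi>i: "sec (qroot f) (zeros l1 - zeros f) \<phi>" "sec (qroot f) (zeros l2 - zeros f) \<phi>" "sec (qroot f) (zeros l3 - zeros f) \<phi>"
    by (rule sec_subset[OF \<phi>]; blast)+
  obtain g1 where g1: "hform 2 g1" "\<And>v. l1 v = 0 \<Longrightarrow> g1 v * g1 v = f v"
    "\<And>v. v \<noteq> 0 \<Longrightarrow> l1 v = 0 \<Longrightarrow> f v \<noteq> 0 \<Longrightarrow> \<phi> (proj v) *\<^sub>R qroot f (proj v) = outer v (g1 v)"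
    by (rule root_of_sec[OF f(1,3) b1.l b1.l_nonzero b1.g_form b1.g_square \<phi>i(1)]) (use that in auto)
  obtain g2 where g2: "hform 2 g2" "\<And>v. l2 v = 0 \<Longrightarrow> g2 v * g2 v = f v"
    "\<And>v. v \<noteq> 0 \<Longrightarrow> l2 v = 0 \<Longrightarrow> f v \<noteq> 0 \<Longrightarrow> \<phi> (proj v) *\<^sub>R qroot f (proj v) = outer v (g2 v)"
    by (rule root_of_sec[OF f(1,3) b2.l b2.l_nonzero b2.g_form b2.g_square \<phi>i(2)]) (use that in auto)
  obtain g3 where g3: "hform 2 g3" "\<And>v. l3 v = 0 \<Longrightarrow> g3 v * g3 v = f v"
    "\<And>v. v \<noteq> 0 \<Longrightarrow> l3 v = 0 \<Longrightarrow> f v \<noteq> 0 \<Longrightarrow> \<phi> (proj v) *\<^sub>R qroot f (proj v) = outer v (g3 v)"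
    by (rule root_of_sec[OF f(1,3) b3.l b3.l_nonzero b3.g_form b3.g_square \<phi>i(3)]) (use that in auto)
  have zero: "g 0 = 0" if "hform 2 g" for g using hform_scale[OF that, of 0 0] by simp
  have agree: "g1 v = g2 v" if "l1 v = 0" "l2 v = 0" for v
  proof (cases "v = 0")
    case False
    show ?thesis
      by (rule outer_inject[OF False])
         (use off(1)[OF False that] g1(2,3)[of v] g2(2,3)[of v] that False in auto)
  qed (simp add: zero[OF g1(1)] zero[OF g2(1)])
  have agree': "g1 v = g3 v" if "l1 v = 0" "l3 v = 0" for v
  proof (cases "v = 0")
    case False
    show ?thesis
      by (rule outer_inject[OF False])
         (use off(2)[OF False that] g1(2,3)[of v] g3(2,3)[of v] that False in auto)
  qed (simp add: zero[OF g1(1)] zero[OF g3(1)])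
  have agree'': "g2 v = g3 v" if "l2 v = 0" "l3 v = 0" for v
  proof (cases "v = 0")
    case False
    show ?thesis
      by (rule outer_inject[OF False])
         (use off(3)[OF False that] g2(2,3)[of v] g3(2,3)[of v] that False in auto)
  qed (simp add: zero[OF g2(1)] zero[OF g3(1)])
  obtain u12 u21 u13 u23 where u: "l2 u12 = 0" "l1 u12 \<noteq> 0" "l1 u21 = 0" "l2 u21 \<noteq> 0" "l3 u13 = 0" "l1 u13 \<noteq> 0"
    "l3 u23 = 0" "l2 u23 \<noteq> 0" by (rule points) (rule that)
  show ?thesis
    by (rule conic_on_three_lines[OF f(1) b1.l b2.l b3.l u b3.l_nonzero off(2,3) g1(1) g2(1) g3(1) g1(2) g2(2) g3(2)
          agree agree' agree'']) (use that in auto)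
qed

end

text \<open>Both sides are equivalent to the existence of a conic whose square is \<open>f\<close> on the three lines.\<close>

lemma conic_iff_section:
  assumes Q: "smooth_quartic Q" and M: "M1 \<in> bitangents Q" "M2 \<in> bitangents Q" "M3 \<in> bitangents Q"
    and ne: "M1 \<noteq> M2" "M1 \<noteq> M3" "M2 \<noteq> M3"
  shows "(\<exists>D1 D2 D3 C. tangency_divisor Q M1 D1 \<and> tangency_divisor Q M2 D2 \<and> tangency_divisor Q M3 D3 \<and>
      is_form 2 C \<and> (\<forall>p. count (D1 + D2 + D3) p \<le> int_mult Q C p)) \<longleftrightarrow>
    (\<exists>\<phi>. sec (qroot (peval Q)) (\<Union>{M1, M2, M3} - zeros (peval Q)) \<phi>)" (is "?L \<longleftrightarrow> ?R")
proof -
  have ex: "\<exists>lf1 A1 B1 lf2 A2 B2 lf3 A3 B3. three_bitangents Q lf1 D1 A1 B1 lf2 D2 A2 B2 lf3 D3 A3 B3 \<and>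
      \<Union>{M1, M2, M3} = zeros (peval lf1) \<union> zeros (peval lf2) \<union> zeros (peval lf3)"
    if D: "tangency_divisor Q M1 D1" "tangency_divisor Q M2 D2" "tangency_divisor Q M3 D3" for D1 D2 D3
  proof -
    obtain lf1 A1 B1 where 1: "bitangent_line Q lf1 D1 A1 B1" "M1 = zeros (peval lf1)"
      by (rule bitangent_line_exists[OF Q D(1)]) (rule that)
    obtain lf2 A2 B2 where 2: "bitangent_line Q lf2 D2 A2 B2" "M2 = zeros (peval lf2)"
      by (rule bitangent_line_exists[OF Q D(2)]) (rule that)
    obtain lf3 A3 B3 where 3: "bitangent_line Q lf3 D3 A3 B3" "M3 = zeros (peval lf3)"
      by (rule bitangent_line_exists[OF Q D(3)]) (rule that)
    have "three_bitangents Q lf1 D1 A1 B1 lf2 D2 A2 B2 lf3 D3 A3 B3"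
      using 1 2 3 ne by (intro three_bitangents.intro three_bitangents_axioms.intro) auto
    moreover have "\<Union>{M1, M2, M3} = zeros (peval lf1) \<union> zeros (peval lf2) \<union> zeros (peval lf3)" using 1 2 3 by blast
    ultimately show ?thesis by blast
  qed
  show ?thesis
  proof
    assume ?L
    then obtain D1 D2 D3 C where D: "tangency_divisor Q M1 D1" "tangency_divisor Q M2 D2" "tangency_divisor Q M3 D3"
      and C: "is_form 2 C" "\<And>p. count (D1 + D2 + D3) p \<le> int_mult Q C p" by blast
    obtain lf1 A1 B1 lf2 A2 B2 lf3 A3 B3 where
      T: "three_bitangents Q lf1 D1 A1 B1 lf2 D2 A2 B2 lf3 D3 A3 B3"
      and U: "\<Union>{M1, M2, M3} = zeros (peval lf1) \<union> zeros (peval lf2) \<union> zeros (peval lf3)" using ex[OF D] by metis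
    interpret three_bitangents Q lf1 D1 A1 B1 lf2 D2 A2 B2 lf3 D3 A3 B3 by (rule T)
    obtain C0 where "hform 2 C0" "\<And>v. l1 v = 0 \<or> l2 v = 0 \<or> l3 v = 0 \<Longrightarrow> C0 v * C0 v = f v"
      by (rule square_of_conic[OF C]) (use that in auto)
    then show ?R unfolding U by (rule section_of_square)
  next
    assume ?R
    then obtain \<phi> where \<phi>: "sec (qroot (peval Q)) (\<Union>{M1, M2, M3} - zeros (peval Q)) \<phi>" by blast
    obtain D1 D2 D3 where D: "tangency_divisor Q M1 D1" "tangency_divisor Q M2 D2" "tangency_divisor Q M3 D3"
      using M unfolding bitangents_def by blast
    obtain lf1 A1 B1 lf2 A2 B2 lf3 A3 B3 where
      T: "three_bitangents Q lf1 D1 A1 B1 lf2 D2 A2 B2 lf3 D3 A3 B3"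
      and U: "\<Union>{M1, M2, M3} = zeros (peval lf1) \<union> zeros (peval lf2) \<union> zeros (peval lf3)" using ex[OF D] by metis
    interpret three_bitangents Q lf1 D1 A1 B1 lf2 D2 A2 B2 lf3 D3 A3 B3 by (rule T)
    obtain C0 where C0: "hform 2 C0" "\<And>v. l1 v = 0 \<or> l2 v = 0 \<or> l3 v = 0 \<Longrightarrow> C0 v * C0 v = f v"
      by (rule square_of_section[OF \<phi>[unfolded U]]) (use that in auto)
    obtain C where "is_form 2 C" "\<And>p. count (D1 + D2 + D3) p \<le> int_mult Q C p"
      by (rule conic_of_square[OF C0]) (use that in auto)
    with D show ?L by blast
  qed
qed

section \<open>The two-graph of a quartic with bitangents\<close>

lemma associated_two_graph_section:
  assumes Q: "smooth_quartic Q" and \<L>: "\<L> \<subseteq> bitangents Q"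
  shows "associated_two_graph Q \<L> = (\<L>, {T. T \<subseteq> \<L> \<and> card T = 3 \<and>
    (\<exists>\<phi>. sec (qroot (peval Q)) (\<Union>T - zeros (peval Q)) \<phi>)})"
proof -
  let ?S = "\<lambda>T. \<exists>\<phi>. sec (qroot (peval Q)) (\<Union>T - zeros (peval Q)) \<phi>"
  define conic where "conic M1 M2 M3 \<longleftrightarrow> (\<exists>D1 D2 D3 C. tangency_divisor Q M1 D1 \<and> tangency_divisor Q M2 D2 \<and> tangency_divisor Q M3 D3 \<and>
        is_form 2 C \<and> (\<forall>p. count (D1 + D2 + D3) p \<le> int_mult Q C p))" for M1 M2 M3
  have graph: "associated_two_graph Q \<L> = (\<L>, {{M1, M2, M3} | M1 M2 M3. M1 \<in> \<L> \<and> M2 \<in> \<L> \<and> M3 \<in> \<L> \<and>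
      M1 \<noteq> M2 \<and> M1 \<noteq> M3 \<and> M2 \<noteq> M3 \<and> conic M1 M2 M3})"
    unfolding associated_two_graph_def conic_def ..
  note iff = conic_iff_section[OF Q, folded conic_def]
  have "T \<in> snd (associated_two_graph Q \<L>) \<longleftrightarrow> T \<subseteq> \<L> \<and> card T = 3 \<and> ?S T" for T
  proof
    assume "T \<in> snd (associated_two_graph Q \<L>)"
    then obtain M1 M2 M3 where M: "T = {M1, M2, M3}" "M1 \<in> \<L>" "M2 \<in> \<L>" "M3 \<in> \<L>" "M1 \<noteq> M2" "M1 \<noteq> M3" "M2 \<noteq> M3"
      and ex: "conic M1 M2 M3"
      unfolding graph by auto
    have "M1 \<in> bitangents Q" "M2 \<in> bitangents Q" "M3 \<in> bitangents Q" using M(2-4) \<L> by auto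
    from iffD1[OF iff[OF this M(5-7)] ex] have "?S {M1, M2, M3}" .
    then show "T \<subseteq> \<L> \<and> card T = 3 \<and> ?S T" using M by simp
  next
    assume R: "T \<subseteq> \<L> \<and> card T = 3 \<and> ?S T"
    then obtain M1 M2 M3 where M: "T = {M1, M2, M3}" "M1 \<noteq> M2" "M2 \<noteq> M3" "M1 \<noteq> M3" unfolding card_3_iff by blast
    then have in\<L>: "M1 \<in> \<L>" "M2 \<in> \<L>" "M3 \<in> \<L>" using R by auto
    have bit: "M1 \<in> bitangents Q" "M2 \<in> bitangents Q" "M3 \<in> bitangents Q" using in\<L> \<L> by auto
    have ex: "conic M1 M2 M3"
      by (rule iffD2[OF iff[OF bit M(2,4,3)]]) (use R M(1) in simp)
    show "T \<in> snd (associated_two_graph Q \<L>)"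
      unfolding graph snd_conv mem_Collect_eq
      by (intro exI[of _ M1] exI[of _ M2] exI[of _ M3] conjI M in\<L> ex)
  qed
  then have "snd (associated_two_graph Q \<L>) = {T. T \<subseteq> \<L> \<and> card T = 3 \<and> ?S T}" by blast
  moreover have "fst (associated_two_graph Q \<L>) = \<L>" by (simp add: associated_two_graph_def)
  ultimately show ?thesis by (metis prod.collapse)
qed

lemma bitangent_is_line:
  assumes "smooth_quartic Q" "M \<in> bitangents Q"
  shows "\<exists>l. line M l"
proof -
  obtain D where "tangency_divisor Q M D" using assms(2) unfolding bitangents_def by blast
  then obtain lf A B where b: "bitangent_line Q lf D A B" "M = zeros (peval lf)"
    using bitangent_line_exists[OF assms(1)] by metis
  then show ?thesis unfolding line_def using bitangent_line.l[OF b(1)] bitangent_line.l_nonzero[OF b(1)] by blast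
qed

text \<open>The bijection of the two-graphs sends a bitangent to its image under \<open>h\<close>. It respects the triples, as
  by \<open>associated_two_graph_section\<close> these are described by sections of the double cover, which \<open>h\<close> and
  its inverse pull back.\<close>

lemma homeo_two_graph_equivalent:
  assumes Q: "smooth_quartic Q" and fin: "finite \<L>1" "finite \<L>2"
    and \<L>: "\<L>1 \<subseteq> bitangents Q" "\<L>2 \<subseteq> bitangents Q"
    and hom: "homeomorphic_pairs UNIV (quartic_with_lines Q \<L>1) UNIV (quartic_with_lines Q \<L>2)"
  shows "two_graph_equivalent (associated_two_graph Q \<L>1) (associated_two_graph Q \<L>2)"
proof -
  let ?f = "peval Q"
  note f = smooth_quartic_form[OF Q]
  obtain w where w: "?f w \<noteq> 0"
  proof -
    have "\<exists>w :: complex^3. w $ 1 \<noteq> 0" by (rule exI[of _ "axis 1 1"]) simp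
    from f(3)[unfolded contains_no_line_def, rule_format, OF hform_coord this] obtain v where "?f v \<noteq> 0" by blast
    then show ?thesis by (rule that)
  qed
  from hom[unfolded homeomorphic_pairs_def quartic_with_lines_def curve_zeros]
  obtain h g where h: "homeomorphism UNIV UNIV h g" and im: "h ` (zeros ?f \<union> \<Union>\<L>1) = zeros ?f \<union> \<Union>\<L>2"
    by (elim exE conjE) (rule that)
  have g: "homeomorphism UNIV UNIV g h" using h by (rule homeomorphism_symD)
  have gh: "g (h p) = p" "h (g p) = p" for p using h unfolding homeomorphism_def by auto
  have ghi: "g ` (h ` X) = X" "h ` (g ` X) = X" for X by (simp_all add: image_image gh)
  have img: "g ` (zeros ?f \<union> \<Union>\<L>2) = zeros ?f \<union> \<Union>\<L>1" unfolding im[symmetric] ghi ..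
  have lines: "\<exists>l. line M l" if "M \<in> \<L>1 \<or> M \<in> \<L>2" for M using bitangent_is_line[OF Q] \<L> that by blast
  have hQ: "h ` zeros ?f = zeros ?f" and hL: "\<And>L. L \<in> \<L>1 \<Longrightarrow> h ` L \<in> \<L>2"
    using homeo_preserves_components[OF f fin(1) _ fin(2) _ h im] lines by blast+
  have gQ: "g ` zeros ?f = zeros ?f" and gL: "\<And>L. L \<in> \<L>2 \<Longrightarrow> g ` L \<in> \<L>1"
    using homeo_preserves_components[OF f fin(2) _ fin(1) _ g img] lines by blast+
  have inj: "inj ((`) h)" by (metis ghi(1) injI)
  have bij: "bij_betw ((`) h) \<L>1 \<L>2"
  proof (rule bij_betw_imageI)
    show "inj_on ((`) h) \<L>1" using inj by (rule inj_on_subset) simp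
    show "(`) h ` \<L>1 = \<L>2" using hL gL ghi(2) by (metis (no_types, lifting) image_subset_iff subsetI subset_antisym image_eqI)
  qed
  have injh: "inj h" by (metis gh(1) injI)
  have sec: "(\<exists>\<phi>. sec (qroot ?f) (\<Union>T - zeros ?f) \<phi>) \<longleftrightarrow> (\<exists>\<phi>. sec (qroot ?f) (\<Union>((`) h ` T) - zeros ?f) \<phi>)" for T
  proof -
    have U: "\<Union>((`) h ` T) - zeros ?f = h ` (\<Union>T - zeros ?f)"
      by (subst hQ[symmetric]) (simp only: image_set_diff[OF injh] image_Union)
    show ?thesis
    proof
      assume "\<exists>\<phi>. sec (qroot ?f) (\<Union>((`) h ` T) - zeros ?f) \<phi>"
      then show "\<exists>\<phi>. sec (qroot ?f) (\<Union>T - zeros ?f) \<phi>"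
        unfolding U using qroot_sec_homeo[OF f(1,2) w h hQ] by blast
    next
      assume "\<exists>\<phi>. sec (qroot ?f) (\<Union>T - zeros ?f) \<phi>"
      then obtain \<phi> where "sec (qroot ?f) (g ` (\<Union>((`) h ` T) - zeros ?f)) \<phi>" unfolding U ghi by blast
      from qroot_sec_homeo[OF f(1,2) w g gQ this]
      show "\<exists>\<phi>. sec (qroot ?f) (\<Union>((`) h ` T) - zeros ?f) \<phi>" by blast
    qed
  qed
  have triple: "{a, b, c} \<subseteq> \<L>1 \<and> card {a, b, c} = 3 \<and> (\<exists>\<phi>. sec (qroot ?f) (\<Union>{a, b, c} - zeros ?f) \<phi>) \<longleftrightarrow>
      {h ` a, h ` b, h ` c} \<subseteq> \<L>2 \<and> card {h ` a, h ` b, h ` c} = 3 \<and>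
      (\<exists>\<phi>. sec (qroot ?f) (\<Union>{h ` a, h ` b, h ` c} - zeros ?f) \<phi>)"
    if "a \<in> \<L>1" "b \<in> \<L>1" "c \<in> \<L>1" for a b c
  proof -
    have "card ((`) h ` {a, b, c}) = card {a, b, c}" by (rule card_image[OF inj_on_subset[OF inj]]) simp
    then show ?thesis using that hL sec[of "{a, b, c}"] by simp
  qed
  then show ?thesis
    unfolding associated_two_graph_section[OF Q \<L>(1)] associated_two_graph_section[OF Q \<L>(2)]
      two_graph_equivalent_def prod.case mem_Collect_eq
    by (intro exI[of _ "(`) h"] conjI bij ballI triple)
qed

theorem theorem1p1:
  fixes Q :: ternary_poly and L :: "nat \<Rightarrow> cp2 set" and I\<^sub>1 I\<^sub>2 :: "nat set"
  assumes "smooth_quartic Q"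
    and "bij_betw L {1..28} (bitangents Q)"
    and "I\<^sub>1 \<subseteq> {1..28}" and "I\<^sub>2 \<subseteq> {1..28}"
    and "\<not> two_graph_equivalent (associated_two_graph Q (L ` I\<^sub>1)) (associated_two_graph Q (L ` I\<^sub>2))"
  shows "\<not> homeomorphic_pairs UNIV (quartic_with_lines Q (L ` I\<^sub>1)) UNIV (quartic_with_lines Q (L ` I\<^sub>2)) \<and>
    (same_combinatorial_type (quartic_with_lines Q (L ` I\<^sub>1)) (quartic_with_lines Q (L ` I\<^sub>2)) \<longrightarrow>
     zariski_pair (quartic_with_lines Q (L ` I\<^sub>1)) (quartic_with_lines Q (L ` I\<^sub>2)))"
proof -
  have fin: "finite (L ` I\<^sub>1)" "finite (L ` I\<^sub>2)"
    using assms(3,4) by (auto intro: finite_subset)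
  have sub: "L ` I\<^sub>1 \<subseteq> bitangents Q" "L ` I\<^sub>2 \<subseteq> bitangents Q"
    using assms(2-4) unfolding bij_betw_def by auto
  have "\<not> homeomorphic_pairs UNIV (quartic_with_lines Q (L ` I\<^sub>1)) UNIV (quartic_with_lines Q (L ` I\<^sub>2))"
    using homeo_two_graph_equivalent[OF assms(1) fin sub] assms(5) by blast
  then show ?thesis unfolding zariski_pair_def by blast
qed

end
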